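(* Let $E$ be a finite set and let $\lambda : E\to\mathbf{R}_+$ be a generic length function such that $\mathrm{Pol}(E,\lambda)\neq\emptyset$. Let $\mathcal{I}$ be a full bending set such that $\dim T_{\mathcal{I}}<|E|-3$. Then $T_{\mathcal{I}}$ is a maximal bending torus if and only if $$\bigcap_{J\in\mathcal{M}_{\mathcal{I}}}\mathrm{Image}(f_J)\neq\emptyset .$$
   Context: For a finite set $E$ and a function $\lambda:E\to\mathbf{R}_+$ with strictly positive values (the length function), put $\widetilde{\mathrm{Pol}}(E,\lambda)=\{\rho:E\to\mathbf{R}^3 \mid \sum_{e\in E}\rho(e)=0,\ |\rho(e)|=\lambda(e)\ \forall e\in E\}$ and $\mathrm{Pol}(E,\lambda)=\widetilde{\mathrm{Pol}}(E,\lambda)/SO(3)$ (the polygon space). $\lambda$ is generic if there is no $\varepsilon:E\to\{\pm1\}$ with $\sum_{e\in E}\varepsilon(e)\lambda(e)=0$. For $\lambda$ generic and $\mathrm{Pol}(E,\lambda)\ne\emptyset$, $\mathrm{Pol}(E,\lambda)$ is a closed smooth symplectic manifold of dimension $2(|E|-3)$; its symplectic structure is that of the symplectic reduction at $0$ of $\prod_{e\in E}\mathcal{O}(\lambda(e))$ by the diagonal action of $SO(3)$, where $\mathcal{O}(s)$ is the coadjoint orbit of $SO(3)$ identified with the sphere of radius $s$ centered at $0$ in $\mathfrak{so}(3)^*\cong\mathbf{R}^3$, and the moment map is $(z_e)\mapsto\sum_{e\in E} z_e$. A subset $I\subset E$ is lopsided if there is $e_0\in I$ with $\lambda(e_0)>\sum_{e\in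 I-\{e_0\}}\lambda(e)$ (every singleton is lopsided). For $I\subset E$ let $f_I:\mathrm{Pol}(E,\lambda)\to\mathbf{R}$ be $f_I(\rho)=|\sum_{e\in I}\rho(e)|$. If $I$ is lopsided, $f_I$ is nowhere zero and smooth; its Hamiltonian flow $\Phi_I^t$ is the bending flow associated to $I$; it is periodic and rotates the vectors $\{\rho(e)\mid e\in I\}$ at constant speed around the axis $\rho_I=\sum_{e\in I}\rho(e)$. A Hamiltonian torus is a sub-torus of the group of symplectomorphisms of $\mathrm{Pol}(E,\lambda)$ (acting in a Hamiltonian fashion). A bending torus is a Hamiltonian torus generated by bending flows of lopsided subsets (the trivial torus, of dimension $0$, is allowed); it is a maximal bending torus if it is maximal for inclusion among bending tori. A bending set is a set $\mathcal{I}$ of lopsided subsets of $E$ which contains every singleton $\{e\}$, $e\in E$, and such that for all $A,B\in\mathcal{I}$ either $A\cap B=\emptyset$ or one of $A,B$ is contained in the other. The bending flows $\{\Phi_I^t\mid I\in\mathcal{I}\}$ of a bending set commute and generate a bending torus, denoted $T_{\mathcal{I}}$. $\mathcal{M}_{\mathcal{I}}$ denotes the family of elements of $\mathcal{I}$ that are maximal for inclusion; it is a partition of $E$. A bending set $\mathcal{I}$ is full if each $I\in\mathcal{I}$ which is not a singleton is the disjoint union of two elements $I',I''\in\mathcal{I}$. *)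

theory Defs
  imports "HOL-Analysis.Analysis" "HOL-Algebra.Bij" "HOL-Algebra.Generated_Groups"
begin

(* The finite set E is the universe of a type 'e of class finite, so that a configuration
   rho : E -> R^3 is an element of the Euclidean space real^3^'e.  (The empty set, which is not
   the universe of a type, carries no generic length function.) *)

section \<open>Polygon spaces\<close>

definition generic :: "('e::finite \<Rightarrow> real) \<Rightarrow> bool" where
  "generic len \<longleftrightarrow>
     (\<nexists>\<epsilon> :: 'e \<Rightarrow> real. (\<forall>e. \<epsilon> e \<in> {-1, 1}) \<and> (\<Sum>e\<in>UNIV. \<epsilon> e * len e) = 0)"

definition closed_polygons :: "('e::finite \<Rightarrow> real) \<Rightarrow> (real^3^'e) set" where
  "closed_polygons len = {\<rho>. (\<Sum>e\<in>UNIV. \<rho> $ e) = 0 \<and> (\<forall>e. norm (\<rho> $ e) = len e)}"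

definition SO3_orbit :: "real^3^'e::finite \<Rightarrow> (real^3^'e) set" where
  "SO3_orbit \<rho> = {(\<chi> e. A *v (\<rho> $ e)) | A. rotation_matrix A}"

definition Pol :: "('e::finite \<Rightarrow> real) \<Rightarrow> (real^3^'e) set set" where
  "Pol len = SO3_orbit ` closed_polygons len"

definition bend_length :: "'e set \<Rightarrow> (real^3^'e::finite) set \<Rightarrow> real" where
  "bend_length I p = the_elem ((\<lambda>\<rho>. norm (\<Sum>e\<in>I. \<rho> $ e)) ` p)"

lemma bend_length_SO3_orbit: "bend_length I (SO3_orbit \<rho>) = norm (\<Sum>e\<in>I. \<rho> $ e)"
proof -
  have "norm (\<Sum>e\<in>I. A *v (\<rho> $ e)) = norm (\<Sum>e\<in>I. \<rho> $ e)" if "rotation_matrix A" for A :: "real^3^3"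
  proof -
    have "(\<Sum>e\<in>I. A *v (\<rho> $ e)) = A *v (\<Sum>e\<in>I. \<rho> $ e)"
      by (simp add: linear_sum[OF matrix_vector_mul_linear])
    moreover have "orthogonal_transformation ((*v) A)"
      using that by (simp add: rotation_matrix_def orthogonal_transformation_matrix)
    ultimately show ?thesis
      by (simp add: orthogonal_transformation_norm)
  qed
  moreover have "rotation_matrix (mat 1 :: real^3^3)"
    by (simp add: rotation_matrix_def orthogonal_matrix_id)
  ultimately have "(\<lambda>\<rho>. norm (\<Sum>e\<in>I. \<rho> $ e)) ` SO3_orbit \<rho> = {norm (\<Sum>e\<in>I. \<rho> $ e)}"
    unfolding SO3_orbit_def by (auto simp: image_iff intro!: exI)
  then show ?thesis
    by (simp add: bend_length_def)
qed


section \<open>Smooth functions on the polygon space\<close>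

(* Meant for open S in a finite-dimensional space, where it is the usual C^k: all iterated
   directional derivatives up to order k exist and are continuous. *)
primrec Ck_on ::
    "nat \<Rightarrow> ('a::real_normed_vector \<Rightarrow> 'b::real_normed_vector) \<Rightarrow> 'a set \<Rightarrow> bool" where
  "Ck_on 0 f S \<longleftrightarrow> continuous_on S f"
| "Ck_on (Suc k) f S \<longleftrightarrow>
     (\<forall>x\<in>S. f differentiable (at x)) \<and> (\<forall>v. Ck_on k (\<lambda>x. frechet_derivative f (at x) v) S)"

(* For generic len, closed_polygons len is a closed submanifold of (R^3)^E on which SO(3) acts
   freely, so the smooth functions on Pol len are the functions whose pullback to
   closed_polygons len extends, near each point, to a smooth function on an open set. *)
definition Pol_smooth ::
    "('e::finite \<Rightarrow> real) \<Rightarrow> ((real^3^'e) set \<Rightarrow> real) \<Rightarrow> bool" where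
  "Pol_smooth len F \<longleftrightarrow>
     (\<forall>\<rho>\<in>closed_polygons len. \<exists>U g. open U \<and> \<rho> \<in> U \<and> (\<forall>k. Ck_on k g U) \<and>
        (\<forall>\<sigma>\<in>U \<inter> closed_polygons len. F (SO3_orbit \<sigma>) = g \<sigma>))"


section \<open>The reduced symplectic form\<close>

(* The Kirillov-Kostant-Souriau form on the sphere of radius s, viewed as a coadjoint orbit, is
   omega_z (xi x z, eta x z) = z . (xi x eta).  For tangent vectors u, v at z (orthogonal to z)
   this reads omega_z (u, v) = z . (u x v) / |z|^2.  The form below is the sum of these over the
   factors; with d J = omega (X_J, -) the moment map of the diagonal action is z \<mapsto> sum of z_e. *)
definition KKS_form :: "real^3^'e::finite \<Rightarrow> real^3^'e \<Rightarrow> real^3^'e \<Rightarrow> real" where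
  "KKS_form \<rho> u v = (\<Sum>e\<in>UNIV. (\<rho> $ e) \<bullet> cross3 (u $ e) (v $ e) / (norm (\<rho> $ e))\<^sup>2)"

definition curve_through ::
    "('e::finite \<Rightarrow> real) \<Rightarrow> (real \<Rightarrow> real^3^'e) \<Rightarrow> real^3^'e \<Rightarrow> real^3^'e \<Rightarrow> bool" where
  "curve_through len c \<rho> u \<longleftrightarrow>
     (\<forall>t. c t \<in> closed_polygons len) \<and> c 0 = \<rho> \<and> (c has_vector_derivative u) (at 0)"

(* The reduced form on Pol len pulls back to the restriction of KKS_form to the zero level
   closed_polygons len.  A tangent vector of Pol len is therefore represented by the velocity of a
   curve in the level; such a velocity u represents the Hamiltonian vector of F when
   d F (w) = omega (u, w) for every velocity w at the same point. *)
definition hamiltonian_vector ::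
    "('e::finite \<Rightarrow> real) \<Rightarrow> ((real^3^'e) set \<Rightarrow> real) \<Rightarrow> real^3^'e \<Rightarrow> real^3^'e \<Rightarrow> bool" where
  "hamiltonian_vector len F \<rho> u \<longleftrightarrow>
     (\<forall>b w. curve_through len b \<rho> w \<longrightarrow>
        ((\<lambda>s. F (SO3_orbit (b s))) has_real_derivative KKS_form \<rho> u w) (at 0))"

(* For every p, the path t \<mapsto> \<Phi> t p starts at p and is an integral curve of the Hamiltonian vector
   field of F: at each time it has a lift to the level which is differentiable at that time and
   whose velocity there represents the Hamiltonian vector.  The lift is only determined up to
   SO(3), hence its velocity up to an orbit direction, which is in the kernel of the restricted
   form. *)
definition is_hamiltonian_flow ::
    "('e::finite \<Rightarrow> real) \<Rightarrow> ((real^3^'e) set \<Rightarrow> real) \<Rightarrow>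
     (real \<Rightarrow> (real^3^'e) set \<Rightarrow> (real^3^'e) set) \<Rightarrow> bool" where
  "is_hamiltonian_flow len F \<Phi> \<longleftrightarrow>
     (\<forall>t. \<Phi> t \<in> Bij (Pol len)) \<and>
     (\<forall>p\<in>Pol len. \<Phi> 0 p = p \<and>
        (\<forall>t. \<exists>c \<rho> u. curve_through len c \<rho> u \<and> (\<forall>s. SO3_orbit (c s) = \<Phi> (t + s) p) \<and>
           hamiltonian_vector len F \<rho> u))"

(* Pol len being compact, a smooth F has exactly one Hamiltonian flow. *)
definition hamiltonian_flow ::
    "('e::finite \<Rightarrow> real) \<Rightarrow> ((real^3^'e) set \<Rightarrow> real) \<Rightarrow>
     real \<Rightarrow> (real^3^'e) set \<Rightarrow> (real^3^'e) set" where
  "hamiltonian_flow len F = (THE \<Phi>. is_hamiltonian_flow len F \<Phi>)"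

(* The differential of \<phi> maps the class of u at the orbit of \<rho> to the class of w at the orbit of
   \<sigma>, expressed through lifted curves. *)
definition tangent_mapsto ::
    "('e::finite \<Rightarrow> real) \<Rightarrow> ((real^3^'e) set \<Rightarrow> (real^3^'e) set) \<Rightarrow>
     real^3^'e \<Rightarrow> real^3^'e \<Rightarrow> real^3^'e \<Rightarrow> real^3^'e \<Rightarrow> bool" where
  "tangent_mapsto len \<phi> \<rho> u \<sigma> w \<longleftrightarrow>
     (\<exists>b c. curve_through len b \<rho> u \<and> curve_through len c \<sigma> w \<and>
        (\<forall>t. SO3_orbit (c t) = \<phi> (SO3_orbit (b t))))"

(* Smoothness of a bijection and of its inverse is tested on pullbacks of smooth functions. *)
definition symplectomorphisms ::
    "('e::finite \<Rightarrow> real) \<Rightarrow> ((real^3^'e) set \<Rightarrow> (real^3^'e) set) set" where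
  "symplectomorphisms len =
     {\<phi> \<in> Bij (Pol len).
        (\<forall>F. Pol_smooth len F \<longrightarrow> Pol_smooth len (\<lambda>p. F (\<phi> p))) \<and>
        (\<forall>F. Pol_smooth len F \<longrightarrow> Pol_smooth len (\<lambda>p. F (inv_into (Pol len) \<phi> p))) \<and>
        (\<forall>\<rho> \<sigma> u u' w w'.
           tangent_mapsto len \<phi> \<rho> u \<sigma> w \<longrightarrow> tangent_mapsto len \<phi> \<rho> u' \<sigma> w' \<longrightarrow>
           KKS_form \<sigma> w w' = KKS_form \<rho> u u')}"


section \<open>Hamiltonian tori\<close>

(* T is the image of an isomorphism \<theta> from the torus R^k / Z^k onto a group of symplectomorphisms,
   with moment map (H 0, ..., H (k - 1)).  Only the first k coordinates of the argument of \<theta>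
   matter, by the kernel condition.  Joint smoothness of the action is automatic, since it is
   composed of the flows of the smooth functions H i. *)
definition hamiltonian_torus_of_dim ::
    "('e::finite \<Rightarrow> real) \<Rightarrow> nat \<Rightarrow> ((real^3^'e) set \<Rightarrow> (real^3^'e) set) set \<Rightarrow> bool" where
  "hamiltonian_torus_of_dim len k T \<longleftrightarrow>
     T \<subseteq> symplectomorphisms len \<and>
     (\<exists>(\<theta> :: (nat \<Rightarrow> real) \<Rightarrow> (real^3^'e) set \<Rightarrow> (real^3^'e) set)
        (H :: nat \<Rightarrow> (real^3^'e) set \<Rightarrow> real).
        range \<theta> = T \<and>
        (\<forall>a b. \<theta> (\<lambda>i. a i + b i) = \<theta> a \<otimes>\<^bsub>BijGroup (Pol len)\<^esub> \<theta> b) \<and>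
        (\<forall>a b. \<theta> a = \<theta> b \<longleftrightarrow> (\<forall>i<k. a i - b i \<in> \<int>)) \<and>
        (\<forall>i<k. Pol_smooth len (H i)) \<and>
        (\<forall>a. is_hamiltonian_flow len (\<lambda>p. \<Sum>i<k. a i * H i p) (\<lambda>t. \<theta> (\<lambda>i. t * a i))))"

definition hamiltonian_torus ::
    "('e::finite \<Rightarrow> real) \<Rightarrow> ((real^3^'e) set \<Rightarrow> (real^3^'e) set) set \<Rightarrow> bool" where
  "hamiltonian_torus len T \<longleftrightarrow> (\<exists>k. hamiltonian_torus_of_dim len k T)"

(* Well defined: a torus of dimension k has exactly 2^k elements of order dividing 2. *)
definition torus_dim ::
    "('e::finite \<Rightarrow> real) \<Rightarrow> ((real^3^'e) set \<Rightarrow> (real^3^'e) set) set \<Rightarrow> nat" where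
  "torus_dim len T = (THE k. hamiltonian_torus_of_dim len k T)"


section \<open>Bending tori\<close>

definition lopsided :: "('e::finite \<Rightarrow> real) \<Rightarrow> 'e set \<Rightarrow> bool" where
  "lopsided len I \<longleftrightarrow> (\<exists>e\<^sub>0\<in>I. len e\<^sub>0 > (\<Sum>e\<in>I - {e\<^sub>0}. len e))"

definition bending_flow ::
    "('e::finite \<Rightarrow> real) \<Rightarrow> 'e set \<Rightarrow> real \<Rightarrow> (real^3^'e) set \<Rightarrow> (real^3^'e) set" where
  "bending_flow len I = hamiltonian_flow len (bend_length I)"

definition bending_group ::
    "('e::finite \<Rightarrow> real) \<Rightarrow> 'e set set \<Rightarrow> ((real^3^'e) set \<Rightarrow> (real^3^'e) set) set" where
  "bending_group len \<I> = generate (BijGroup (Pol len)) (\<Union>I\<in>\<I>. range (bending_flow len I))"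

definition bending_torus ::
    "('e::finite \<Rightarrow> real) \<Rightarrow> ((real^3^'e) set \<Rightarrow> (real^3^'e) set) set \<Rightarrow> bool" where
  "bending_torus len T \<longleftrightarrow>
     hamiltonian_torus len T \<and> (\<exists>\<I>. (\<forall>I\<in>\<I>. lopsided len I) \<and> T = bending_group len \<I>)"

definition maximal_bending_torus ::
    "('e::finite \<Rightarrow> real) \<Rightarrow> ((real^3^'e) set \<Rightarrow> (real^3^'e) set) set \<Rightarrow> bool" where
  "maximal_bending_torus len T \<longleftrightarrow>
     bending_torus len T \<and> (\<forall>T'. bending_torus len T' \<and> T \<subseteq> T' \<longrightarrow> T' = T)"

definition bending_set :: "('e::finite \<Rightarrow> real) \<Rightarrow> 'e set set \<Rightarrow> bool" where
  "bending_set len \<I> \<longleftrightarrow>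
     (\<forall>I\<in>\<I>. lopsided len I) \<and> (\<forall>e. {e} \<in> \<I>) \<and>
     (\<forall>A\<in>\<I>. \<forall>B\<in>\<I>. A \<inter> B = {} \<or> A \<subseteq> B \<or> B \<subseteq> A)"

definition full_bending_set :: "('e::finite \<Rightarrow> real) \<Rightarrow> 'e set set \<Rightarrow> bool" where
  "full_bending_set len \<I> \<longleftrightarrow>
     bending_set len \<I> \<and>
     (\<forall>I\<in>\<I>. (\<nexists>e. I = {e}) \<longrightarrow> (\<exists>I'\<in>\<I>. \<exists>I''\<in>\<I>. I' \<inter> I'' = {} \<and> I = I' \<union> I''))"

definition maximal_members :: "'e set set \<Rightarrow> 'e set set" where
  "maximal_members \<I> = {J \<in> \<I>. \<forall>K\<in>\<I>. J \<subseteq> K \<longrightarrow> K = J}"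

end

theory Submission
  imports Defs
begin

text \<open>The bending flow of a lopsided set I is the rotation of the block I about the sum of its edges:
  this rotation is a Hamiltonian flow, and there is only one, because the form restricted to the closed
  polygons has no kernel besides the infinitesimal rotations of the whole polygon. A full bending set
  with at least three maximal members thus generates a torus with one circle for each member that is
  not a singleton, and the hypothesis on the dimension says that there are at least four maximal members.

  The images have a common point if and only if no union of two maximal members J, J' is lopsided: if it
  is, one of the two blocks is always longer than the other; if none is, the maximal blocks can be
  stretched to a common length and arranged to an equilateral polygon. A lopsided union can be added to the
  bending set and enlarges the torus. Conversely, if the flow of a lopsided K commutes with the torus,
  then K or its complement is nested in or disjoint from every member, since four blocks partitioning the
  edges are not always coplanar; without a lopsided union, this forces K or its complement to be a member.\<close>

unbundle cross3_syntax

section \<open>Rotations of three-space\<close>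

text \<open>Tangent vectors are given only as velocities of curves of closed polygons, and a flow
  only by a definite description. So each tangent direction used as a test has to be realised by an
  explicit curve, and the description has to be resolved by existence and uniqueness. Two kinds of
  curves suffice: a bend, and the motion of one edge compensated by two non-parallel edges, which
  exist by genericity. Lifts of a path may jump within the orbits; paths are therefore compared
  through the scalar and triple products of the edges, which do not see such jumps and determine the
  orbit.

  The number four arises as follows. A full bending set is a forest of binary trees with the edges
  as leaves, so the members that are not singletons number |E| minus the number of trees. With three
  or more trees each such member has a circle of its own; with two, the roots are complementary and
  share a flow, which costs one circle. A dimension below |E| - 3 thus forces four trees, and
  merging two of them still leaves the three on which the independence of the circles rests.\<close>

lemma bounded_bilinear_cross3: "bounded_bilinear (\<lambda>x y :: real^3. x \<times> y)"
  using bilinear_conv_bounded_bilinear bilinear_cross by blast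

text \<open>\<open>\<zeta> \<times> z\<close> is the velocity of z under the infinitesimal rotation
  \<open>\<zeta>\<close>. Expanding the double cross product, only the multiple of z survives since
  x is orthogonal to z; its product with z is cancelled by the squared norm, so the radius
  disappears.\<close>

lemma inner_cross_cross_self: "norm z \<noteq> 0 \<Longrightarrow> z \<bullet> x = 0 \<Longrightarrow>
    z \<bullet> (x \<times> (\<zeta> \<times> z)) / (norm z)\<^sup>2 = - (x \<bullet> \<zeta>)" for z x \<zeta> :: "real^3"
  by (simp add: Lagrange inner_diff_right inner_commute power2_norm_eq_inner)

lemma KKS_summand_cross:
  fixes z x \<zeta> :: "real^3"
  assumes "z \<noteq> 0" "z \<bullet> x = 0"
  shows "z \<bullet> ((\<zeta> \<times> z) \<times> x) / (norm z)\<^sup>2 = x \<bullet> \<zeta>"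
  using inner_cross_cross_self[of z x \<zeta>] assms cross_skew[of "\<zeta> \<times> z" x]
  by simp

lemma inner_triple_commute: "x \<bullet> (y \<times> z) = y \<bullet> (z \<times> x)" for x y z :: "real^3"
  by (metis cross_triple inner_commute)

text \<open>The test for equality of vectors used throughout: by Lagrange's identity the first two
  products make y parallel to \<open>a \<times> b\<close>, and the third makes it
  orthogonal.\<close>

lemma orthogonal_to_cross_frame:
  fixes a b y :: "real^3"
  assumes "a \<times> b \<noteq> 0" "y \<bullet> a = 0" "y \<bullet> b = 0" "y \<bullet> (a \<times> b) = 0"
  shows "y = 0"
proof -
  have "y \<times> (a \<times> b) = 0"
    by (simp add: Lagrange assms)
  then show ?thesis
    using norm_and_cross_eq_0[of y "a \<times> b"] assms by auto
qed

text \<open>The three equations say that the lengths of a and b and their scalar product are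
  stationary; motions of a frame with this property are infinitesimal rotations.\<close>

lemma infinitesimal_rotation_on_frame:
  fixes a b x y :: "real^3"
  assumes ab: "a \<times> b \<noteq> 0" and x: "x \<bullet> a = 0" and y: "y \<bullet> b = 0" and xy: "x \<bullet> b + y \<bullet> a = 0"
  obtains \<xi> where "x = \<xi> \<times> a" "y = \<xi> \<times> b"
proof
  define N where "N = a \<times> b"
  \<comment> \<open>The coefficients are forced: those at a and b are read off from the components
    of y and x along N, and the one at N has to fit both \<open>x \<bullet> b\<close> and
    \<open>- (y \<bullet> a)\<close>, which agree by \<open>xy\<close>.\<close>
  define \<xi> where "\<xi> = ((y \<bullet> N) / (N \<bullet> N)) *\<^sub>R a - ((x \<bullet> N) / (N \<bullet> N)) *\<^sub>R b + ((x \<bullet> b) / (N \<bullet> N)) *\<^sub>R N"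
  have NN: "N \<bullet> N \<noteq> 0"
    using ab by (simp add: N_def)
  have [simp]: "N \<bullet> a = 0" "N \<bullet> b = 0"
    by (simp_all add: N_def dot_cross_self)
  have ba: "b \<times> a = - N"
    unfolding N_def by (rule cross_skew)
  have Nb: "(N \<times> a) \<bullet> b = N \<bullet> N" "(N \<times> b) \<bullet> a = - (N \<bullet> N)"
    by (metis N_def cross_triple inner_commute, metis N_def ba cross_triple inner_commute inner_minus_right)
  have Na: "(N \<times> a) \<bullet> a = 0" "(N \<times> a) \<bullet> N = 0" "(N \<times> b) \<bullet> b = 0" "(N \<times> b) \<bullet> N = 0"
    by (simp_all add: dot_cross_self)
  have xa: "\<xi> \<times> a = ((x \<bullet> N) / (N \<bullet> N)) *\<^sub>R N + ((x \<bullet> b) / (N \<bullet> N)) *\<^sub>R (N \<times> a)"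
    by (simp add: \<xi>_def cross_add_left Cross3.left_diff_distrib cross_mult_left ba)
  have yb: "\<xi> \<times> b = ((y \<bullet> N) / (N \<bullet> N)) *\<^sub>R N + ((x \<bullet> b) / (N \<bullet> N)) *\<^sub>R (N \<times> b)"
    by (simp add: \<xi>_def cross_add_left Cross3.left_diff_distrib cross_mult_left N_def)
  have "x - \<xi> \<times> a = 0"
    by (rule orthogonal_to_cross_frame[OF ab], unfold N_def[symmetric] xa)
      (use x NN in \<open>simp_all add: inner_diff_left inner_add_left Nb Na\<close>)
  then show "x = \<xi> \<times> a" by simp
  have "y - \<xi> \<times> b = 0"
    by (rule orthogonal_to_cross_frame[OF ab], unfold N_def[symmetric] yb)
      (use y xy NN in \<open>simp_all add: inner_diff_left inner_add_left Nb Na\<close>)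
  then show "y = \<xi> \<times> b" by simp
qed

(* Rodrigues' formula. For v = 0 it gives multiplication by cos t, which is not a rotation. *)
definition rot :: "real^3 \<Rightarrow> real \<Rightarrow> real^3 \<Rightarrow> real^3" where
  "rot v t x = cos t *\<^sub>R x + sin t *\<^sub>R (sgn v \<times> x) + ((1 - cos t) * (sgn v \<bullet> x)) *\<^sub>R sgn v"

lemma linear_rot: "linear (rot v t)"
  by (rule linearI) (simp_all add: rot_def cross_add_right cross_mult_right inner_add_right algebra_simps)

lemma rot_0 [simp]: "rot v 0 x = x"
  by (simp add: rot_def)

lemma rot_2pi_Ints: "s - t \<in> \<int> \<Longrightarrow> rot v (2 * pi * s) x = rot v (2 * pi * t) x"
proof -
  assume "s - t \<in> \<int>"
  then obtain m :: int where m: "s - t = of_int m" by (auto elim: Ints_cases)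
  then have "s = t + of_int m"
    by simp
  then have "2 * pi * s = 2 * pi * t + 2 * pi * of_int m"
    by (simp add: distrib_left)
  then show ?thesis
    by (simp add: rot_def cos_add sin_add)
qed

lemma sgn_inner_self: "v \<noteq> 0 \<Longrightarrow> sgn v \<bullet> sgn v = 1" for v :: "real^3"
  by (metis norm_sgn power2_norm_eq_inner one_power2)

lemma rot_rot:
  assumes "v \<noteq> 0"
  shows "rot v s (rot v t x) = rot v (s + t) x"
proof -
  have n: "sgn v \<bullet> sgn v = 1"
    using assms by (rule sgn_inner_self)
  have 1: "sgn v \<times> rot v t x = cos t *\<^sub>R (sgn v \<times> x) + sin t *\<^sub>R ((sgn v \<bullet> x) *\<^sub>R sgn v - x)"
    by (simp add: rot_def cross_add_right cross_mult_right Lagrange n)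
  have 2: "sgn v \<bullet> rot v t x = sgn v \<bullet> x"
    by (simp add: rot_def inner_add_right dot_cross_self n algebra_simps)
  have "rot v s (rot v t x) = cos s *\<^sub>R rot v t x + sin s *\<^sub>R (sgn v \<times> rot v t x) + ((1 - cos s) * (sgn v \<bullet> rot v t x)) *\<^sub>R sgn v"
    by (rule rot_def)
  also have "\<dots> = rot v (s + t) x"
    unfolding 1 2 by (simp add: rot_def cos_add sin_add algebra_simps)
  finally show ?thesis .
qed

lemma norm_rot:
  assumes "v \<noteq> 0"
  shows "norm (rot v t x) = norm x"
proof -
  have n: "sgn v \<bullet> sgn v = 1"
    using assms by (rule sgn_inner_self)
  define q where "q = sgn v \<bullet> x"
  have 1: "(sgn v \<times> x) \<bullet> (sgn v \<times> x) = x \<bullet> x - q\<^sup>2"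
    by (simp add: dot_cross n inner_commute q_def power2_eq_square)
  have q': "x \<bullet> sgn v = q" by (simp add: q_def inner_commute)
  have 0: "x \<bullet> (sgn v \<times> x) = 0" "(sgn v \<times> x) \<bullet> x = 0" "sgn v \<bullet> (sgn v \<times> x) = 0" "(sgn v \<times> x) \<bullet> sgn v = 0"
    by (simp_all add: dot_cross_self)
  have "rot v t x \<bullet> rot v t x = (cos t)\<^sup>2 * (x \<bullet> x) + (sin t)\<^sup>2 * (x \<bullet> x - q\<^sup>2) + 2 * cos t * (1 - cos t) * q\<^sup>2 + (1 - cos t)\<^sup>2 * q\<^sup>2"
    by (simp add: rot_def q_def[symmetric] q' inner_add_left inner_add_right 0 1 n power2_eq_square algebra_simps)
  also have "\<dots> = x \<bullet> x"
    unfolding sin_squared_eq by (simp add: power2_eq_square algebra_simps)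
  finally show ?thesis
    by (simp add: norm_eq)
qed

lemma rot_axis: "rot v t v = v"
proof -
  have "sgn v \<bullet> v = norm v"
    by (cases "v = 0") (simp_all add: sgn_div_norm power2_norm_eq_inner[symmetric] power2_eq_square)
  moreover have "sgn v \<times> v = 0"
    by (simp add: sgn_div_norm cross_mult_left)
  moreover have "norm v *\<^sub>R sgn v = v"
    by (cases "v = 0") (simp_all add: sgn_div_norm)
  ultimately show ?thesis
    by (simp add: rot_def algebra_simps) (metis mult.commute scaleR_scaleR)
qed

lemma rot_sum: "rot v t (sum f S) = (\<Sum>x\<in>S. rot v t (f x))"
  by (rule linear_sum[OF linear_rot])

text \<open>The determinant is 1, not -1, because the rotation by t is the square of the rotation by
  t/2.\<close>

lemma rotation_matrix_rot:
  assumes "v \<noteq> 0"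
  shows "rotation_matrix (matrix (rot v t))"
proof -
  have orth: "orthogonal_matrix (matrix (rot v s))" for s
    using orthogonal_transformation_matrix[of "rot v s"] linear_rot norm_rot[OF assms]
    by (simp add: orthogonal_transformation)
  have "matrix (rot v t) = matrix (rot v (t/2)) ** matrix (rot v (t/2))"
    using matrix_compose[OF linear_rot linear_rot, of v "t/2" v "t/2"] rot_rot[OF assms, of "t/2" "t/2"]
    by (simp add: o_def)
  then have "det (matrix (rot v t)) = (det (matrix (rot v (t/2))))\<^sup>2"
    by (simp add: det_mul power2_eq_square)
  moreover have "det (matrix (rot v (t/2))) = 1 \<or> det (matrix (rot v (t/2))) = - 1"
    using orth det_orthogonal_matrix by blast
  ultimately show ?thesis
    using orth by (auto simp: rotation_matrix_def)
qed

lemma matrix_rot_mult [simp]: "matrix (rot v t) *v x = rot v t x"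
  by (simp add: linear_rot)

lemma rotation_matrix_norm: "rotation_matrix A \<Longrightarrow> norm (A *v x) = norm x" for A :: "real^3^3"
  using orthogonal_transformation_matrix[of "(*v) A"]
  by (simp add: rotation_matrix_def orthogonal_transformation_norm)

lemma rotation_matrix_inner: "rotation_matrix A \<Longrightarrow> (A *v x) \<bullet> (A *v y) = x \<bullet> y" for A :: "real^3^3"
  using orthogonal_transformation_matrix[of "(*v) A"]
  by (simp add: rotation_matrix_def orthogonal_transformation_def)

text \<open>Rodrigues' formula is built from scalar products, cross products and \<open>sgn\<close>,
  all respected by rotations. Both the equivariance of a bend under SO(3) and the commutation of
  nested bends are instances.\<close>

lemma rotation_matrix_rot_equivariant:
  assumes "rotation_matrix A"
  shows "rot (A *v v) t (A *v x) = A *v rot v t x"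
proof -
  have "sgn (A *v v) = A *v sgn v"
    by (simp add: sgn_div_norm rotation_matrix_norm[OF assms] matrix_vector_mult_scaleR)
  then show ?thesis
    by (simp add: rot_def cross_rotation_matrix[OF assms] rotation_matrix_inner[OF assms]
        matrix_vector_mult_scaleR matrix_vector_right_distrib)
qed

lemma rotation_matrix_mat_1: "rotation_matrix (mat 1 :: real^3^3)"
  by (simp add: rotation_matrix_def orthogonal_matrix_id)

lemma rotation_matrix_mult: "rotation_matrix A \<Longrightarrow> rotation_matrix B \<Longrightarrow> rotation_matrix (A ** B)"
  for A B :: "real^3^3"
  by (simp add: rotation_matrix_def orthogonal_matrix_mul det_mul)

lemma rotation_matrix_transpose: "rotation_matrix A \<Longrightarrow> rotation_matrix (transpose A)"
  for A :: "real^3^3"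
  by (simp add: rotation_matrix_def orthogonal_matrix_transpose)

lemma rotation_matrix_transpose_mult:
  "rotation_matrix A \<Longrightarrow> transpose A ** A = mat 1"
  for A :: "real^3^3"
  by (simp add: rotation_matrix_def orthogonal_matrix_def)

text \<open>The matrix is Q times the inverse of P, where the columns of P are a, b,
  \<open>a \<times> b\<close> and those of Q are c, d, \<open>c \<times> d\<close>. Equal scalar
  products give equal Gram matrices, hence orthogonality; both determinants are the squared norm of
  the cross product, hence determinant 1.\<close>

lemma rotation_between_frames:
  fixes a b c d :: "real^3"
  assumes ab: "a \<times> b \<noteq> 0" and gram: "a \<bullet> a = c \<bullet> c" "a \<bullet> b = c \<bullet> d" "b \<bullet> b = d \<bullet> d"
  obtains A where "rotation_matrix A" "A *v a = c" "A *v b = d"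
proof -
  define P where "P = (transpose (vector [a, b, a \<times> b]) :: real^3^3)"
  define Q where "Q = (transpose (vector [c, d, c \<times> d]) :: real^3^3)"
  have detP: "det P = (a \<times> b) \<bullet> (a \<times> b)"
    by (simp add: P_def det_transpose dot_cross_det[symmetric]) (metis inner_triple_commute)
  have detQ: "det Q = (c \<times> d) \<bullet> (c \<times> d)"
    by (simp add: Q_def det_transpose dot_cross_det[symmetric]) (metis inner_triple_commute)
  have eq: "(a \<times> b) \<bullet> (a \<times> b) = (c \<times> d) \<bullet> (c \<times> d)"
    by (simp add: dot_cross gram inner_commute)
  have "det P \<noteq> 0" using ab detP by simp
  then have inv: "invertible P" by (simp add: invertible_det_nz)
  then obtain P' where PP: "P ** P' = mat 1" "P' ** P = mat 1"
    by (auto simp: invertible_def)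
  define A where "A = Q ** P'"
  have AP: "A ** P = Q"
    by (simp add: A_def PP matrix_mul_assoc[symmetric])
  have gramm: "transpose P ** P = transpose Q ** Q"
    unfolding P_def Q_def
    by (simp add: matrix_matrix_mult_def vec_eq_iff forall_3 transpose_def sum_3 vector_3)
      (use gram eq in \<open>simp add: inner_vec_def sum_3 cross_components mult.commute\<close>,
       simp add: algebra_simps)
  have "transpose A ** A = mat 1"
  proof -
    have 1: "transpose P ** transpose A ** (A ** P) = transpose P ** P"
      using gramm by (simp add: AP flip: matrix_transpose_mul)
    have "transpose P' ** transpose P = mat 1"
      by (metis PP(1) matrix_transpose_mul transpose_mat)
    then have "transpose A ** A = (transpose P' ** transpose P) ** (transpose A ** A) ** (P ** P')"
      by (simp add: PP)
    also have "\<dots> = transpose P' ** (transpose P ** transpose A ** (A ** P)) ** P'"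
      by (simp add: matrix_mul_assoc)
    also have "\<dots> = (transpose P' ** transpose P) ** (P ** P')"
      unfolding 1 by (simp add: matrix_mul_assoc)
    also have "\<dots> = mat 1"
      using \<open>transpose P' ** transpose P = mat 1\<close> by (simp add: PP)
    finally show ?thesis .
  qed
  moreover have "det A = 1"
    using AP detP detQ eq ab by (metis det_mul inner_eq_zero_iff mult_cancel_right2)
  ultimately have rotA: "rotation_matrix A"
    by (simp add: rotation_matrix_def orthogonal_matrix)
  have "A *v (P *v axis 1 1) = Q *v axis 1 1" "A *v (P *v axis 2 1) = Q *v axis 2 1"
    by (simp_all add: AP matrix_vector_mul_assoc)
  moreover have "P *v axis 1 1 = a" "P *v axis 2 1 = b" "Q *v axis 1 1 = c" "Q *v axis 2 1 = d"
    by (simp_all add: P_def Q_def matrix_vector_mul_component vec_eq_iff matrix_vector_mult_basis column_transpose row_def vector_3)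
  ultimately show thesis
    using that[OF rotA] by simp
qed

section \<open>Rotating a block of edges\<close>

definition act :: "real^3^3 \<Rightarrow> real^3^'e::finite \<Rightarrow> real^3^'e" where
  "act A \<rho> = (\<chi> e. A *v (\<rho> $ e))"

definition block_sum :: "'e::finite set \<Rightarrow> real^3^'e \<Rightarrow> real^3" where
  "block_sum I \<rho> = (\<Sum>e\<in>I. \<rho> $ e)"

definition Rot :: "'e::finite set \<Rightarrow> real \<Rightarrow> real^3^'e \<Rightarrow> real^3^'e" where
  "Rot I t \<rho> = (\<chi> e. if e \<in> I then rot (block_sum I \<rho>) t (\<rho> $ e) else \<rho> $ e)"

lemma act_nth [simp]: "act A \<rho> $ e = A *v (\<rho> $ e)"
  by (simp add: act_def)

lemma act_mat_1 [simp]: "act (mat 1) \<rho> = \<rho>"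
  by (simp add: vec_eq_iff)

lemma act_mult: "act (A ** B) \<rho> = act A (act B \<rho>)"
  by (simp add: vec_eq_iff[of "act _ _"] matrix_vector_mul_assoc)

lemma block_sum_act [simp]: "block_sum I (act A \<rho>) = A *v block_sum I \<rho>"
  by (simp add: block_sum_def linear_sum[OF matrix_vector_mul_linear])

lemma block_sum_UNIV_split: "block_sum I \<rho> + block_sum (- I) \<rho> = block_sum UNIV \<rho>"
  unfolding block_sum_def by (metis Compl_eq_Diff_UNIV add.commute finite_class.finite_UNIV subset_UNIV sum.subset_diff)

lemma block_sum_Un: "I \<inter> J = {} \<Longrightarrow> block_sum (I \<union> J) \<rho> = block_sum I \<rho> + block_sum J \<rho>"
  by (simp add: block_sum_def sum.union_disjoint)

lemma block_sum_singleton [simp]: "block_sum {e} \<rho> = \<rho> $ e"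
  by (simp add: block_sum_def)

lemma block_sum_insert: "e \<notin> I \<Longrightarrow> block_sum (insert e I) \<rho> = \<rho> $ e + block_sum I \<rho>"
  by (simp add: block_sum_def)

lemma closed_polygons_iff:
  "\<rho> \<in> closed_polygons len \<longleftrightarrow> block_sum UNIV \<rho> = 0 \<and> (\<forall>e. norm (\<rho> $ e) = len e)"
  by (simp add: closed_polygons_def block_sum_def)

lemma SO3_orbit_eq: "SO3_orbit \<rho> = {act A \<rho> | A. rotation_matrix A}"
  by (simp add: SO3_orbit_def act_def)

lemma SO3_orbit_self [simp]: "\<rho> \<in> SO3_orbit \<rho>"
  unfolding SO3_orbit_eq using rotation_matrix_mat_1 act_mat_1 by force

lemma SO3_orbit_act:
  assumes "rotation_matrix A"
  shows "SO3_orbit (act A \<rho>) = SO3_orbit \<rho>"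
proof (intro equalityI subsetI)
  fix x assume "x \<in> SO3_orbit (act A \<rho>)"
  then show "x \<in> SO3_orbit \<rho>"
    unfolding SO3_orbit_eq using rotation_matrix_mult[OF _ assms] by (auto simp flip: act_mult)
next
  fix x assume "x \<in> SO3_orbit \<rho>"
  then obtain B where B: "rotation_matrix B" "x = act B \<rho>"
    by (auto simp: SO3_orbit_eq)
  have "B = B ** transpose A ** A"
    by (simp add: matrix_mul_assoc[symmetric] rotation_matrix_transpose_mult[OF assms])
  then have "x = act (B ** transpose A) (act A \<rho>)"
    using B by (simp add: act_mult[symmetric])
  then show "x \<in> SO3_orbit (act A \<rho>)"
    unfolding SO3_orbit_eq using B rotation_matrix_mult rotation_matrix_transpose[OF assms] by blast
qed

lemma SO3_orbit_eqD:
  assumes "SO3_orbit \<rho> = SO3_orbit \<sigma>"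
  obtains A where "rotation_matrix A" "\<sigma> = act A \<rho>"
  using SO3_orbit_self[of \<sigma>] assms unfolding SO3_orbit_eq by blast

lemma act_closed_polygons:
  assumes "rotation_matrix A" "\<rho> \<in> closed_polygons len"
  shows "act A \<rho> \<in> closed_polygons len"
  using assms by (simp add: closed_polygons_iff rotation_matrix_norm)

lemma SO3_orbit_subset_closed_polygons:
  "\<rho> \<in> closed_polygons len \<Longrightarrow> SO3_orbit \<rho> \<subseteq> closed_polygons len"
  by (auto simp: SO3_orbit_eq act_closed_polygons)

lemma SO3_orbit_in_Pol [simp]: "\<rho> \<in> closed_polygons len \<Longrightarrow> SO3_orbit \<rho> \<in> Pol len"
  by (simp add: Pol_def)

lemma PolE:
  assumes "p \<in> Pol len"
  obtains \<rho> where "\<rho> \<in> closed_polygons len" "p = SO3_orbit \<rho>"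
  using assms by (auto simp: Pol_def)

lemma bend_length_block_sum: "bend_length I (SO3_orbit \<rho>) = norm (block_sum I \<rho>)"
  by (simp add: bend_length_SO3_orbit block_sum_def)

lemma Rot_nth: "Rot I t \<rho> $ e = (if e \<in> I then rot (block_sum I \<rho>) t (\<rho> $ e) else \<rho> $ e)"
  by (simp add: Rot_def)

lemma Rot_0 [simp]: "Rot I 0 \<rho> = \<rho>"
  by (simp add: vec_eq_iff[of "Rot _ _ _"] Rot_nth)

lemma block_sum_Rot_subset:
  assumes "J \<subseteq> I"
  shows "block_sum J (Rot I t \<rho>) = rot (block_sum I \<rho>) t (block_sum J \<rho>)"
proof -
  have "block_sum J (Rot I t \<rho>) = (\<Sum>e\<in>J. rot (block_sum I \<rho>) t (\<rho> $ e))"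
    unfolding block_sum_def[of J] by (rule sum.cong) (use assms in \<open>auto simp: Rot_nth\<close>)
  then show ?thesis
    by (simp add: block_sum_def[of J] rot_sum)
qed

lemma block_sum_Rot_disjoint:
  assumes "I \<inter> J = {}"
  shows "block_sum J (Rot I t \<rho>) = block_sum J \<rho>"
  unfolding block_sum_def by (rule sum.cong) (use assms in \<open>auto simp: Rot_nth\<close>)

lemma block_sum_Rot_supset:
  assumes "I \<subseteq> J"
  shows "block_sum J (Rot I t \<rho>) = block_sum J \<rho>"
proof -
  have "block_sum J \<sigma> = block_sum I \<sigma> + block_sum (J - I) \<sigma>" for \<sigma> :: "real^3^'a"
    using block_sum_Un[of I "J - I" \<sigma>] assms by (simp add: Un_absorb1)
  moreover have "block_sum I (Rot I t \<rho>) = block_sum I \<rho>"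
    by (simp add: block_sum_Rot_subset rot_axis)
  moreover have "block_sum (J - I) (Rot I t \<rho>) = block_sum (J - I) \<rho>"
    by (rule block_sum_Rot_disjoint) auto
  ultimately show ?thesis by simp
qed

lemma Rot_closed_polygons:
  assumes "\<rho> \<in> closed_polygons len" "block_sum I \<rho> \<noteq> 0"
  shows "Rot I t \<rho> \<in> closed_polygons len"
  using assms by (auto simp: closed_polygons_iff block_sum_Rot_supset Rot_nth norm_rot)

lemma Rot_Rot:
  assumes "block_sum I \<rho> \<noteq> 0"
  shows "Rot I s (Rot I t \<rho>) = Rot I (s + t) \<rho>"
  by (simp add: vec_eq_iff[of "Rot _ _ _"] Rot_nth block_sum_Rot_supset rot_rot[OF assms])

lemma Rot_act:
  assumes "rotation_matrix A"
  shows "Rot I t (act A \<rho>) = act A (Rot I t \<rho>)"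
  by (simp add: vec_eq_iff[of "Rot _ _ _"] Rot_nth rotation_matrix_rot_equivariant[OF assms])

lemma Rot_commute_disjoint:
  assumes "I \<inter> J = {}"
  shows "Rot I s (Rot J t \<rho>) = Rot J t (Rot I s \<rho>)"
  using assms by (auto simp: vec_eq_iff[of "Rot _ _ _"] Rot_nth block_sum_Rot_disjoint Int_commute)

text \<open>The bend of J moves I as a rigid body and takes the axis of I along, so bending I before
  or after makes no difference.\<close>

lemma Rot_commute_subset:
  assumes "I \<subseteq> J" "block_sum J \<rho> \<noteq> 0"
  shows "Rot I s (Rot J t \<rho>) = Rot J t (Rot I s \<rho>)"
proof -
  have "rot (rot (block_sum J \<rho>) t (block_sum I \<rho>)) s (rot (block_sum J \<rho>) t x)
      = rot (block_sum J \<rho>) t (rot (block_sum I \<rho>) s x)" for x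
    using rotation_matrix_rot_equivariant[OF rotation_matrix_rot[OF assms(2)], of t "block_sum I \<rho>" s x]
    by simp
  then show ?thesis
    using assms(1) by (auto simp: vec_eq_iff[of "Rot _ _ _"] Rot_nth block_sum_Rot_subset block_sum_Rot_supset)
qed

lemma Rot_singleton: "Rot {e} t \<rho> = \<rho>"
  by (simp add: vec_eq_iff[of "Rot _ _ _"] Rot_nth rot_axis)

lemma Rot_2pi_Ints: "s - t \<in> \<int> \<Longrightarrow> Rot I (2 * pi * s) \<rho> = Rot I (2 * pi * t) \<rho>"
  by (simp add: vec_eq_iff[of "Rot _ _ _"] Rot_nth rot_2pi_Ints)

text \<open>If the sum vanished, the dominating edge would be minus the sum of the others, against
  the triangle inequality.\<close>

lemma lopsided_block_sum_nonzero:
  assumes "lopsided len I" "\<And>e. norm (\<rho> $ e) = len e"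
  shows "block_sum I \<rho> \<noteq> 0"
proof
  assume 0: "block_sum I \<rho> = 0"
  obtain e where e: "e \<in> I" "len e > (\<Sum>e\<in>I - {e}. len e)"
    using assms(1) by (auto simp: lopsided_def)
  then have "\<rho> $ e = - (\<Sum>e\<in>I - {e}. \<rho> $ e)"
    using 0 by (simp add: block_sum_def sum.remove[of I e] eq_neg_iff_add_eq_0)
  then have "len e \<le> (\<Sum>e\<in>I - {e}. len e)"
    using sum_norm_le[of "I - {e}" "\<lambda>e. \<rho> $ e" len] assms(2) by (metis dual_order.refl norm_minus_cancel)
  with e show False by simp
qed

lemma lopsided_closed_polygon:
  "lopsided len I \<Longrightarrow> \<rho> \<in> closed_polygons len \<Longrightarrow> block_sum I \<rho> \<noteq> 0"
  by (metis closed_polygons_iff lopsided_block_sum_nonzero)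

subsection \<open>Velocities\<close>

lemma has_vector_derivative_vec_nth_iff:
  "(c has_vector_derivative u) (at x within S) \<longleftrightarrow> (\<forall>e. ((\<lambda>t. c t $ e) has_vector_derivative (u $ e)) (at x within S))"
  for c :: "real \<Rightarrow> 'a::euclidean_space^'n"
proof
  assume L: "(c has_vector_derivative u) (at x within S)"
  show "\<forall>e. ((\<lambda>t. c t $ e) has_vector_derivative (u $ e)) (at x within S)"
    using bounded_linear.has_vector_derivative[OF bounded_linear_vec_nth L] by blast
next
  assume R: "\<forall>e. ((\<lambda>t. c t $ e) has_vector_derivative (u $ e)) (at x within S)"
  have "((\<lambda>t. c t \<bullet> b) has_derivative (\<lambda>h. (h *\<^sub>R u) \<bullet> b)) (at x within S)" if b: "b \<in> Basis" for b
  proof -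
    obtain i y where iy: "b = axis i y" using b by (auto simp: Basis_vec_def)
    have "((\<lambda>t. c t $ i) has_derivative (\<lambda>h. h *\<^sub>R u $ i)) (at x within S)"
      using R by (simp add: has_vector_derivative_def)
    from has_derivative_inner_left[OF this, of y] show ?thesis
      by (simp add: iy inner_axis)
  qed
  then show "(c has_vector_derivative u) (at x within S)"
    unfolding has_vector_derivative_def has_derivative_componentwise_within[of c] by blast
qed

text \<open>For nonzero v this is the part of w orthogonal to v, divided by the norm of v.\<close>

definition dsgn :: "real^3 \<Rightarrow> real^3 \<Rightarrow> real^3" where
  "dsgn v w = (1 / norm v) *\<^sub>R w - ((v \<bullet> w) / (norm v) ^ 3) *\<^sub>R v"

(* When v moves with velocity w, the derivative of rot v t is rot v t composed with the cross product by twist v w t. *)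
definition twist :: "real^3 \<Rightarrow> real^3 \<Rightarrow> real \<Rightarrow> real^3" where
  "twist v w t = (cos t - 1) *\<^sub>R (sgn v \<times> dsgn v w) + sin t *\<^sub>R dsgn v w"

lemma sgn_inner_dsgn:
  assumes "v \<noteq> 0"
  shows "sgn v \<bullet> dsgn v w = 0"
  using assms by (simp add: sgn_div_norm dsgn_def inner_diff_right power2_norm_eq_inner[symmetric] field_simps eval_nat_numeral)

lemma dsgn_decompose:
  assumes "v \<noteq> 0"
  shows "w = norm v *\<^sub>R dsgn v w + ((v \<bullet> w) / norm v) *\<^sub>R sgn v"
  using assms by (simp add: sgn_div_norm dsgn_def scaleR_diff_right field_simps eval_nat_numeral)

lemma has_vector_derivative_sgn:
  assumes v: "(v has_vector_derivative w) (at a within S)" and nz: "v a \<noteq> 0"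
  shows "((\<lambda>s. sgn (v s)) has_vector_derivative dsgn (v a) w) (at a within S)"
proof -
  have v': "(v has_derivative (\<lambda>h. h *\<^sub>R w)) (at a within S)"
    using v by (simp add: has_vector_derivative_def)
  have "((\<lambda>s. norm (v s)) has_derivative (\<lambda>h. h * (v a \<bullet> w) / norm (v a))) (at a within S)"
    using has_derivative_compose[OF v' has_derivative_norm[OF nz]]
    by (simp add: sgn_div_norm inner_commute divide_inverse mult_ac)
  then have 1: "((\<lambda>s. inverse (norm (v s))) has_derivative (\<lambda>h. h * (- (v a \<bullet> w) / norm (v a) ^ 3))) (at a within S)"
    using nz by (auto intro!: derivative_eq_intros ext simp: field_simps eval_nat_numeral)
  show ?thesis
    unfolding sgn_div_norm has_vector_derivative_def
    by (rule has_derivative_eq_rhs[OF has_derivative_scaleR[OF 1 v']])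
      (simp add: fun_eq_iff dsgn_def algebra_simps inverse_eq_divide)
qed

text \<open>With n the axis, \<open>\<delta>\<close> its velocity and c, s the cosine and sine of
  the angle, the right side is the derivative of Rodrigues' formula in the axis, and the left side
  is the rotation applied to \<open>\<eta> \<times> x\<close>. So \<open>\<eta>\<close> is the
  angular velocity, seen before the rotation, that a moving axis contributes. The computation runs
  in the frame n, \<open>\<delta>\<close>, \<open>n \<times> \<delta>\<close>.\<close>

lemma rot_velocity_identity:
  fixes n \<delta> x :: "real^3"
  assumes n: "n \<bullet> n = 1" "n \<bullet> \<delta> = 0" and cs: "c * c + s * s = (1::real)"
  defines "\<eta> \<equiv> (c - 1) *\<^sub>R (n \<times> \<delta>) + s *\<^sub>R \<delta>"
  shows "c *\<^sub>R (\<eta> \<times> x) + s *\<^sub>R (n \<times> (\<eta> \<times> x)) + ((1 - c) * (n \<bullet> (\<eta> \<times> x))) *\<^sub>R n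
    = s *\<^sub>R (\<delta> \<times> x) + (1 - c) *\<^sub>R ((\<delta> \<bullet> x) *\<^sub>R n + (n \<bullet> x) *\<^sub>R \<delta>)"
proof -
  define m where "m = n \<times> \<delta>"
  have nm: "n \<times> m = - \<delta>"
    by (simp add: m_def Lagrange n)
  have 1: "m \<times> x = (n \<bullet> x) *\<^sub>R \<delta> - (\<delta> \<bullet> x) *\<^sub>R n"
    using cross_skew[of m x] by (simp add: m_def Lagrange inner_commute)
  have 2: "\<delta> \<times> x = (m \<bullet> x) *\<^sub>R n - (n \<bullet> x) *\<^sub>R m"
  proof -
    have "x \<times> (n \<times> m) = (m \<bullet> x) *\<^sub>R n - (n \<bullet> x) *\<^sub>R m"
      by (simp add: Lagrange inner_commute)
    then show ?thesis
      using cross_skew[of \<delta> x] by (simp add: nm)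
  qed
  have \<eta>: "\<eta> = (c - 1) *\<^sub>R m + s *\<^sub>R \<delta>"
    by (simp add: \<eta>_def m_def)
  have n\<eta>: "n \<bullet> \<eta> = 0"
    by (simp add: \<eta> m_def inner_add_right dot_cross_self n)
  have 3: "\<eta> \<times> x = (c - 1) *\<^sub>R (m \<times> x) + s *\<^sub>R (\<delta> \<times> x)"
    by (simp add: \<eta> cross_add_left cross_mult_left)
  have 4: "n \<times> (\<eta> \<times> x) = (n \<bullet> x) *\<^sub>R \<eta>"
    by (simp add: Lagrange n\<eta>)
  have 5: "n \<bullet> (\<eta> \<times> x) = (1 - c) * (\<delta> \<bullet> x) + s * (m \<bullet> x)"
  proof -
    have "n \<bullet> (\<eta> \<times> x) = (n \<times> \<eta>) \<bullet> x"
      by (metis cross_triple inner_commute)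
    also have "n \<times> \<eta> = (1 - c) *\<^sub>R \<delta> + s *\<^sub>R m"
      unfolding \<eta> cross_add_right cross_mult_right nm by (simp add: m_def algebra_simps)
    finally show ?thesis by (simp add: inner_add_left)
  qed
  have ss: "s * s = 1 - c * c" using cs by simp
  have sx: "s * (s * y) = y - c * (c * y)" for y
    using ss by (metis left_diff_distrib' mult.assoc mult_1)
  show ?thesis
    unfolding 4 5 unfolding 3 unfolding 1 \<eta>
    by (simp add: 2 algebra_simps) (simp add: ss sx algebra_simps, simp add: vec_eq_iff)
qed

text \<open>Point, angle and axis all move; the three contributions are written inside the rotation,
  the last two as angular velocities. In this form the rotation drops out of every triple product,
  so that the symplectic form can be evaluated on the polygon before the bend.\<close>

lemma has_vector_derivative_rot:
  assumes v: "(v has_vector_derivative w) (at a within S)" and nz: "v a \<noteq> 0"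
    and \<tau>: "(\<tau> has_real_derivative \<tau>') (at a within S)"
    and x: "(x has_vector_derivative y) (at a within S)"
  shows "((\<lambda>s. rot (v s) (\<tau> s) (x s)) has_vector_derivative
     rot (v a) (\<tau> a) (y + (\<tau>' *\<^sub>R sgn (v a) + twist (v a) w (\<tau> a)) \<times> x a)) (at a within S)"
proof -
  define n where "n = sgn (v a)"
  define \<delta> where "\<delta> = dsgn (v a) w"
  define c where "c = cos (\<tau> a)"
  define s where "s = sin (\<tau> a)"
  have n: "n \<bullet> n = 1" "n \<bullet> \<delta> = 0"
    using nz by (simp_all add: n_def \<delta>_def sgn_inner_self sgn_inner_dsgn)
  have cs: "c * c + s * s = 1"
    by (simp add: c_def s_def flip: power2_eq_square)
  have dn: "((\<lambda>s. sgn (v s)) has_vector_derivative \<delta>) (at a within S)"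
    unfolding \<delta>_def by (rule has_vector_derivative_sgn[OF v nz])
  have dcos: "((\<lambda>s. cos (\<tau> s)) has_real_derivative - s * \<tau>') (at a within S)"
    and dsin: "((\<lambda>s. sin (\<tau> s)) has_real_derivative c * \<tau>') (at a within S)"
    using \<tau> by (auto intro!: derivative_eq_intros simp: s_def c_def)
  have dcos1: "((\<lambda>s. 1 - cos (\<tau> s)) has_real_derivative s * \<tau>') (at a within S)"
    using DERIV_diff[OF DERIV_const dcos] by simp
  have dnx: "((\<lambda>s. sgn (v s) \<bullet> x s) has_real_derivative n \<bullet> y + \<delta> \<bullet> x a) (at a within S)"
    using bounded_bilinear.has_vector_derivative[OF bounded_bilinear_inner dn x]
    by (simp add: n_def has_real_derivative_iff_has_vector_derivative)
  have dncx: "((\<lambda>s. sgn (v s) \<times> x s) has_vector_derivative n \<times> y + \<delta> \<times> x a) (at a within S)"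
    using bounded_bilinear.has_vector_derivative[OF bounded_bilinear_cross3 dn x]
    by (simp add: n_def)
  have "((\<lambda>s. rot (v s) (\<tau> s) (x s)) has_vector_derivative
      (c *\<^sub>R y + (- s * \<tau>') *\<^sub>R x a) + (s *\<^sub>R (n \<times> y + \<delta> \<times> x a) + (c * \<tau>') *\<^sub>R (n \<times> x a))
      + (((1 - c) * (n \<bullet> x a)) *\<^sub>R \<delta> + ((1 - c) * (n \<bullet> y + \<delta> \<bullet> x a) + s * \<tau>' * (n \<bullet> x a)) *\<^sub>R n)) (at a within S)"
    unfolding rot_def c_def s_def n_def
    by (intro has_vector_derivative_add has_vector_derivative_scaleR DERIV_mult'
        dcos[unfolded s_def] dsin[unfolded c_def] dcos1[unfolded s_def] x dn dnx[unfolded n_def] dncx[unfolded n_def])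
  moreover have "rot (v a) (\<tau> a) (y + (\<tau>' *\<^sub>R sgn (v a) + twist (v a) w (\<tau> a)) \<times> x a)
    = (c *\<^sub>R y + (- s * \<tau>') *\<^sub>R x a) + (s *\<^sub>R (n \<times> y + \<delta> \<times> x a) + (c * \<tau>') *\<^sub>R (n \<times> x a))
      + (((1 - c) * (n \<bullet> x a)) *\<^sub>R \<delta> + ((1 - c) * (n \<bullet> y + \<delta> \<bullet> x a) + s * \<tau>' * (n \<bullet> x a)) *\<^sub>R n)"
  proof -
    define \<eta> where "\<eta> = (c - 1) *\<^sub>R (n \<times> \<delta>) + s *\<^sub>R \<delta>"
    have r: "rot (v a) (\<tau> a) z = c *\<^sub>R z + s *\<^sub>R (n \<times> z) + ((1 - c) * (n \<bullet> z)) *\<^sub>R n" for z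
      by (simp add: rot_def c_def s_def n_def)
    have r\<eta>: "rot (v a) (\<tau> a) (\<eta> \<times> x a) = s *\<^sub>R (\<delta> \<times> x a) + (1 - c) *\<^sub>R ((\<delta> \<bullet> x a) *\<^sub>R n + (n \<bullet> x a) *\<^sub>R \<delta>)"
      unfolding r \<eta>_def by (rule rot_velocity_identity[OF n cs])
    have rn: "rot (v a) (\<tau> a) (n \<times> x a) = c *\<^sub>R (n \<times> x a) + s *\<^sub>R ((n \<bullet> x a) *\<^sub>R n - x a)"
      by (simp add: r Lagrange n dot_cross_self)
    have "twist (v a) w (\<tau> a) = \<eta>"
      by (simp add: \<eta>_def n_def \<delta>_def c_def s_def twist_def)
    then have "y + (\<tau>' *\<^sub>R sgn (v a) + twist (v a) w (\<tau> a)) \<times> x a = y + \<tau>' *\<^sub>R (n \<times> x a) + \<eta> \<times> x a"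
      by (simp add: n_def cross_add_left cross_mult_left)
    then have "rot (v a) (\<tau> a) (y + (\<tau>' *\<^sub>R sgn (v a) + twist (v a) w (\<tau> a)) \<times> x a)
      = rot (v a) (\<tau> a) y + \<tau>' *\<^sub>R rot (v a) (\<tau> a) (n \<times> x a) + rot (v a) (\<tau> a) (\<eta> \<times> x a)"
      by (simp add: linear_add[OF linear_rot] linear_scale[OF linear_rot])
    then show ?thesis
      unfolding rn r\<eta> by (simp add: r algebra_simps)
  qed
  ultimately show ?thesis by simp
qed

text \<open>The reason why bending is symplectic: these are the correction terms of
  \<open>KKS_summand_twisted\<close>, summed over the block. As a twist is orthogonal to v, only the
  components of w and w' across v count; what is left is a multiple of T with factor 2(c - 1) + (c -
  1)^2 + s^2 = 0.\<close>

lemma twist_symplectic: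
  assumes v: "v \<noteq> 0"
  shows "w' \<bullet> twist v w t - w \<bullet> twist v w' t + (twist v w' t \<times> v) \<bullet> twist v w t = 0"
proof -
  define n where "n = sgn v"
  define \<delta> where "\<delta> = dsgn v w"
  define \<delta>' where "\<delta>' = dsgn v w'"
  define c where "c = cos t"
  define s where "s = sin t"
  define T where "T = n \<bullet> (\<delta> \<times> \<delta>')"
  have n: "n \<bullet> n = 1" "n \<bullet> \<delta> = 0" "n \<bullet> \<delta>' = 0"
    using v by (simp_all add: n_def \<delta>_def \<delta>'_def sgn_inner_self sgn_inner_dsgn)
  have cs: "c * c + s * s = 1"
    by (simp add: c_def s_def flip: power2_eq_square)
  have tw: "twist v w t = (c - 1) *\<^sub>R (n \<times> \<delta>) + s *\<^sub>R \<delta>" "twist v w' t = (c - 1) *\<^sub>R (n \<times> \<delta>') + s *\<^sub>R \<delta>'"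
    by (simp_all add: twist_def n_def \<delta>_def \<delta>'_def c_def s_def)
  have ntw: "n \<bullet> twist v w t = 0" "n \<bullet> twist v w' t = 0"
    by (simp_all add: tw inner_add_right dot_cross_self n)
  have ww: "w = norm v *\<^sub>R \<delta> + ((v \<bullet> w) / norm v) *\<^sub>R n" "w' = norm v *\<^sub>R \<delta>' + ((v \<bullet> w') / norm v) *\<^sub>R n"
    unfolding n_def \<delta>_def \<delta>'_def by (rule dsgn_decompose[OF v])+
  have T1: "\<delta>' \<bullet> (n \<times> \<delta>) = T" "\<delta> \<bullet> (n \<times> \<delta>') = - T"
    unfolding T_def by (metis inner_triple_commute, metis inner_triple_commute cross_skew inner_minus_right)
  have w1: "w' \<bullet> twist v w t = norm v * ((c - 1) * T + s * (\<delta> \<bullet> \<delta>'))"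
    by (subst ww(2)) (simp add: inner_add_left ntw, simp add: tw inner_add_right T1 inner_commute[of \<delta>' \<delta>])
  have w2: "w \<bullet> twist v w' t = norm v * (- (c - 1) * T + s * (\<delta> \<bullet> \<delta>'))"
    by (subst ww(1)) (simp add: inner_add_left ntw, simp add: tw inner_add_right T1 algebra_simps)
  have "(twist v w' t \<times> v) \<bullet> twist v w t = norm v * ((twist v w' t \<times> n) \<bullet> twist v w t)"
    using v by (simp add: n_def sgn_div_norm cross_mult_right)
  also have "(twist v w' t \<times> n) \<bullet> twist v w t = ((c - 1) * (c - 1) + s * s) * T"
  proof -
    have A: "twist v w' t \<times> n = (c - 1) *\<^sub>R \<delta>' - s *\<^sub>R (n \<times> \<delta>')"
      using cross_skew[of "twist v w' t" n] by (simp add: tw cross_add_right cross_mult_right Lagrange n)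
    have B: "(n \<times> \<delta>') \<bullet> (n \<times> \<delta>) = \<delta>' \<bullet> \<delta>"
      by (simp add: dot_cross n)
    have C: "(n \<times> \<delta>') \<bullet> \<delta> = - T"
      using T1 by (simp add: inner_commute)
    show ?thesis
      unfolding A tw(1) by (simp add: inner_add_right inner_diff_left B C T1 algebra_simps)
  qed
  finally show ?thesis
    unfolding w1 w2 using cs by (simp add: algebra_simps)
qed

definition Rot_velocity :: "'e::finite set \<Rightarrow> real \<Rightarrow> real \<Rightarrow> real^3^'e \<Rightarrow> real^3^'e \<Rightarrow> real^3^'e" where
  "Rot_velocity I t t' \<rho> u = (\<chi> e. if e \<in> I
     then rot (block_sum I \<rho>) t (u $ e + (t' *\<^sub>R sgn (block_sum I \<rho>) + twist (block_sum I \<rho>) (block_sum I u) t) \<times> \<rho> $ e)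
     else u $ e)"

lemma has_vector_derivative_block_sum:
  assumes "(c has_vector_derivative u) (at a within S)"
  shows "((\<lambda>s. block_sum I (c s)) has_vector_derivative block_sum I u) (at a within S)"
  unfolding block_sum_def using assms
  by (auto simp: has_vector_derivative_vec_nth_iff intro!: has_vector_derivative_sum)

lemma has_vector_derivative_Rot:
  assumes "(\<tau> has_real_derivative \<tau>') (at a within S)" "(c has_vector_derivative u) (at a within S)"
    "block_sum I (c a) \<noteq> 0"
  shows "((\<lambda>s. Rot I (\<tau> s) (c s)) has_vector_derivative Rot_velocity I (\<tau> a) \<tau>' (c a) u) (at a within S)"
proof (subst has_vector_derivative_vec_nth_iff, rule allI)
  fix e
  have ce: "((\<lambda>t. c t $ e) has_vector_derivative u $ e) (at a within S)"
    using assms(2) by (simp add: has_vector_derivative_vec_nth_iff)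
  show "((\<lambda>t. Rot I (\<tau> t) (c t) $ e) has_vector_derivative Rot_velocity I (\<tau> a) \<tau>' (c a) u $ e) (at a within S)"
    using has_vector_derivative_rot[OF has_vector_derivative_block_sum[OF assms(2)] assms(3) assms(1) ce] ce
    by (cases "e \<in> I") (simp_all add: Rot_nth Rot_velocity_def)
qed

subsection \<open>The Kirillov-Kostant-Souriau form\<close>

text \<open>The linearised equations of the level set. Velocities of curves of polygons solve them;
  where conversely a curve with a given velocity is wanted, it is constructed.\<close>

definition tangent :: "real^3^'e::finite \<Rightarrow> real^3^'e \<Rightarrow> bool" where
  "tangent \<rho> u \<longleftrightarrow> block_sum UNIV u = 0 \<and> (\<forall>e. \<rho> $ e \<bullet> u $ e = 0)"

text \<open>For all edges this is a direction along the SO(3) orbit; for a block I it is the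
  velocity of a bend when \<open>\<xi>\<close> is parallel to the block sum. For other
  \<open>\<xi>\<close> it may violate the closing condition.\<close>

definition rotation_field :: "'e::finite set \<Rightarrow> real^3 \<Rightarrow> real^3^'e \<Rightarrow> real^3^'e" where
  "rotation_field I \<xi> \<rho> = (\<chi> e. if e \<in> I then \<xi> \<times> \<rho> $ e else 0)"

lemma KKS_form_add_left: "KKS_form \<rho> (u + u') w = KKS_form \<rho> u w + KKS_form \<rho> u' w"
  by (simp add: KKS_form_def cross_add_left inner_add_right add_divide_distrib sum.distrib)

lemma KKS_form_scaleR_left: "KKS_form \<rho> (r *\<^sub>R u) w = r * KKS_form \<rho> u w"
  by (simp add: KKS_form_def cross_mult_left sum_distrib_left)

lemma KKS_form_skew: "KKS_form \<rho> u w = - KKS_form \<rho> w u"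
  unfolding KKS_form_def by (subst cross_skew) (simp add: sum_negf)

lemma KKS_form_diff_left: "KKS_form \<rho> (u - u') w = KKS_form \<rho> u w - KKS_form \<rho> u' w"
  using KKS_form_add_left[of \<rho> u "(-1) *\<^sub>R u'" w] KKS_form_scaleR_left[of \<rho> "-1" u' w] by simp

text \<open>The moment map identity: the sum of a block generates the rotations of its edges. For
  \<open>I = UNIV\<close> the right side vanishes, so orbit directions lie in the kernel of the
  form; for \<open>\<xi>\<close> the direction of the block sum it is the derivative of the bend
  length.\<close>

lemma KKS_form_rotation_field:
  assumes "\<And>e. \<rho> $ e \<noteq> 0" "tangent \<rho> w"
  shows "KKS_form \<rho> (rotation_field I \<xi> \<rho>) w = \<xi> \<bullet> block_sum I w"
proof -
  have "KKS_form \<rho> (rotation_field I \<xi> \<rho>) w = (\<Sum>e\<in>UNIV. if e \<in> I then w $ e \<bullet> \<xi> else 0)"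
    unfolding KKS_form_def using assms
    by (intro sum.cong) (auto simp: rotation_field_def KKS_summand_cross tangent_def)
  also have "\<dots> = (\<Sum>e\<in>I. w $ e \<bullet> \<xi>)"
    by (simp add: sum.If_cases)
  finally show ?thesis
    by (simp add: block_sum_def inner_sum_right inner_commute)
qed

lemma KKS_form_act:
  assumes "rotation_matrix A"
  shows "KKS_form (act A \<rho>) (act A u) (act A w) = KKS_form \<rho> u w"
  by (simp add: KKS_form_def cross_rotation_matrix[OF assms] rotation_matrix_inner[OF assms] rotation_matrix_norm[OF assms])

text \<open>The correction is free of denominators and linear in u, w and z for fixed
  \<open>\<eta>\<close> and \<open>\<theta>\<close>; its sum over a block therefore involves block
  sums only.\<close>

lemma KKS_summand_twisted:
  fixes z u w \<eta> \<theta> :: "real^3"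
  assumes "z \<noteq> 0" "z \<bullet> u = 0" "z \<bullet> w = 0"
  shows "z \<bullet> ((u + \<eta> \<times> z) \<times> (w + \<theta> \<times> z)) / (norm z)\<^sup>2
    = z \<bullet> (u \<times> w) / (norm z)\<^sup>2 + (w \<bullet> \<eta> - u \<bullet> \<theta> + (\<theta> \<times> z) \<bullet> \<eta>)"
proof -
  have "z \<bullet> (u \<times> (\<theta> \<times> z)) / (norm z)\<^sup>2 = - (u \<bullet> \<theta>)"
    using inner_cross_cross_self[of z u \<theta>] assms by simp
  moreover have "z \<bullet> ((\<eta> \<times> z) \<times> w) / (norm z)\<^sup>2 = w \<bullet> \<eta>"
    using KKS_summand_cross assms by blast
  moreover have "z \<bullet> ((\<eta> \<times> z) \<times> (\<theta> \<times> z)) / (norm z)\<^sup>2 = (\<theta> \<times> z) \<bullet> \<eta>"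
    using KKS_summand_cross[of z "\<theta> \<times> z" \<eta>] assms by (simp add: dot_cross_self)
  ultimately show ?thesis
    by (simp add: cross_add_left cross_add_right inner_add_right add_divide_distrib)
qed

text \<open>The rotation preserves triple products and norms, which leaves the corrections of
  \<open>KKS_summand_twisted\<close>. Their sum over I depends on the block sums of u, w and
  \<open>\<rho>\<close> alone, and \<open>twist_symplectic\<close> annihilates it.\<close>

lemma KKS_form_Rot:
  assumes nz: "\<And>e. \<rho> $ e \<noteq> 0" and I: "block_sum I \<rho> \<noteq> 0" and u: "tangent \<rho> u" and w: "tangent \<rho> w"
  shows "KKS_form (Rot I t \<rho>) (Rot_velocity I t 0 \<rho> u) (Rot_velocity I t 0 \<rho> w) = KKS_form \<rho> u w"
proof -
  define v where "v = block_sum I \<rho>"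
  define \<eta> where "\<eta> = twist v (block_sum I u) t"
  define \<theta> where "\<theta> = twist v (block_sum I w) t"
  have v0: "v \<noteq> 0"
    using I by (simp add: v_def)
  then have A: "rotation_matrix (matrix (rot v t))"
    by (rule rotation_matrix_rot)
  have rot_triple: "rot v t x \<bullet> (rot v t y \<times> rot v t z) = x \<bullet> (y \<times> z)" for x y z
    using cross_rotation_matrix[OF A, of y z] rotation_matrix_inner[OF A, of x "y \<times> z"] by simp
  have "KKS_form (Rot I t \<rho>) (Rot_velocity I t 0 \<rho> u) (Rot_velocity I t 0 \<rho> w)
    = (\<Sum>e\<in>UNIV. \<rho> $ e \<bullet> (u $ e \<times> w $ e) / (norm (\<rho> $ e))\<^sup>2
       + (if e \<in> I then w $ e \<bullet> \<eta> - u $ e \<bullet> \<theta> + (\<theta> \<times> \<rho> $ e) \<bullet> \<eta> else 0))"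
    unfolding KKS_form_def
  proof (intro sum.cong refl)
    fix e
    have "\<rho> $ e \<bullet> u $ e = 0" "\<rho> $ e \<bullet> w $ e = 0"
      using u w by (simp_all add: tangent_def)
    with nz show "Rot I t \<rho> $ e \<bullet> (Rot_velocity I t 0 \<rho> u $ e \<times> Rot_velocity I t 0 \<rho> w $ e) / (norm (Rot I t \<rho> $ e))\<^sup>2
      = \<rho> $ e \<bullet> (u $ e \<times> w $ e) / (norm (\<rho> $ e))\<^sup>2
       + (if e \<in> I then w $ e \<bullet> \<eta> - u $ e \<bullet> \<theta> + (\<theta> \<times> \<rho> $ e) \<bullet> \<eta> else 0)"
      using KKS_summand_twisted[of "\<rho> $ e" "u $ e" "w $ e" \<eta> \<theta>] v0
      by (simp add: Rot_nth Rot_velocity_def flip: v_def \<eta>_def \<theta>_def)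
        (simp add: rot_triple norm_rot)
  qed
  also have "\<dots> = KKS_form \<rho> u w + (\<Sum>e\<in>I. w $ e \<bullet> \<eta> - u $ e \<bullet> \<theta> + (\<theta> \<times> \<rho> $ e) \<bullet> \<eta>)"
    by (simp add: sum.distrib KKS_form_def sum.If_cases)
  also have "(\<Sum>e\<in>I. w $ e \<bullet> \<eta> - u $ e \<bullet> \<theta> + (\<theta> \<times> \<rho> $ e) \<bullet> \<eta>)
    = block_sum I w \<bullet> \<eta> - block_sum I u \<bullet> \<theta> + (\<theta> \<times> v) \<bullet> \<eta>"
    by (simp add: sum.distrib sum_subtractf block_sum_def v_def inner_sum_left
        linear_sum[OF bounded_linear.linear[OF bounded_bilinear.bounded_linear_right[OF bounded_bilinear_cross3]]])
  also have "\<dots> = 0"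
    unfolding \<eta>_def \<theta>_def using I by (intro twist_symplectic) (simp add: v_def)
  finally show ?thesis by simp
qed

section \<open>Curves of polygons\<close>

lemma curve_throughD:
  assumes "curve_through len c \<rho> u"
  shows "c t \<in> closed_polygons len" "c 0 = \<rho>" "(c has_vector_derivative u) (at 0)" "\<rho> \<in> closed_polygons len"
  using assms unfolding curve_through_def by auto

lemma curve_through_tangent:
  assumes "curve_through len c \<rho> u"
  shows "tangent \<rho> u"
  unfolding tangent_def
proof (intro conjI allI)
  note c = curve_throughD[OF assms]
  have "((\<lambda>s. block_sum UNIV (c s)) has_vector_derivative block_sum UNIV u) (at 0)"
    by (rule has_vector_derivative_block_sum[OF c(3)])
  moreover have "(\<lambda>s. block_sum UNIV (c s)) = (\<lambda>s. 0)"
    using c(1) by (auto simp: closed_polygons_iff)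
  ultimately show "block_sum UNIV u = 0"
    by (metis has_vector_derivative_const vector_derivative_unique_at)
  fix e
  have ce: "((\<lambda>s. c s $ e) has_vector_derivative u $ e) (at 0)"
    using c(3) by (simp add: has_vector_derivative_vec_nth_iff[of c])
  have "((\<lambda>s. c s $ e \<bullet> c s $ e) has_vector_derivative c 0 $ e \<bullet> u $ e + u $ e \<bullet> c 0 $ e) (at 0)"
    by (rule bounded_bilinear.has_vector_derivative[OF bounded_bilinear_inner ce ce])
  moreover have "(\<lambda>s. c s $ e \<bullet> c s $ e) = (\<lambda>s. (len e)\<^sup>2)"
    using c(1) by (auto simp: closed_polygons_iff simp flip: power2_norm_eq_inner)
  ultimately have "c 0 $ e \<bullet> u $ e + u $ e \<bullet> c 0 $ e = 0"
    by (metis has_vector_derivative_const vector_derivative_unique_at)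
  then show "\<rho> $ e \<bullet> u $ e = 0"
    using c(2) by (simp add: inner_commute)
qed

lemma twist_0 [simp]: "twist v w 0 = 0"
  by (simp add: twist_def)

lemma Rot_velocity_at_0:
  "Rot_velocity I 0 r \<rho> u = u + rotation_field I (r *\<^sub>R sgn (block_sum I \<rho>)) \<rho>"
  by (subst vec_eq_iff) (simp add: Rot_velocity_def rotation_field_def)

lemma curve_through_Rot:
  assumes c: "curve_through len c \<rho> u" and nz: "\<And>t. block_sum I (c t) \<noteq> 0"
    and \<tau>: "(\<tau> has_real_derivative r) (at 0)"
  shows "curve_through len (\<lambda>t. Rot I (\<tau> t) (c t)) (Rot I (\<tau> 0) \<rho>) (Rot_velocity I (\<tau> 0) r \<rho> u)"
  using has_vector_derivative_Rot[OF \<tau> curve_throughD(3)[OF c] nz] curve_throughD(1,2)[OF c] nz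
  by (auto simp: curve_through_def intro: Rot_closed_polygons)

lemma curve_through_const: "\<rho> \<in> closed_polygons len \<Longrightarrow> curve_through len (\<lambda>t. \<rho>) \<rho> 0"
  by (simp add: curve_through_def)

lemma curve_through_bend:
  assumes "\<rho> \<in> closed_polygons len" "block_sum I \<rho> \<noteq> 0"
  shows "curve_through len (\<lambda>t. Rot I (r * t) \<rho>) \<rho> (rotation_field I (r *\<^sub>R sgn (block_sum I \<rho>)) \<rho>)"
  using curve_through_Rot[OF curve_through_const[OF assms(1)], of I "\<lambda>t. r * t" r] assms(2)
  by (simp add: Rot_velocity_at_0 DERIV_cmult_Id)

lemma has_vector_derivative_act:
  assumes "(c has_vector_derivative u) (at a within S)"
  shows "((\<lambda>t. act A (c t)) has_vector_derivative act A u) (at a within S)"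
proof -
  have "bounded_linear (act A)"
    by (rule linear_conv_bounded_linear[THEN iffD1], rule linearI; subst vec_eq_iff)
      (simp_all add: matrix_vector_right_distrib matrix_vector_mult_scaleR)
  from bounded_linear.has_vector_derivative[OF this assms] show ?thesis .
qed

lemma curve_through_act:
  assumes "rotation_matrix A" "curve_through len c \<rho> u"
  shows "curve_through len (\<lambda>t. act A (c t)) (act A \<rho>) (act A u)"
  using assms has_vector_derivative_act[of c u 0 UNIV A]
  by (auto simp: curve_through_def act_closed_polygons)

text \<open>When one edge moves, two non-parallel edges can be adjusted so as to close up the polygon again:
  they form a triangle over the moving vector v, whose apex is found by the cosine rule.\<close>

lemma triangle_apex_curve:
  fixes a b :: "real^3" and v :: "real \<Rightarrow> real^3"
  assumes ab: "a \<times> b \<noteq> 0" and v0: "v 0 = a + b" and v: "(v has_vector_derivative v') (at 0)"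
  obtains x x' where "(x has_vector_derivative x') (at 0)" "x 0 = a"
    "\<forall>\<^sub>F t in at 0. norm (x t) = norm a \<and> norm (v t - x t) = norm b"
proof -
  define n where "n = a \<times> b"
  define m where "m t = n \<times> v t" for t
  define N where "N t = v t \<bullet> v t" for t
  define M where "M t = m t \<bullet> m t" for t
  \<comment> \<open>If |x| = |a| and |v - x| = |b|, the cosine rule gives
    \<open>x \<bullet> v = \<alpha> * N\<close>. What is then missing from |a|^2 is the squared
    height, and Q is the square of the height in multiples of m. The root enters x with a minus sign
    because \<open>a \<bullet> m 0 = - (n \<bullet> n)\<close> is negative.\<close>
  define \<alpha> where "\<alpha> t = (N t + (norm a)\<^sup>2 - (norm b)\<^sup>2) / (2 * N t)" for t
  define Q where "Q t = ((norm a)\<^sup>2 - (\<alpha> t)\<^sup>2 * N t) / M t" for t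
  define x where "x t = \<alpha> t *\<^sub>R v t - sqrt (Q t) *\<^sub>R m t" for t
  have nn: "n \<bullet> n > 0"
    using ab by (simp add: n_def)
  have ab0: "a + b \<noteq> 0"
  proof
    assume "a + b = 0"
    then have "b = - a" by (simp add: eq_neg_iff_add_eq_0 add.commute)
    then show False using ab by simp
  qed
  have vm: "v t \<bullet> m t = 0" for t
    by (simp add: m_def dot_cross_self)
  have am: "a \<bullet> m 0 = - (n \<bullet> n)"
  proof -
    have "a \<bullet> m 0 = n \<bullet> (v 0 \<times> a)"
      by (metis m_def inner_triple_commute)
    also have "v 0 \<times> a = - n"
      using cross_skew[of b a] by (simp add: v0 cross_add_left n_def)
    finally show ?thesis by simp
  qed
  have N0: "N 0 > 0"
    using ab0 by (simp add: N_def v0)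
  have m0: "m 0 \<noteq> 0"
    using am nn by auto
  then have M0: "M 0 > 0"
    by (simp add: M_def)
  \<comment> \<open>The height of a over \<open>v 0\<close> in multiples of \<open>m 0\<close>.
    Since it is positive, so is Q near time 0, and its root is differentiable there.\<close>
  define \<kappa> where "\<kappa> = (n \<bullet> n) / M 0"
  have \<kappa>: "\<kappa> > 0"
    using nn M0 by (simp add: \<kappa>_def)
  have \<alpha>0: "\<alpha> 0 = (a \<bullet> v 0) / N 0"
  proof -
    have "N 0 + (norm a)\<^sup>2 - (norm b)\<^sup>2 = 2 * (a \<bullet> v 0)"
      by (simp add: N_def v0 power2_norm_eq_inner inner_add_left inner_add_right inner_commute)
    then show ?thesis by (simp add: \<alpha>_def)
  qed
  have a_eq: "a = \<alpha> 0 *\<^sub>R v 0 - \<kappa> *\<^sub>R m 0"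
  proof -
    have n0: "a \<bullet> n = 0" "v 0 \<bullet> n = 0" "m 0 \<bullet> n = 0"
      by (simp_all add: n_def v0 m_def dot_cross_self inner_add_left)
    have "a - \<alpha> 0 *\<^sub>R v 0 + \<kappa> *\<^sub>R m 0 = 0"
    proof (rule orthogonal_to_cross_frame[of n "v 0"])
      show "n \<times> v 0 \<noteq> 0" using m0 by (simp add: m_def)
      show "(a - \<alpha> 0 *\<^sub>R v 0 + \<kappa> *\<^sub>R m 0) \<bullet> n = 0"
        using n0 by (simp add: inner_add_left inner_diff_left)
      show "(a - \<alpha> 0 *\<^sub>R v 0 + \<kappa> *\<^sub>R m 0) \<bullet> v 0 = 0"
        using N0 by (simp add: inner_add_left inner_diff_left inner_commute[of "m 0"] vm \<alpha>0 N_def)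
      have "(a - \<alpha> 0 *\<^sub>R v 0 + \<kappa> *\<^sub>R m 0) \<bullet> m 0 = 0"
        using M0 vm[of 0] am by (simp add: inner_add_left inner_diff_left \<kappa>_def M_def)
      then show "(a - \<alpha> 0 *\<^sub>R v 0 + \<kappa> *\<^sub>R m 0) \<bullet> (n \<times> v 0) = 0"
        by (simp add: m_def)
    qed
    then show ?thesis by (simp add: algebra_simps)
  qed
  have "(norm a)\<^sup>2 = (\<alpha> 0)\<^sup>2 * N 0 + \<kappa>\<^sup>2 * M 0"
  proof -
    have "a \<bullet> a = (\<alpha> 0 *\<^sub>R v 0 - \<kappa> *\<^sub>R m 0) \<bullet> (\<alpha> 0 *\<^sub>R v 0 - \<kappa> *\<^sub>R m 0)"
      using a_eq by simp
    also have "\<dots> = (\<alpha> 0)\<^sup>2 * N 0 + \<kappa>\<^sup>2 * M 0"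
      using vm[of 0] by (simp add: inner_diff_left inner_diff_right N_def M_def inner_commute power2_eq_square)
    finally show ?thesis by (simp add: power2_norm_eq_inner)
  qed
  then have Q0: "Q 0 = \<kappa>\<^sup>2"
    using M0 by (simp add: Q_def)
  have x0: "x 0 = a"
    using \<kappa> a_eq by (simp add: x_def Q0)
  have dm: "(m has_vector_derivative n \<times> v') (at 0)"
    unfolding m_def[abs_def]
    using bounded_bilinear.has_vector_derivative[OF bounded_bilinear_cross3 has_vector_derivative_const v] by simp
  have "(N has_vector_derivative (v 0 \<bullet> v' + v' \<bullet> v 0)) (at 0)"
    unfolding N_def[abs_def] by (rule bounded_bilinear.has_vector_derivative[OF bounded_bilinear_inner v v])
  then have fN: "N field_differentiable (at 0)"
    by (auto simp: has_real_derivative_iff_has_vector_derivative[symmetric] field_differentiable_def)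
  have "(M has_vector_derivative (m 0 \<bullet> (n \<times> v') + (n \<times> v') \<bullet> m 0)) (at 0)"
    unfolding M_def[abs_def] by (rule bounded_bilinear.has_vector_derivative[OF bounded_bilinear_inner dm dm])
  then have fM: "M field_differentiable (at 0)"
    by (auto simp: has_real_derivative_iff_has_vector_derivative[symmetric] field_differentiable_def)
  have f\<alpha>: "\<alpha> field_differentiable (at 0)"
    unfolding \<alpha>_def[abs_def] using N0
    by (intro field_differentiable_divide field_differentiable_diff field_differentiable_add
        field_differentiable_mult fN field_differentiable_const) auto
  have fQ: "Q field_differentiable (at 0)"
    unfolding Q_def[abs_def] using M0
    by (intro field_differentiable_divide field_differentiable_diff field_differentiable_mult
        field_differentiable_power f\<alpha> fN fM field_differentiable_const) auto
  obtain Q' \<alpha>' where Q': "(Q has_real_derivative Q') (at 0)" and \<alpha>': "(\<alpha> has_real_derivative \<alpha>') (at 0)"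
    using fQ f\<alpha> by (auto simp: field_differentiable_def)
  have "((\<lambda>t. sqrt (Q t)) has_real_derivative (inverse (sqrt (Q 0)) / 2) * Q') (at 0)"
    using \<kappa> by (intro DERIV_chain2[OF DERIV_real_sqrt Q']) (simp add: Q0)
  then obtain q where dx: "(x has_vector_derivative q) (at 0)"
    unfolding x_def[abs_def] using has_vector_derivative_diff[OF has_vector_derivative_scaleR[OF \<alpha>' v] has_vector_derivative_scaleR[OF _ dm]]
    by blast
  have cont: "isCont N 0" "isCont M 0" "isCont Q 0"
    using fN fM fQ field_differentiable_imp_continuous_at by blast+
  have "\<forall>\<^sub>F t in at 0. N t > 0" "\<forall>\<^sub>F t in at 0. M t > 0" "\<forall>\<^sub>F t in at 0. Q t > 0"
    using cont N0 M0 Q0 \<kappa> by (auto simp: isCont_def intro: order_tendstoD(1))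
  then have ev: "\<forall>\<^sub>F t in at 0. norm (x t) = norm a \<and> norm (v t - x t) = norm b"
  proof eventually_elim
    case (elim t)
    have "x t \<bullet> x t = (\<alpha> t)\<^sup>2 * N t + (sqrt (Q t))\<^sup>2 * M t"
      using vm[of t] by (simp add: x_def inner_diff_left inner_diff_right N_def M_def inner_commute power2_eq_square)
    also have "\<dots> = (norm a)\<^sup>2"
      using elim by (simp add: Q_def)
    finally have 1: "x t \<bullet> x t = (norm a)\<^sup>2" .
    have "x t \<bullet> v t = \<alpha> t * N t"
      by (simp add: x_def inner_diff_left N_def inner_commute[of "m t"] vm)
    then have 2: "2 * (x t \<bullet> v t) = N t + (norm a)\<^sup>2 - (norm b)\<^sup>2"
      using elim by (simp add: \<alpha>_def)
    have "(v t - x t) \<bullet> (v t - x t) = N t - 2 * (x t \<bullet> v t) + x t \<bullet> x t"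
      by (simp add: inner_diff_left inner_diff_right N_def inner_commute)
    also have "\<dots> = (norm b)\<^sup>2"
      using 1 2 by simp
    finally show ?case
      using 1 by (simp add: norm_eq_sqrt_inner)
  qed
  show thesis
    by (rule that[OF dx x0 ev])
qed

lemma move_edge:
  assumes \<rho>: "\<rho> \<in> closed_polygons len" and ab: "\<rho> $ a \<times> \<rho> $ b \<noteq> 0" and g: "g \<noteq> a" "g \<noteq> b"
    and lg: "len g > 0" and w: "w \<bullet> \<rho> $ g = 0"
  obtains c u where "curve_through len c \<rho> u" "u $ g = w" "\<And>h. h \<notin> {a, b, g} \<Longrightarrow> u $ h = 0"
proof -
  have ab': "a \<noteq> b"
    using ab by auto
  have ng: "norm (\<rho> $ h) = len h" for h
    using \<rho> by (simp add: closed_polygons_iff)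
  then have g0: "\<rho> $ g \<noteq> 0"
    using lg by (metis less_irrefl norm_zero)
  \<comment> \<open>The straight motion with velocity w leaves the sphere of radius
    \<open>len g\<close>; projecting it back radially keeps the velocity, as w is tangent to that
    sphere.\<close>
  define \<gamma> where "\<gamma> t = len g *\<^sub>R sgn (\<rho> $ g + t *\<^sub>R w)" for t
  have nz: "\<rho> $ g + t *\<^sub>R w \<noteq> 0" for t
  proof
    assume "\<rho> $ g + t *\<^sub>R w = 0"
    then have "(\<rho> $ g + t *\<^sub>R w) \<bullet> \<rho> $ g = 0" by simp
    then show False using g0 w by (simp add: inner_add_left)
  qed
  have \<gamma>0: "\<gamma> 0 = \<rho> $ g"
    using ng[of g] lg by (simp add: \<gamma>_def sgn_div_norm)
  have n\<gamma>: "norm (\<gamma> t) = len g" for t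
    using nz[of t] lg by (simp add: \<gamma>_def norm_sgn)
  have "((\<lambda>t. \<rho> $ g + t *\<^sub>R w) has_vector_derivative w) (at 0)"
    by (auto intro!: derivative_eq_intros)
  from has_vector_derivative_sgn[OF this nz]
  have "(\<gamma> has_vector_derivative len g *\<^sub>R dsgn (\<rho> $ g) w) (at 0)"
    unfolding \<gamma>_def by (auto intro!: derivative_eq_intros simp: has_vector_derivative_def)
  moreover have "len g *\<^sub>R dsgn (\<rho> $ g) w = w"
    using w ng[of g] lg by (simp add: dsgn_def inner_commute)
  ultimately have d\<gamma>: "(\<gamma> has_vector_derivative w) (at 0)"
    by simp
  define v where "v t = \<rho> $ a + \<rho> $ b + \<rho> $ g - \<gamma> t" for t
  have dv: "(v has_vector_derivative 0 - w) (at 0)"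
    unfolding v_def[abs_def] by (intro has_vector_derivative_diff has_vector_derivative_const d\<gamma>)
  have v0: "v 0 = \<rho> $ a + \<rho> $ b"
    by (simp add: v_def \<gamma>0)
  obtain x x' where dx: "(x has_vector_derivative x') (at 0)" and x0: "x 0 = \<rho> $ a"
    and ev: "\<forall>\<^sub>F t in at 0. norm (x t) = norm (\<rho> $ a) \<and> norm (v t - x t) = norm (\<rho> $ b)"
    by (rule triangle_apex_curve[OF ab v0 dv])
  define k where "k t = (\<chi> h. if h = a then x t else if h = b then v t - x t else if h = g then \<gamma> t else \<rho> $ h)" for t
  define u where "u = (\<chi> h. if h = a then x' else if h = b then (0 - w) - x' else if h = g then w else 0)"
  \<comment> \<open>The triangle exists only near time 0, but \<open>curve_through\<close> wants a
    closed polygon at all times; the default value \<open>\<rho>\<close> elsewhere does not affect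
    the derivative at 0.\<close>
  define c where "c t = (if norm (x t) = norm (\<rho> $ a) \<and> norm (v t - x t) = norm (\<rho> $ b) then k t else \<rho>)" for t
  have dk: "(k has_vector_derivative u) (at 0)"
    unfolding has_vector_derivative_vec_nth_iff[of k]
    using dx d\<gamma> has_vector_derivative_diff[OF dv dx]
    by (auto simp: k_def u_def)
  have k0: "k 0 = \<rho>"
    using x0 \<gamma>0 by (auto simp: vec_eq_iff[of _ \<rho>] k_def v_def)
  have "\<forall>\<^sub>F t in at 0. k t = c t"
    using ev by eventually_elim (simp add: c_def)
  moreover have c0: "c 0 = \<rho>"
    by (simp add: c_def k0)
  ultimately have dc: "(c has_vector_derivative u) (at 0)"
    using dk k0 has_derivative_transform_eventually[of k _ 0 UNIV c]
    by (simp add: has_vector_derivative_def)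
  have cp: "c t \<in> closed_polygons len" for t
  proof (cases "norm (x t) = norm (\<rho> $ a) \<and> norm (v t - x t) = norm (\<rho> $ b)")
    case True
    have U: "UNIV = insert a (insert b (insert g (UNIV - {a, b, g})))"
      by auto
    have "block_sum UNIV (k t) = x t + (v t - x t) + \<gamma> t + block_sum (UNIV - {a,b,g}) \<rho>"
    proof -
      have "block_sum (UNIV - {a,b,g}) (k t) = block_sum (UNIV - {a,b,g}) \<rho>"
        unfolding block_sum_def by (rule sum.cong) (auto simp: k_def)
      then show ?thesis
        by (subst U) (use ab' g in \<open>simp add: block_sum_insert, simp add: k_def\<close>)
    qed
    also have "\<dots> = block_sum UNIV \<rho>"
      by (subst (2) U) (use ab' g in \<open>simp add: block_sum_insert v_def\<close>)
    finally have "block_sum UNIV (k t) = 0"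
      using \<rho> by (simp add: closed_polygons_iff)
    moreover have "norm (k t $ h) = len h" for h
      using True ng n\<gamma> by (simp add: k_def)
    ultimately show ?thesis
      using True by (simp add: c_def closed_polygons_iff)
  qed (use \<rho> in \<open>auto simp: c_def\<close>)
  show thesis
  proof (rule that)
    show "curve_through len c \<rho> u"
      using cp c0 dc by (simp add: curve_through_def)
    show "u $ g = w" using g by (simp add: u_def)
    show "\<And>h. h \<notin> {a, b, g} \<Longrightarrow> u $ h = 0" by (simp add: u_def)
  qed
qed

subsection \<open>The kernel of the restricted form\<close>

text \<open>If all edges were parallel, their cosines with a fixed edge a would be signs, and the
  closing condition multiplied by that edge would be the relation that genericity forbids.\<close>

lemma generic_nonparallel:
  assumes gen: "generic len" and pos: "\<And>e. len e > 0" and \<rho>: "\<rho> \<in> closed_polygons len"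
  obtains a b where "\<rho> $ a \<times> \<rho> $ b \<noteq> 0"
proof (rule ccontr)
  assume "\<not> thesis"
  then have par: "\<rho> $ a \<times> \<rho> $ b = 0" for a b
    using that by blast
  have n: "norm (\<rho> $ e) = len e" for e
    using \<rho> by (simp add: closed_polygons_iff)
  have nz: "\<rho> $ e \<noteq> 0" for e
    using n pos by (metis less_irrefl norm_zero)
  fix a :: 'a
  define \<epsilon> where "\<epsilon> e = (\<rho> $ e \<bullet> \<rho> $ a) / (len e * len a)" for e
  have sq: "(\<epsilon> e)\<^sup>2 = 1" for e
  proof -
    have "(\<rho> $ e \<bullet> \<rho> $ a)\<^sup>2 = (len e * len a)\<^sup>2"
      using norm_cross_dot[of "\<rho> $ e" "\<rho> $ a"] by (simp add: par n)
    then show ?thesis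
      using pos[of e] pos[of a] by (simp add: \<epsilon>_def power_divide)
  qed
  then have "\<epsilon> e \<in> {-1, 1}" for e
    using sq[of e] by (auto simp: power2_eq_1_iff)
  moreover have "(\<Sum>e\<in>UNIV. \<epsilon> e * len e) = 0"
  proof -
    have "(\<Sum>e\<in>UNIV. \<epsilon> e * len e) = (\<Sum>e\<in>UNIV. (\<rho> $ e \<bullet> \<rho> $ a) / len a)"
      by (rule sum.cong) (use pos in \<open>simp_all add: \<epsilon>_def less_imp_neq[symmetric]\<close>)
    also have "\<dots> = (block_sum UNIV \<rho> \<bullet> \<rho> $ a) / len a"
      by (simp add: block_sum_def inner_sum_left sum_divide_distrib)
    also have "\<dots> = 0"
      using \<rho> by (simp add: closed_polygons_iff)
    finally show ?thesis .
  qed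
  ultimately show False
    using gen unfolding generic_def by blast
qed

lemma tangent_diff: "tangent \<rho> u \<Longrightarrow> tangent \<rho> w \<Longrightarrow> tangent \<rho> (u - w)"
  by (simp add: tangent_def inner_diff_right block_sum_def sum_subtractf)

lemma block_sum_rotation_field_UNIV: "block_sum I (rotation_field UNIV \<xi> \<rho>) = \<xi> \<times> block_sum I \<rho>"
  by (simp add: block_sum_def rotation_field_def linear_sum[OF bounded_linear.linear[OF bounded_bilinear.bounded_linear_right[OF bounded_bilinear_cross3]]])

lemma tangent_rotation_field_UNIV:
  "\<rho> \<in> closed_polygons len \<Longrightarrow> tangent \<rho> (rotation_field UNIV \<xi> \<rho>)"
  by (simp add: tangent_def block_sum_rotation_field_UNIV closed_polygons_iff)
    (simp add: rotation_field_def dot_cross_self)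

text \<open>The bend of two non-parallel edges a, b shows that x is an infinitesimal rotation on them; after
  subtracting it, the curves that move one further edge g and adjust a, b see only the value of x at g.\<close>

lemma KKS_kernel:
  assumes gen: "generic len" and pos: "\<And>e. len e > 0" and \<rho>: "\<rho> \<in> closed_polygons len"
    and x: "tangent \<rho> x" and orth: "\<And>c w. curve_through len c \<rho> w \<Longrightarrow> KKS_form \<rho> x w = 0"
  obtains \<xi> where "x = rotation_field UNIV \<xi> \<rho>"
proof -
  obtain a b where ab: "\<rho> $ a \<times> \<rho> $ b \<noteq> 0"
    using generic_nonparallel[OF gen pos \<rho>] by blast
  then have ab': "a \<noteq> b" by auto
  have nz: "\<rho> $ e \<noteq> 0" for e
    using \<rho> pos by (metis closed_polygons_iff less_irrefl norm_zero)
  have s0: "block_sum {a, b} \<rho> \<noteq> 0"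
  proof
    assume "block_sum {a, b} \<rho> = 0"
    then have "\<rho> $ b = - \<rho> $ a"
      using ab' by (simp add: block_sum_insert eq_neg_iff_add_eq_0 add.commute)
    with ab show False by simp
  qed
  have "KKS_form \<rho> x (rotation_field {a, b} (1 *\<^sub>R sgn (block_sum {a, b} \<rho>)) \<rho>) = 0"
    by (rule orth[OF curve_through_bend[OF \<rho> s0]])
  then have "sgn (block_sum {a, b} \<rho>) \<bullet> block_sum {a, b} x = 0"
    using KKS_form_rotation_field[OF nz x, of "{a,b}"] KKS_form_skew[of \<rho> x] by simp
  then have "(\<rho> $ a + \<rho> $ b) \<bullet> (x $ a + x $ b) = 0"
    using s0 ab' by (simp add: sgn_div_norm block_sum_insert)
  moreover have xa: "\<rho> $ e \<bullet> x $ e = 0" for e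
    using x by (simp add: tangent_def)
  ultimately have "x $ a \<bullet> \<rho> $ b + x $ b \<bullet> \<rho> $ a = 0"
    by (simp add: inner_add_left inner_add_right inner_commute)
  then obtain \<xi> where \<xi>: "x $ a = \<xi> \<times> \<rho> $ a" "x $ b = \<xi> \<times> \<rho> $ b"
    using infinitesimal_rotation_on_frame[OF ab, of "x $ a" "x $ b"] xa by (metis inner_commute)
  define y where "y = x - rotation_field UNIV \<xi> \<rho>"
  have ty: "tangent \<rho> y"
    unfolding y_def by (intro tangent_diff x tangent_rotation_field_UNIV[OF \<rho>])
  have yw: "KKS_form \<rho> y w = 0" if "curve_through len c \<rho> w" for c w
  proof -
    have "tangent \<rho> w"
      using that by (rule curve_through_tangent)
    then have "KKS_form \<rho> (rotation_field UNIV \<xi> \<rho>) w = 0"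
      using KKS_form_rotation_field[OF nz, of w UNIV \<xi>] by (simp add: tangent_def)
    then show ?thesis
      using orth[OF that] by (simp add: y_def KKS_form_diff_left)
  qed
  have yab: "y $ a = 0" "y $ b = 0"
    using \<xi> by (simp_all add: y_def rotation_field_def)
  have "y $ g = 0" for g
  proof (cases "g = a \<or> g = b")
    case False
    have y_orth: "\<rho> $ g \<bullet> y $ g = 0"
      using ty by (simp add: tangent_def)
    \<comment> \<open>With this velocity the single summand left, that of g, is minus the squared
      norm of y at g.\<close>
    define w where "w = y $ g \<times> \<rho> $ g"
    have "w \<bullet> \<rho> $ g = 0" by (simp add: w_def dot_cross_self)
    then obtain c u where c: "curve_through len c \<rho> u" "u $ g = w" "\<And>h. h \<notin> {a, b, g} \<Longrightarrow> u $ h = 0"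
      using move_edge[OF \<rho> ab _ _ pos, of g w] False by metis
    have "KKS_form \<rho> y u = (\<Sum>e\<in>{g}. \<rho> $ e \<bullet> (y $ e \<times> u $ e) / (norm (\<rho> $ e))\<^sup>2)"
      unfolding KKS_form_def
    proof (rule sum.mono_neutral_right)
      show "\<forall>i\<in>UNIV - {g}. \<rho> $ i \<bullet> (y $ i \<times> u $ i) / (norm (\<rho> $ i))\<^sup>2 = 0"
        using c(3) yab by (metis DiffD2 cross_zero_left cross_zero_right div_0 inner_zero_right insertE singletonD singletonI)
    qed auto
    then have "\<rho> $ g \<bullet> (y $ g \<times> w) / (norm (\<rho> $ g))\<^sup>2 = 0"
      using yw[OF c(1)] c(2) by simp
    then have "- (y $ g \<bullet> y $ g) = 0"
      using inner_cross_cross_self[of "\<rho> $ g" "y $ g" "y $ g"] y_orth nz by (simp add: w_def)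
    then show ?thesis by simp
  qed (use yab in auto)
  then have "y = 0" by (simp add: vec_eq_iff[of y])
  then show thesis
    using that[of \<xi>] by (simp add: y_def)
qed

subsection \<open>Polygons in general position\<close>

text \<open>The scalar product with D starts at 0 with the positive derivative
  \<open>D \<bullet> D\<close>, hence is positive for small positive times.\<close>

lemma eventually_nonzero_if_derivative_nonzero:
  fixes f :: "real \<Rightarrow> real^3"
  assumes "(f has_vector_derivative D) (at 0)" "f 0 = 0" "D \<noteq> 0"
  shows "\<forall>\<^sub>F t in at_right 0. f t \<noteq> 0"
proof -
  have "((\<lambda>t. f t \<bullet> D) has_vector_derivative f 0 \<bullet> 0 + D \<bullet> D) (at 0)"
    by (rule bounded_bilinear.has_vector_derivative[OF bounded_bilinear_inner assms(1) has_vector_derivative_const])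
  then have "((\<lambda>t. f t \<bullet> D) has_real_derivative D \<bullet> D) (at 0)"
    by (simp add: has_real_derivative_iff_has_vector_derivative)
  moreover have "D \<bullet> D > 0"
    using assms(3) by simp
  ultimately obtain d where d: "d > 0" "\<forall>h>0. h < d \<longrightarrow> f 0 \<bullet> D < f (0 + h) \<bullet> D"
    using DERIV_pos_inc_right by blast
  have "\<forall>\<^sub>F t in at_right 0. t \<in> {0<..<d}"
    using d(1) by (rule eventually_at_right_real)
  then show ?thesis
    using d(2) by (elim eventually_mono) (fastforce simp: assms(2))
qed

lemma perpendicular_direction:
  fixes z y :: "real^3"
  assumes "z \<noteq> 0"
  obtains w where "w \<noteq> 0" "w \<bullet> z = 0" "w \<bullet> y = 0"
proof (cases "z \<times> y = 0")
  case False
  then show ?thesis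
    using that[of "z \<times> y"] by (simp add: dot_cross_self)
next
  case True
  obtain k where k: "z \<times> axis k 1 \<noteq> 0"
    using cross_basis_nonzero[OF assms] by blast
  have "y \<bullet> (z \<times> axis k 1) = axis k 1 \<bullet> (y \<times> z)"
    by (metis inner_triple_commute)
  then have "(z \<times> axis k 1) \<bullet> y = 0"
    using True cross_skew[of y z] by (simp add: inner_commute)
  then show ?thesis
    using that[OF k] by (simp add: dot_cross_self)
qed

lemma block_sum_velocity_of_moved_edge:
  assumes "u $ g = w" "\<And>h. h \<notin> {a, b, g} \<Longrightarrow> u $ h = 0" "X \<inter> {a, b} = {}"
  shows "block_sum X u = (if g \<in> X then w else 0)"
proof -
  have "block_sum X u = (\<Sum>h\<in>X. if h = g then w else 0)"
    unfolding block_sum_def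
  proof (rule sum.cong)
    fix h assume "h \<in> X"
    then show "u $ h = (if h = g then w else 0)"
      using assms(1,3) assms(2)[of h] by auto
  qed simp
  then show ?thesis by simp
qed

lemma eventually_at_right_nonzero_along_curve:
  assumes c: "curve_through len c \<rho> u" and Q: "continuous_on UNIV Q" "Q \<rho> \<noteq> (0::'b::real_normed_vector)"
  shows "\<forall>\<^sub>F t in at_right 0. Q (c t) \<noteq> 0"
proof -
  have "isCont c 0"
    using curve_throughD(3)[OF c] has_vector_derivative_continuous by blast
  then have "isCont (\<lambda>t. Q (c t)) 0"
    by (rule isCont_o2) (use Q(1) in \<open>simp add: continuous_on_eq_continuous_at\<close>)
  then have "\<forall>\<^sub>F t in at 0. Q (c t) \<noteq> 0"
    using Q(2) curve_throughD(2)[OF c] by (auto simp: isCont_def intro: tendsto_imp_eventually_ne)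
  then show ?thesis
    by (simp add: eventually_at_split)
qed

text \<open>The compensating edges a and b lie outside X, so the sum of X moves exactly with its
  edge g. The map Q records what earlier perturbations have achieved: its being nonzero is an open
  condition and survives a small motion.\<close>

lemma perturb_to_nonzero:
  fixes Q :: "real^3^'e::finite \<Rightarrow> real^3"
  assumes \<rho>: "\<rho> \<in> closed_polygons len" and pos: "\<And>e. len e > 0" and ab: "\<rho> $ a \<times> \<rho> $ b \<noteq> 0"
    and g: "g \<in> X" and X: "X \<inter> {a, b} = {}" and Q: "continuous_on UNIV Q" "Q \<rho> \<noteq> 0"
  obtains \<sigma> where "\<sigma> \<in> closed_polygons len" "block_sum X \<sigma> \<noteq> 0" "Q \<sigma> \<noteq> 0"
proof (cases "block_sum X \<rho> = 0")
  case True
  have "\<rho> $ g \<noteq> 0"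
    using \<rho> pos by (metis closed_polygons_iff less_irrefl norm_zero)
  then obtain w where w: "w \<noteq> 0" "w \<bullet> \<rho> $ g = 0"
    by (rule perpendicular_direction)
  have "g \<noteq> a" "g \<noteq> b" using g X by auto
  then obtain c u where c: "curve_through len c \<rho> u" and u: "u $ g = w" "\<And>h. h \<notin> {a, b, g} \<Longrightarrow> u $ h = 0"
    using move_edge[OF \<rho> ab _ _ pos w(2)] by blast
  have "block_sum X u = w"
    using block_sum_velocity_of_moved_edge[OF u X] g by simp
  then have "((\<lambda>t. block_sum X (c t)) has_vector_derivative w) (at 0)"
    using has_vector_derivative_block_sum[OF curve_throughD(3)[OF c]] by metis
  then have "\<forall>\<^sub>F t in at_right 0. block_sum X (c t) \<noteq> 0"
    by (rule eventually_nonzero_if_derivative_nonzero) (use True w curve_throughD(2)[OF c] in auto)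
  moreover have "\<forall>\<^sub>F t in at_right 0. Q (c t) \<noteq> 0"
    by (rule eventually_at_right_nonzero_along_curve[OF c Q])
  ultimately have "\<forall>\<^sub>F t in at_right (0::real). block_sum X (c t) \<noteq> 0 \<and> Q (c t) \<noteq> 0"
    by (rule eventually_conj)
  then obtain t where "block_sum X (c t) \<noteq> 0 \<and> Q (c t) \<noteq> 0"
    using eventually_happens trivial_limit_at_right_real by blast
  then show ?thesis
    using that curve_throughD(1)[OF c] by blast
qed (use that \<rho> Q in blast)

text \<open>The velocity w is also chosen orthogonal to the sum of Y, and that sum has velocity 0
  because Y contains neither g nor a or b. The cross product thus starts with derivative
  \<open>w \<times> block_sum Y \<rho>\<close>, nonzero as a product of orthogonal nonzero
  vectors.\<close>

lemma perturb_to_nonparallel: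
  fixes Q :: "real^3^'e::finite \<Rightarrow> real^3"
  assumes \<rho>: "\<rho> \<in> closed_polygons len" and pos: "\<And>e. len e > 0" and ab: "\<rho> $ a \<times> \<rho> $ b \<noteq> 0"
    and g: "g \<in> X" and X: "X \<inter> {a, b} = {}" and Y: "Y \<inter> {a, b} = {}" "X \<inter> Y = {}" "block_sum Y \<rho> \<noteq> 0"
    and Q: "continuous_on UNIV Q" "Q \<rho> \<noteq> 0"
  obtains \<sigma> where "\<sigma> \<in> closed_polygons len" "block_sum X \<sigma> \<times> block_sum Y \<sigma> \<noteq> 0" "Q \<sigma> \<noteq> 0"
proof (cases "block_sum X \<rho> \<times> block_sum Y \<rho> = 0")
  case True
  have "\<rho> $ g \<noteq> 0"
    using \<rho> pos by (metis closed_polygons_iff less_irrefl norm_zero)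
  then obtain w where w: "w \<noteq> 0" "w \<bullet> \<rho> $ g = 0" "w \<bullet> block_sum Y \<rho> = 0"
    by (rule perpendicular_direction)
  have "g \<noteq> a" "g \<noteq> b" using g X by auto
  then obtain c u where c: "curve_through len c \<rho> u" and u: "u $ g = w" "\<And>h. h \<notin> {a, b, g} \<Longrightarrow> u $ h = 0"
    using move_edge[OF \<rho> ab _ _ pos w(2)] by blast
  have "block_sum X u = w" "block_sum Y u = 0"
    using block_sum_velocity_of_moved_edge[OF u X] block_sum_velocity_of_moved_edge[OF u Y(1)] g Y(2) by auto
  then have "((\<lambda>t. block_sum X (c t)) has_vector_derivative w) (at 0)"
    "((\<lambda>t. block_sum Y (c t)) has_vector_derivative 0) (at 0)"
    using has_vector_derivative_block_sum[OF curve_throughD(3)[OF c]] by metis+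
  then have "((\<lambda>t. block_sum X (c t) \<times> block_sum Y (c t)) has_vector_derivative
      block_sum X (c 0) \<times> 0 + w \<times> block_sum Y (c 0)) (at 0)"
    by (rule bounded_bilinear.has_vector_derivative[OF bounded_bilinear_cross3])
  then have "\<forall>\<^sub>F t in at_right 0. block_sum X (c t) \<times> block_sum Y (c t) \<noteq> 0"
    by (rule eventually_nonzero_if_derivative_nonzero)
      (use True w Y(3) norm_and_cross_eq_0[of w] curve_throughD(2)[OF c] in auto)
  moreover have "\<forall>\<^sub>F t in at_right 0. Q (c t) \<noteq> 0"
    by (rule eventually_at_right_nonzero_along_curve[OF c Q])
  ultimately have "\<forall>\<^sub>F t in at_right (0::real). block_sum X (c t) \<times> block_sum Y (c t) \<noteq> 0 \<and> Q (c t) \<noteq> 0"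
    by (rule eventually_conj)
  then obtain t where "block_sum X (c t) \<times> block_sum Y (c t) \<noteq> 0 \<and> Q (c t) \<noteq> 0"
    using eventually_happens trivial_limit_at_right_real by blast
  then show ?thesis
    using that curve_throughD(1)[OF c] by blast
qed (use that \<rho> Q in blast)

text \<open>Supplies compensating edges from a condition on block sums: in the bilinear expansion of
  the cross product some term is nonzero.\<close>

lemma nonparallel_edges_of_blocks:
  assumes "block_sum X \<rho> \<times> block_sum Y \<rho> \<noteq> 0"
  obtains x y where "x \<in> X" "y \<in> Y" "\<rho> $ x \<times> \<rho> $ y \<noteq> 0"
proof -
  have "block_sum X \<rho> \<times> block_sum Y \<rho> = (\<Sum>x\<in>X. \<Sum>y\<in>Y. \<rho> $ x \<times> \<rho> $ y)"
    unfolding block_sum_def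
    by (subst linear_sum[OF bounded_linear.linear[OF bounded_bilinear.bounded_linear_left[OF bounded_bilinear_cross3]]])
      (subst linear_sum[OF bounded_linear.linear[OF bounded_bilinear.bounded_linear_right[OF bounded_bilinear_cross3]]], simp)
  then show thesis
    using assms that by (metis (no_types, lifting) sum.neutral)
qed

lemma continuous_on_block_sum: "continuous_on UNIV (block_sum I)"
  unfolding block_sum_def[abs_def] by (intro continuous_intros)

lemma continuous_on_cross_block_sum: "continuous_on UNIV (\<lambda>\<rho>. block_sum X \<rho> \<times> block_sum Y \<rho>)"
  by (intro continuous_on_cross continuous_on_block_sum)

lemma four_blocks_partition_sum:
  assumes "\<rho> \<in> closed_polygons len" "A \<union> B \<union> C \<union> D = UNIV"
    "A \<inter> B = {}" "A \<inter> C = {}" "A \<inter> D = {}" "B \<inter> C = {}" "B \<inter> D = {}" "C \<inter> D = {}"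
  shows "block_sum A \<rho> + block_sum B \<rho> + block_sum C \<rho> + block_sum D \<rho> = 0"
proof -
  have "block_sum UNIV \<rho> = block_sum A \<rho> + block_sum B \<rho> + block_sum C \<rho> + block_sum D \<rho>"
    using assms(3-) unfolding assms(2)[symmetric] by (subst block_sum_Un, blast)+ simp
  then show ?thesis
    using assms(1) by (simp add: closed_polygons_iff)
qed

text \<open>Moving single edges of C, D, A and B in turn makes the sums of C and D and those of A and B
  non-parallel; if the quadrilateral is still flat, it is folded by a quarter turn of A and B about its diagonal.\<close>

lemma four_blocks_core:
  assumes \<rho>: "\<rho> \<in> closed_polygons len" and pos: "\<And>e. len e > 0"
    and ef: "e \<in> A" "f \<in> B" "\<rho> $ e \<times> \<rho> $ f \<noteq> 0" and ne: "C \<noteq> {}" "D \<noteq> {}"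
    and part: "A \<union> B \<union> C \<union> D = UNIV"
      "A \<inter> B = {}" "A \<inter> C = {}" "A \<inter> D = {}" "B \<inter> C = {}" "B \<inter> D = {}" "C \<inter> D = {}"
  obtains \<sigma> where "\<sigma> \<in> closed_polygons len" "block_sum A \<sigma> \<bullet> (block_sum B \<sigma> \<times> block_sum C \<sigma>) \<noteq> 0"
proof -
  obtain gC gD where g: "gC \<in> C" "gD \<in> D" using ne by blast
  define Q where "Q \<rho> = \<rho> $ e \<times> \<rho> $ f" for \<rho> :: "real^3^'a"
  have Q: "continuous_on UNIV Q"
    unfolding Q_def by (intro continuous_on_cross continuous_intros)
  obtain \<rho>1 where \<rho>1: "\<rho>1 \<in> closed_polygons len" "block_sum C \<rho>1 \<noteq> 0" "Q \<rho>1 \<noteq> 0"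
    by (rule perturb_to_nonzero[OF \<rho> pos ef(3) g(1) _ Q]) (use ef part in \<open>auto simp: Q_def\<close>)
  obtain \<rho>2 where \<rho>2: "\<rho>2 \<in> closed_polygons len" "block_sum D \<rho>2 \<times> block_sum C \<rho>2 \<noteq> 0"
    by (rule perturb_to_nonparallel[OF \<rho>1(1) pos \<rho>1(3)[unfolded Q_def] g(2) _ _ _ \<rho>1(2) Q \<rho>1(3)]) (use ef part in auto)
  note QDC = continuous_on_cross_block_sum[of D C]
  \<comment> \<open>From here on edges of A and B move, so the compensation passes from e and f to
    edges of D and C. The pair is chosen anew after the next perturbation, because only the block
    sums are kept non-parallel, not these particular edges.\<close>
  obtain d c where dc: "d \<in> D" "c \<in> C" "\<rho>2 $ d \<times> \<rho>2 $ c \<noteq> 0"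
    using nonparallel_edges_of_blocks[OF \<rho>2(2)] by blast
  obtain \<rho>3 where \<rho>3: "\<rho>3 \<in> closed_polygons len" "block_sum A \<rho>3 \<noteq> 0" "block_sum D \<rho>3 \<times> block_sum C \<rho>3 \<noteq> 0"
    by (rule perturb_to_nonzero[OF \<rho>2(1) pos dc(3) ef(1) _ QDC]) (use dc \<rho>2 part in auto)
  obtain d c where dc: "d \<in> D" "c \<in> C" "\<rho>3 $ d \<times> \<rho>3 $ c \<noteq> 0"
    using nonparallel_edges_of_blocks[OF \<rho>3(3)] by blast
  obtain \<rho>4 where \<rho>4: "\<rho>4 \<in> closed_polygons len" "block_sum B \<rho>4 \<times> block_sum A \<rho>4 \<noteq> 0"
      "block_sum D \<rho>4 \<times> block_sum C \<rho>4 \<noteq> 0"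
    by (rule perturb_to_nonparallel[OF \<rho>3(1) pos dc(3) ef(2) _ _ _ \<rho>3(2) QDC \<rho>3(3)]) (use dc part in auto)
  define a b c d v where "a = block_sum A \<rho>4" and "b = block_sum B \<rho>4" and "c = block_sum C \<rho>4"
    and "d = block_sum D \<rho>4" and "v = block_sum (A \<union> B) \<rho>4"
  have v: "v = a + b"
    using part(2) by (simp add: v_def a_def b_def block_sum_Un)
  have "a + b + c + d = 0"
    unfolding a_def b_def c_def d_def by (rule four_blocks_partition_sum[OF \<rho>4(1) part])
  then have d: "d = - (v + c)"
    by (simp add: v eq_neg_iff_add_eq_0 algebra_simps)
  have ba: "b \<times> a \<noteq> 0" and "d \<times> c \<noteq> 0"
    using \<rho>4 by (simp_all add: a_def b_def c_def d_def)
  then have vc: "v \<times> c \<noteq> 0"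
    by (simp add: d Cross3.left_diff_distrib)
  have va: "v \<times> a \<noteq> 0"
    using ba by (simp add: v cross_add_left)
  then have v0: "v \<noteq> 0" by auto
  show thesis
  proof (cases "a \<bullet> (v \<times> c) = 0")
    case False
    then have "a \<bullet> (b \<times> c) \<noteq> 0"
      by (simp add: v cross_add_left inner_add_right dot_cross_self)
    then show ?thesis
      using that[OF \<rho>4(1)] by (simp add: a_def b_def c_def)
  next
    case True
    define \<sigma> where "\<sigma> = Rot (A \<union> B) (pi/2) \<rho>4"
    define a' where "a' = rot v (pi/2) a"
    have \<sigma>: "block_sum A \<sigma> = a'" "block_sum C \<sigma> = c" "block_sum (A \<union> B) \<sigma> = v"
      unfolding \<sigma>_def a'_def a_def c_def v_def using part
      by (subst block_sum_Rot_subset block_sum_Rot_supset block_sum_Rot_disjoint; auto)+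
    have "block_sum B \<sigma> = v - a'"
      using \<sigma> part(2) by (simp add: block_sum_Un algebra_simps)
    then have det: "block_sum A \<sigma> \<bullet> (block_sum B \<sigma> \<times> block_sum C \<sigma>) = a' \<bullet> (v \<times> c)"
      by (simp add: \<sigma> Cross3.left_diff_distrib inner_diff_right dot_cross_self)
    have "a' = sgn v \<times> a + (sgn v \<bullet> a) *\<^sub>R sgn v"
      by (simp add: a'_def rot_def)
    then have a': "a' \<bullet> (v \<times> c) = (1 / norm v) * ((v \<times> a) \<bullet> (v \<times> c))"
      by (simp add: sgn_div_norm cross_mult_left inner_add_left dot_cross_self inverse_eq_divide)
    \<comment> \<open>The quarter turn replaces the part of a across v by
      \<open>sgn v \<times> a\<close>. If the determinant still vanished,
      \<open>v \<times> c\<close> would be orthogonal to v, to a (by \<open>True\<close>) and to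
      \<open>v \<times> a\<close>, hence zero.\<close>
    have "a' \<bullet> (v \<times> c) \<noteq> 0"
    proof
      assume "a' \<bullet> (v \<times> c) = 0"
      then have "(v \<times> c) \<bullet> (v \<times> a) = 0"
        using a' v0 by (simp add: inner_commute)
      then have "v \<times> c = 0"
        using orthogonal_to_cross_frame[OF va, of "v \<times> c"] True by (simp add: dot_cross_self inner_commute)
      with vc show False by simp
    qed
    moreover have "\<sigma> \<in> closed_polygons len"
      unfolding \<sigma>_def using v0 by (intro Rot_closed_polygons[OF \<rho>4(1)]) (simp add: v_def)
    ultimately show ?thesis
      using that det by metis
  qed
qed

lemma parallel_trans:
  fixes g a b :: "real^3"
  assumes "g \<noteq> 0" "g \<times> a = 0" "g \<times> b = 0"
  shows "a \<times> b = 0"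
proof -
  have "(g \<bullet> x) *\<^sub>R g = (g \<bullet> g) *\<^sub>R x" if "g \<times> x = 0" for x
    using Lagrange[of g g x] that by simp
  then have "(g \<bullet> g) *\<^sub>R (a \<times> b) = (g \<bullet> a) *\<^sub>R (g \<times> b)"
    using assms by (metis cross_mult_left)
  then show ?thesis
    using assms by simp
qed

text \<open>There are non-parallel edges in different blocks: if the pair given by genericity lies
  in one block, an edge g outside cannot be parallel to both. Since the four block sums add up to 0,
  the determinants of any three of them agree up to sign, so it does not matter which two blocks
  contain the pair.\<close>

proposition four_blocks_noncoplanar:
  assumes gen: "generic len" and pos: "\<And>e. len e > 0" and ne: "Pol len \<noteq> {}"
    and blocks: "A \<noteq> {}" "B \<noteq> {}" "C \<noteq> {}" "D \<noteq> {}"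
    and part: "A \<union> B \<union> C \<union> D = UNIV"
      "A \<inter> B = {}" "A \<inter> C = {}" "A \<inter> D = {}" "B \<inter> C = {}" "B \<inter> D = {}" "C \<inter> D = {}"
  obtains \<sigma> where "\<sigma> \<in> closed_polygons len" "block_sum A \<sigma> \<bullet> (block_sum B \<sigma> \<times> block_sum C \<sigma>) \<noteq> 0"
proof -
  obtain \<rho> where \<rho>: "\<rho> \<in> closed_polygons len"
    using ne by (auto simp: Pol_def)
  obtain a b where ab: "\<rho> $ a \<times> \<rho> $ b \<noteq> 0"
    using generic_nonparallel[OF gen pos \<rho>] by blast
  define separate where "separate e f \<longleftrightarrow> (\<forall>X\<in>{A, B, C, D}. \<not> (e \<in> X \<and> f \<in> X))" for e f
  have "\<exists>e f. separate e f \<and> \<rho> $ e \<times> \<rho> $ f \<noteq> 0"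
  proof (cases "separate a b")
    case False
    then obtain X where X: "X \<in> {A, B, C, D}" "a \<in> X" "b \<in> X"
      by (auto simp: separate_def)
    then have "A \<inter> X = {} \<or> B \<inter> X = {}"
      using part by auto
    then obtain g where g: "g \<notin> X"
      using blocks by blast
    have "separate g a" "separate g b"
      using X g part by (auto simp: separate_def)
    moreover have "\<rho> $ g \<noteq> 0"
      using \<rho> pos by (metis closed_polygons_iff less_irrefl norm_zero)
    ultimately show ?thesis
      using parallel_trans[of "\<rho> $ g" "\<rho> $ a" "\<rho> $ b"] ab by blast
  qed (use ab in blast)
  then obtain e f where ef: "separate e f" "\<rho> $ e \<times> \<rho> $ f \<noteq> 0" by blast
  then have fe: "\<rho> $ f \<times> \<rho> $ e \<noteq> 0"
    by (metis cross_skew neg_equal_0_iff_equal)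
  note core = four_blocks_core[OF \<rho> pos]
  note s = four_blocks_partition_sum[OF _ part, of _ len]
  have sums: "block_sum D \<sigma> = - (block_sum A \<sigma> + block_sum B \<sigma> + block_sum C \<sigma>)" if "\<sigma> \<in> closed_polygons len" for \<sigma>
    using minus_unique[OF s[OF that]] by simp
  define det where "det X Y Z \<sigma> = block_sum X \<sigma> \<bullet> (block_sum Y \<sigma> \<times> block_sum Z \<sigma>)" for X Y Z and \<sigma> :: "real^3^'a"
  have perm: "det A C B \<sigma> = - det A B C \<sigma>" "det B C A \<sigma> = det A B C \<sigma>" for \<sigma>
    unfolding det_def by (metis cross_skew inner_minus_right, metis inner_triple_commute)
  have perm': "det A D B \<sigma> = det A B C \<sigma>" "det B D A \<sigma> = - det A B C \<sigma>" "det C D A \<sigma> = det A B C \<sigma>"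
    if "\<sigma> \<in> closed_polygons len" for \<sigma>
  proof -
    have "det A D B \<sigma> = - det A C B \<sigma>"
      by (simp add: det_def sums[OF that] cross_add_left Cross3.left_diff_distrib inner_add_right inner_diff_right dot_cross_self)
    then show "det A D B \<sigma> = det A B C \<sigma>" by (simp add: perm)
    have "det B D A \<sigma> = - det B C A \<sigma>"
      by (simp add: det_def sums[OF that] cross_add_left Cross3.left_diff_distrib inner_add_right inner_diff_right dot_cross_self)
    then show "det B D A \<sigma> = - det A B C \<sigma>" by (simp add: perm)
    have "det C D A \<sigma> = - det C B A \<sigma>"
      by (simp add: det_def sums[OF that] cross_add_left Cross3.left_diff_distrib inner_add_right inner_diff_right dot_cross_self)
    also have "det C B A \<sigma> = - det A B C \<sigma>"
      using perm(1)[of \<sigma>] unfolding det_def by (metis inner_triple_commute)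
    finally show "det C D A \<sigma> = det A B C \<sigma>" by simp
  qed
  have "\<exists>\<sigma>\<in>closed_polygons len. det A B C \<sigma> \<noteq> 0"
    if *: "\<rho> $ e \<times> \<rho> $ f \<noteq> 0" "e \<in> A \<and> f \<in> B \<or> e \<in> A \<and> f \<in> C \<or> e \<in> A \<and> f \<in> D \<or> e \<in> B \<and> f \<in> C \<or> e \<in> B \<and> f \<in> D \<or> e \<in> C \<and> f \<in> D"
    for e f
    using *(2)
  proof (elim disjE conjE)
    assume "e \<in> A" "f \<in> B"
    from core[OF this *(1) blocks(3,4)] show ?thesis
      using part by (metis det_def)
  next
    assume "e \<in> A" "f \<in> C"
    from core[OF this *(1) blocks(2,4)] obtain \<sigma> where "\<sigma> \<in> closed_polygons len" "det A C B \<sigma> \<noteq> 0"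
      using part by (auto simp: det_def Un_ac Int_ac)
    then show ?thesis using perm by auto
  next
    assume "e \<in> A" "f \<in> D"
    from core[OF this *(1) blocks(2,3)] obtain \<sigma> where "\<sigma> \<in> closed_polygons len" "det A D B \<sigma> \<noteq> 0"
      using part by (auto simp: det_def Un_ac Int_ac)
    then show ?thesis using perm' by auto
  next
    assume "e \<in> B" "f \<in> C"
    from core[OF this *(1) blocks(1,4)] obtain \<sigma> where "\<sigma> \<in> closed_polygons len" "det B C A \<sigma> \<noteq> 0"
      using part by (auto simp: det_def Un_ac Int_ac)
    then show ?thesis using perm by auto
  next
    assume "e \<in> B" "f \<in> D"
    from core[OF this *(1) blocks(1,3)] obtain \<sigma> where "\<sigma> \<in> closed_polygons len" "det B D A \<sigma> \<noteq> 0"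
      using part by (auto simp: det_def Un_ac Int_ac)
    then show ?thesis using perm' by auto
  next
    assume "e \<in> C" "f \<in> D"
    from core[OF this *(1) blocks(1,2)] obtain \<sigma> where "\<sigma> \<in> closed_polygons len" "det C D A \<sigma> \<noteq> 0"
      using part by (auto simp: det_def Un_ac Int_ac)
    then show ?thesis using perm' by auto
  qed
  note cases = this
  have "e \<in> A \<union> B \<union> C \<union> D" "f \<in> A \<union> B \<union> C \<union> D"
    unfolding part by auto
  then have "\<exists>\<sigma>\<in>closed_polygons len. det A B C \<sigma> \<noteq> 0"
    using cases[OF ef(2)] cases[OF fe] ef(1) unfolding separate_def by blast
  then show thesis
    using that by (auto simp: det_def)
qed

section \<open>Infinitesimal rigidity\<close>

text \<open>Two non-parallel edges fix the rotation. Relative to them the scalar products determine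
  every other edge up to reflection in their plane, and the triple products decide the side.\<close>

lemma same_invariants_imp_same_orbit:
  assumes gen: "generic len" and pos: "\<And>e. len e > 0"
    and \<rho>: "\<rho> \<in> closed_polygons len" and \<sigma>: "\<sigma> \<in> closed_polygons len"
    and gram: "\<And>e f. \<rho> $ e \<bullet> \<rho> $ f = \<sigma> $ e \<bullet> \<sigma> $ f"
    and vol: "\<And>e f g. \<rho> $ e \<bullet> (\<rho> $ f \<times> \<rho> $ g) = \<sigma> $ e \<bullet> (\<sigma> $ f \<times> \<sigma> $ g)"
  shows "SO3_orbit \<rho> = SO3_orbit \<sigma>"
proof -
  obtain a b where ab: "\<rho> $ a \<times> \<rho> $ b \<noteq> 0"
    using generic_nonparallel[OF gen pos \<rho>] by blast
  obtain A where A: "rotation_matrix A" "A *v (\<rho> $ a) = \<sigma> $ a" "A *v (\<rho> $ b) = \<sigma> $ b"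
    by (rule rotation_between_frames[OF ab gram gram gram])
  have "A *v (\<rho> $ a \<times> \<rho> $ b) = \<sigma> $ a \<times> \<sigma> $ b"
    using cross_rotation_matrix[OF A(1), of "\<rho> $ a" "\<rho> $ b"] A by simp
  then have ab': "\<sigma> $ a \<times> \<sigma> $ b \<noteq> 0"
    using ab rotation_matrix_norm[OF A(1)] by (metis norm_eq_zero)
  have "act A \<rho> $ e - \<sigma> $ e = 0" for e
  proof (rule orthogonal_to_cross_frame[OF ab'])
    have i: "(A *v x) \<bullet> (A *v y) = x \<bullet> y" for x y
      by (rule rotation_matrix_inner[OF A(1)])
    show "(act A \<rho> $ e - \<sigma> $ e) \<bullet> \<sigma> $ a = 0" "(act A \<rho> $ e - \<sigma> $ e) \<bullet> \<sigma> $ b = 0"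
      using i[of "\<rho> $ e" "\<rho> $ a"] i[of "\<rho> $ e" "\<rho> $ b"] A gram by (simp_all add: inner_diff_left)
    have "(A *v \<rho> $ e) \<bullet> (\<sigma> $ a \<times> \<sigma> $ b) = \<rho> $ e \<bullet> (\<rho> $ a \<times> \<rho> $ b)"
      using i[of "\<rho> $ e" "\<rho> $ a \<times> \<rho> $ b"] \<open>A *v (\<rho> $ a \<times> \<rho> $ b) = \<sigma> $ a \<times> \<sigma> $ b\<close> by simp
    then show "(act A \<rho> $ e - \<sigma> $ e) \<bullet> (\<sigma> $ a \<times> \<sigma> $ b) = 0"
      using vol by (simp add: inner_diff_left)
  qed
  then have "act A \<rho> = \<sigma>"
    by (subst vec_eq_iff) simp
  then show ?thesis
    using SO3_orbit_act[OF A(1)] by metis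
qed

text \<open>Together with \<open>volume_variation\<close>, the derivatives in direction x of the
  invariants that separate the orbits.\<close>

definition gram_variation :: "real^3^'e::finite \<Rightarrow> real^3^'e \<Rightarrow> 'e \<Rightarrow> 'e \<Rightarrow> real" where
  "gram_variation \<rho> x e f = \<rho> $ e \<bullet> x $ f + x $ e \<bullet> \<rho> $ f"

definition volume_variation :: "real^3^'e::finite \<Rightarrow> real^3^'e \<Rightarrow> 'e \<Rightarrow> 'e \<Rightarrow> 'e \<Rightarrow> real" where
  "volume_variation \<rho> x e f g = \<rho> $ e \<bullet> (\<rho> $ f \<times> x $ g + x $ f \<times> \<rho> $ g) + x $ e \<bullet> (\<rho> $ f \<times> \<rho> $ g)"

lemma gram_variation_diff: "gram_variation \<rho> (x - y) e f = gram_variation \<rho> x e f - gram_variation \<rho> y e f"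
  by (simp add: gram_variation_def inner_diff_left inner_diff_right)

lemma volume_variation_diff:
  "volume_variation \<rho> (x - y) e f g = volume_variation \<rho> x e f g - volume_variation \<rho> y e f g"
  by (simp add: volume_variation_def Cross3.left_diff_distrib Cross3.right_diff_distrib
      inner_diff_left inner_diff_right inner_add_right)

lemma gram_variation_rotation: "gram_variation \<rho> (rotation_field UNIV \<xi> \<rho>) e f = 0"
proof -
  have "\<rho> $ e \<bullet> (\<xi> \<times> \<rho> $ f) = - ((\<xi> \<times> \<rho> $ e) \<bullet> \<rho> $ f)"
    by (metis cross_skew cross_triple inner_commute inner_minus_left)
  then show ?thesis
    by (simp add: gram_variation_def rotation_field_def)
qed

lemma volume_variation_rotation: "volume_variation \<rho> (rotation_field UNIV \<xi> \<rho>) e f g = 0"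
proof -
  have J: "b \<times> (\<xi> \<times> c) + (\<xi> \<times> b) \<times> c = \<xi> \<times> (b \<times> c)" for b c :: "real^3"
    using Jacobi[of \<xi> b c] cross_skew[of c \<xi>] cross_skew[of "\<xi> \<times> b" c]
    by (simp add: add_eq_0_iff)
  have "\<rho> $ e \<bullet> (\<xi> \<times> (\<rho> $ f \<times> \<rho> $ g)) = - ((\<xi> \<times> \<rho> $ e) \<bullet> (\<rho> $ f \<times> \<rho> $ g))"
    by (metis cross_skew cross_triple inner_commute inner_minus_left)
  then show ?thesis
    by (simp add: volume_variation_def rotation_field_def J)
qed

lemma has_real_derivative_gram:
  assumes "(c has_vector_derivative u) (at a)"
  shows "((\<lambda>s. c s $ e \<bullet> c s $ f) has_real_derivative gram_variation (c a) u e f) (at a)"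
proof -
  have c: "((\<lambda>s. c s $ e) has_vector_derivative u $ e) (at a)" for e
    using assms by (simp add: has_vector_derivative_vec_nth_iff[of c])
  show ?thesis
    using bounded_bilinear.has_vector_derivative[OF bounded_bilinear_inner c c]
    by (simp add: gram_variation_def has_real_derivative_iff_has_vector_derivative)
qed

lemma has_real_derivative_volume:
  assumes "(c has_vector_derivative u) (at a)"
  shows "((\<lambda>s. c s $ e \<bullet> (c s $ f \<times> c s $ g)) has_real_derivative volume_variation (c a) u e f g) (at a)"
proof -
  have c: "((\<lambda>s. c s $ e) has_vector_derivative u $ e) (at a)" for e
    using assms by (simp add: has_vector_derivative_vec_nth_iff[of c])
  show ?thesis
    using bounded_bilinear.has_vector_derivative[OF bounded_bilinear_inner c
        bounded_bilinear.has_vector_derivative[OF bounded_bilinear_cross3 c c]]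
    by (simp add: volume_variation_def has_real_derivative_iff_has_vector_derivative)
qed

text \<open>The linearised form of \<open>same_invariants_imp_same_orbit\<close>: after subtraction
  of the infinitesimal rotation that agrees with x on the frame a, b, stationary invariants make the
  rest orthogonal to the frame and its normal.\<close>

lemma infinitesimal_rigidity:
  assumes ab: "\<rho> $ a \<times> \<rho> $ b \<noteq> 0"
    and gram: "\<And>e f. gram_variation \<rho> x e f = 0" and vol: "\<And>e f g. volume_variation \<rho> x e f g = 0"
  obtains \<xi> where "x = rotation_field UNIV \<xi> \<rho>"
proof -
  have xx: "x $ e \<bullet> \<rho> $ e = 0" for e
    using gram[of e e] by (simp add: gram_variation_def inner_commute)
  obtain \<xi> where \<xi>: "x $ a = \<xi> \<times> \<rho> $ a" "x $ b = \<xi> \<times> \<rho> $ b"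
    using infinitesimal_rotation_on_frame[OF ab xx xx] gram[of b a]
    by (metis add.commute gram_variation_def inner_commute)
  define y where "y = x - rotation_field UNIV \<xi> \<rho>"
  have yab: "y $ a = 0" "y $ b = 0"
    using \<xi> by (simp_all add: y_def rotation_field_def)
  have gy: "gram_variation \<rho> y e f = 0" for e f
    by (simp add: y_def gram_variation_diff gram gram_variation_rotation)
  have vy: "volume_variation \<rho> y e f g = 0" for e f g
    by (simp add: y_def volume_variation_diff vol volume_variation_rotation)
  have "y $ e = 0" for e
    by (rule orthogonal_to_cross_frame[OF ab])
      (use gy[of e a] gy[of e b] vy[of e a b] yab in \<open>simp_all add: gram_variation_def volume_variation_def\<close>)
  then have "y = 0" by (simp add: vec_eq_iff[of y])
  then show thesis
    using that[of \<xi>] by (simp add: y_def)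
qed

lemma SO3_orbit_eq_gram: "SO3_orbit \<rho> = SO3_orbit \<sigma> \<Longrightarrow> \<rho> $ e \<bullet> \<rho> $ f = \<sigma> $ e \<bullet> \<sigma> $ f"
  by (erule SO3_orbit_eqD) (simp add: rotation_matrix_inner)

lemma SO3_orbit_eq_volume:
  "SO3_orbit \<rho> = SO3_orbit \<sigma> \<Longrightarrow> \<rho> $ e \<bullet> (\<rho> $ f \<times> \<rho> $ g) = \<sigma> $ e \<bullet> (\<sigma> $ f \<times> \<sigma> $ g)"
  by (erule SO3_orbit_eqD) (simp add: rotation_matrix_inner cross_rotation_matrix)

text \<open>The rotation taking one lift to the other may depend on time without any regularity and
  cannot be differentiated. The invariants of both lifts are the same functions of time, so the
  difference of the velocities leaves them stationary.\<close>

lemma velocities_of_same_orbit_curve: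
  assumes gen: "generic len" and pos: "\<And>e. len e > 0"
    and c: "curve_through len c \<rho> u" and d: "curve_through len d \<rho> w"
    and orb: "\<And>t. SO3_orbit (c t) = SO3_orbit (d t)"
  obtains \<xi> where "u - w = rotation_field UNIV \<xi> \<rho>"
proof -
  obtain a b where ab: "\<rho> $ a \<times> \<rho> $ b \<noteq> 0"
    using generic_nonparallel[OF gen pos curve_throughD(4)[OF c]] by blast
  have g: "gram_variation \<rho> u e f = gram_variation \<rho> w e f" for e f
  proof (rule DERIV_unique)
    show "((\<lambda>s. c s $ e \<bullet> c s $ f) has_real_derivative gram_variation \<rho> u e f) (at 0)"
      using has_real_derivative_gram[OF curve_throughD(3)[OF c]] curve_throughD(2)[OF c] by simp
    show "((\<lambda>s. c s $ e \<bullet> c s $ f) has_real_derivative gram_variation \<rho> w e f) (at 0)"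
      using has_real_derivative_gram[OF curve_throughD(3)[OF d]] curve_throughD(2)[OF d] SO3_orbit_eq_gram[OF orb] by simp
  qed
  have v: "volume_variation \<rho> u e f g = volume_variation \<rho> w e f g" for e f g
  proof (rule DERIV_unique)
    show "((\<lambda>s. c s $ e \<bullet> (c s $ f \<times> c s $ g)) has_real_derivative volume_variation \<rho> u e f g) (at 0)"
      using has_real_derivative_volume[OF curve_throughD(3)[OF c]] curve_throughD(2)[OF c] by simp
    show "((\<lambda>s. c s $ e \<bullet> (c s $ f \<times> c s $ g)) has_real_derivative volume_variation \<rho> w e f g) (at 0)"
      using has_real_derivative_volume[OF curve_throughD(3)[OF d]] curve_throughD(2)[OF d] SO3_orbit_eq_volume[OF orb] by simp
  qed
  obtain \<xi> where "u - w = rotation_field UNIV \<xi> \<rho>"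
    by (rule infinitesimal_rigidity[OF ab, of "u - w"]) (simp_all add: gram_variation_diff volume_variation_diff g v)
  then show thesis
    by (rule that)
qed

section \<open>Hamiltonian flows\<close>

lemma hamiltonian_vector_unique:
  assumes gen: "generic len" and pos: "\<And>e. len e > 0" and \<rho>: "\<rho> \<in> closed_polygons len"
    and "hamiltonian_vector len F \<rho> u" "hamiltonian_vector len F \<rho> u'" "tangent \<rho> u" "tangent \<rho> u'"
  obtains \<xi> where "u - u' = rotation_field UNIV \<xi> \<rho>"
proof (rule KKS_kernel[OF gen pos \<rho>])
  show "tangent \<rho> (u - u')"
    using assms by (simp add: tangent_diff)
  show "KKS_form \<rho> (u - u') w = 0" if "curve_through len c \<rho> w" for c w
    using assms(4,5) that unfolding hamiltonian_vector_def KKS_form_diff_left by (metis DERIV_unique diff_self)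
qed (use that in blast)

lemma closed_polygon_edge_nonzero:
  assumes "\<And>e. len e > 0" "\<rho> \<in> closed_polygons len"
  shows "\<rho> $ e \<noteq> 0"
  using assms by (metis closed_polygons_iff less_irrefl norm_zero)

text \<open>The chain rule for the norm, differentiable at a nonzero block sum, turns the derivative
  of the length into a scalar product that the moment map identity
  \<open>KKS_form_rotation_field\<close> evaluates as the form.\<close>

lemma hamiltonian_vector_bend_length:
  assumes pos: "\<And>e. len e > 0" and \<rho>: "\<rho> \<in> closed_polygons len" and nz: "block_sum I \<rho> \<noteq> 0"
  shows "hamiltonian_vector len (bend_length I) \<rho> (rotation_field I (sgn (block_sum I \<rho>)) \<rho>)"
  unfolding hamiltonian_vector_def
proof (intro allI impI)
  fix b w assume b: "curve_through len b \<rho> w"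
  have db: "((\<lambda>s. block_sum I (b s)) has_derivative (\<lambda>h. h *\<^sub>R block_sum I w)) (at 0)"
    using has_vector_derivative_block_sum[OF curve_throughD(3)[OF b]] by (simp add: has_vector_derivative_def)
  have "(norm has_derivative (\<lambda>h. h \<bullet> sgn (block_sum I \<rho>))) (at (block_sum I (b 0)))"
    using has_derivative_norm[OF nz] curve_throughD(2)[OF b] by simp
  from has_derivative_compose[OF db this]
  have "((\<lambda>s. norm (block_sum I (b s))) has_derivative (\<lambda>h. (h *\<^sub>R block_sum I w) \<bullet> sgn (block_sum I \<rho>))) (at 0)"
    by simp
  then have "((\<lambda>s. norm (block_sum I (b s))) has_real_derivative sgn (block_sum I \<rho>) \<bullet> block_sum I w) (at 0)"
    by (simp add: has_real_derivative_iff_has_vector_derivative has_vector_derivative_def inner_commute)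
  then show "((\<lambda>s. bend_length I (SO3_orbit (b s))) has_real_derivative
      KKS_form \<rho> (rotation_field I (sgn (block_sum I \<rho>)) \<rho>) w) (at 0)"
    using KKS_form_rotation_field[OF closed_polygon_edge_nonzero[OF pos \<rho>] curve_through_tangent[OF b]]
    by (simp add: bend_length_block_sum)
qed

lemma dsgn_add: "dsgn v (w + w') = dsgn v w + dsgn v w'"
  by (simp add: dsgn_def inner_add_right add_divide_distrib algebra_simps)

lemma twist_add: "twist v (w + w') t = twist v w t + twist v w' t"
  by (simp add: twist_def dsgn_add cross_add_right algebra_simps)

lemma block_sum_add: "block_sum I (u + w) = block_sum I u + block_sum I w"
  by (simp add: block_sum_def sum.distrib)

lemma Rot_velocity_add: "Rot_velocity I t r \<rho> (u + w) = Rot_velocity I t r \<rho> u + Rot_velocity I t 0 \<rho> w"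
  by (subst vec_eq_iff) (auto simp: Rot_velocity_def block_sum_add twist_add cross_add_left
      simp flip: linear_add[OF linear_rot] intro!: arg_cong[of _ _ "rot _ _"])

text \<open>Obtained without computation by differentiating
  \<open>Rot I (t - s) (Rot I s \<rho>)\<close>, which does not depend on s.\<close>

lemma Rot_velocity_bend:
  assumes nz: "block_sum I \<rho> \<noteq> 0"
  shows "Rot_velocity I t (- 1) \<rho> (rotation_field I (sgn (block_sum I \<rho>)) \<rho>) = 0"
proof -
  have "((\<lambda>s. Rot I s \<rho>) has_vector_derivative Rot_velocity I 0 1 \<rho> 0) (at 0)"
    using has_vector_derivative_Rot[OF DERIV_ident has_vector_derivative_const, of I \<rho> 0] nz by simp
  then have d: "((\<lambda>s. Rot I s \<rho>) has_vector_derivative rotation_field I (sgn (block_sum I \<rho>)) \<rho>) (at 0)"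
    by (simp add: Rot_velocity_at_0)
  have "((\<lambda>s. t - s) has_real_derivative - 1) (at 0)"
    by (auto intro!: derivative_eq_intros)
  from has_vector_derivative_Rot[OF this d, of I] nz
  have "((\<lambda>s. Rot I (t - s) (Rot I s \<rho>)) has_vector_derivative
      Rot_velocity I t (- 1) \<rho> (rotation_field I (sgn (block_sum I \<rho>)) \<rho>)) (at 0)"
    by simp
  then have "((\<lambda>s. Rot I t \<rho>) has_vector_derivative
      Rot_velocity I t (- 1) \<rho> (rotation_field I (sgn (block_sum I \<rho>)) \<rho>)) (at (0::real))"
    by (simp add: Rot_Rot[OF nz])
  then show ?thesis
    by (metis has_vector_derivative_const vector_derivative_unique_at)
qed

text \<open>The derivative of the equivariance of the bend along the rotations E with angular
  velocity \<open>\<xi>\<close>. The case of a zero vector is separate because it has no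
  axis.\<close>

lemma Rot_velocity_rotation_field:
  assumes nz: "block_sum I \<rho> \<noteq> 0"
  shows "Rot_velocity I t 0 \<rho> (rotation_field UNIV \<xi> \<rho>) = rotation_field UNIV \<xi> (Rot I t \<rho>)"
proof (cases "\<xi> = 0")
  case True
  then have "rotation_field UNIV \<xi> \<sigma> = 0" for \<sigma> :: "real^3^'a"
    by (subst vec_eq_iff) (simp add: rotation_field_def)
  moreover have "Rot_velocity I t 0 \<rho> 0 = 0"
    by (subst vec_eq_iff) (simp add: Rot_velocity_def twist_def dsgn_def block_sum_def linear_0[OF linear_rot])
  ultimately show ?thesis by simp
next
  case False
  define E where "E s = matrix (rot \<xi> (norm \<xi> * s))" for s
  have E: "rotation_matrix (E s)" for s
    unfolding E_def by (rule rotation_matrix_rot[OF False])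
  have dE: "((\<lambda>s. act (E s) \<sigma>) has_vector_derivative rotation_field UNIV \<xi> \<sigma>) (at 0)" for \<sigma> :: "real^3^'a"
  proof (subst has_vector_derivative_vec_nth_iff, rule allI)
    fix e
    have "((\<lambda>s. norm \<xi> * s) has_real_derivative norm \<xi>) (at 0)"
      by (auto intro!: derivative_eq_intros)
    from has_vector_derivative_rot[OF has_vector_derivative_const False this has_vector_derivative_const, of "\<sigma> $ e"]
    show "((\<lambda>s. act (E s) \<sigma> $ e) has_vector_derivative rotation_field UNIV \<xi> \<sigma> $ e) (at 0)"
      using False by (simp add: E_def rotation_field_def sgn_div_norm)
  qed
  have E0: "act (E 0) \<rho> = \<rho>"
    by (subst vec_eq_iff) (simp add: E_def)
  from has_vector_derivative_Rot[OF DERIV_const dE, of I \<rho> t] nz E0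
  have "((\<lambda>s. Rot I t (act (E s) \<rho>)) has_vector_derivative Rot_velocity I t 0 \<rho> (rotation_field UNIV \<xi> \<rho>)) (at 0)"
    by simp
  then have "((\<lambda>s. act (E s) (Rot I t \<rho>)) has_vector_derivative Rot_velocity I t 0 \<rho> (rotation_field UNIV \<xi> \<rho>)) (at 0)"
    by (simp add: Rot_act[OF E])
  then show ?thesis
    using dE by (metis vector_derivative_unique_at)
qed

text \<open>Undoing the flow by the explicit rotation leaves a path whose lifts have infinitesimal rotations as
  velocities, so all scalar and triple products are constant along it.\<close>

lemma hamiltonian_flow_bend_length_unique:
  assumes gen: "generic len" and pos: "\<And>e. len e > 0" and I: "lopsided len I"
    and \<Phi>: "is_hamiltonian_flow len (bend_length I) \<Phi>" and \<rho>: "\<rho> \<in> closed_polygons len"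
  shows "\<Phi> t (SO3_orbit \<rho>) = SO3_orbit (Rot I t \<rho>)"
proof -
  define p where "p = SO3_orbit \<rho>"
  have p: "p \<in> Pol len"
    using \<rho> by (simp add: p_def)
  have nz: "block_sum I \<sigma> \<noteq> 0" if "\<sigma> \<in> closed_polygons len" for \<sigma>
    using lopsided_closed_polygon[OF I that] .
  have "\<Phi> t p \<in> Pol len" for t
    using \<Phi> p by (auto simp: is_hamiltonian_flow_def dest: Bij_imp_funcset)
  then have "\<exists>\<sigma>. \<sigma> \<in> closed_polygons len \<and> \<Phi> t p = SO3_orbit \<sigma>" for t
    by (metis PolE)
  \<comment> \<open>These representatives are chosen point by point and need not be continuous; only
    invariant functions of them will be differentiated.\<close>
  then obtain r where r: "\<And>t. r t \<in> closed_polygons len" "\<And>t. \<Phi> t p = SO3_orbit (r t)"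
    by metis
  define y where "y t = Rot I (- t) (r t)" for t
  have y: "y t \<in> closed_polygons len" for t
    unfolding y_def by (intro Rot_closed_polygons nz r)
  have der: "\<exists>z \<xi>. (\<forall>s. SO3_orbit (z s) = SO3_orbit (y (t + s))) \<and>
      (z has_vector_derivative rotation_field UNIV \<xi> (z 0)) (at 0)" for t
  proof -
    have "\<exists>c \<sigma> u. curve_through len c \<sigma> u \<and> (\<forall>s. SO3_orbit (c s) = \<Phi> (t + s) p) \<and>
        hamiltonian_vector len (bend_length I) \<sigma> u"
      using \<Phi> p by (simp add: is_hamiltonian_flow_def)
    then obtain c \<sigma> u where c: "curve_through len c \<sigma> u" and orb: "\<And>s. SO3_orbit (c s) = \<Phi> (t + s) p"
      and hv: "hamiltonian_vector len (bend_length I) \<sigma> u"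
      by auto
    note \<sigma> = curve_throughD[OF c]
    define X where "X = rotation_field I (sgn (block_sum I \<sigma>)) \<sigma>"
    have tX: "tangent \<sigma> X"
      using curve_through_tangent[OF curve_through_bend[OF \<sigma>(4) nz[OF \<sigma>(4)], of 1]] by (simp add: X_def)
    obtain \<xi> where \<xi>: "u - X = rotation_field UNIV \<xi> \<sigma>"
      by (rule hamiltonian_vector_unique[OF gen pos \<sigma>(4) hv _ curve_through_tangent[OF c] tX])
        (simp add: X_def hamiltonian_vector_bend_length[OF pos \<sigma>(4) nz[OF \<sigma>(4)]])
    \<comment> \<open>The bend is undone on the lift c, which has a velocity at 0, in place of r. By
      \<open>Rot_velocity_bend\<close> the Hamiltonian part X of that velocity cancels against the
      running angle, and only the orbit direction is left.\<close>
    define z where "z s = Rot I (- t - s) (c s)" for s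
    have "SO3_orbit (z s) = SO3_orbit (y (t + s))" for s
    proof -
      have "SO3_orbit (r (t + s)) = SO3_orbit (c s)"
        using orb r by simp
      then obtain A where "rotation_matrix A" "c s = act A (r (t + s))"
        by (rule SO3_orbit_eqD)
      then show ?thesis
        by (simp add: z_def y_def Rot_act SO3_orbit_act)
    qed
    moreover have "(z has_vector_derivative rotation_field UNIV \<xi> (z 0)) (at 0)"
    proof -
      have "((\<lambda>s. - t - s) has_real_derivative - 1) (at 0)"
        by (auto intro!: derivative_eq_intros)
      from has_vector_derivative_Rot[OF this \<sigma>(3), of I] nz[OF \<sigma>(4)] \<sigma>(2)
      have "(z has_vector_derivative Rot_velocity I (- t) (- 1) \<sigma> u) (at 0)"
        by (simp add: z_def[abs_def])
      moreover have "u = X + rotation_field UNIV \<xi> \<sigma>"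
        using \<xi> by (simp add: algebra_simps)
      ultimately show ?thesis
        using nz[OF \<sigma>(4)] \<sigma>(2)
        by (simp add: Rot_velocity_add Rot_velocity_bend X_def Rot_velocity_rotation_field z_def)
    qed
    ultimately show ?thesis by blast
  qed
  have "SO3_orbit (y t) = SO3_orbit (y 0)"
  proof (rule same_invariants_imp_same_orbit[OF gen pos y y])
    show "y t $ e \<bullet> y t $ f = y 0 $ e \<bullet> y 0 $ f" for e f
    proof (rule DERIV_isconst_all[of "\<lambda>t. y t $ e \<bullet> y t $ f"], rule allI)
      fix t
      obtain z \<xi> where z: "\<And>s. SO3_orbit (z s) = SO3_orbit (y (t + s))"
        and dz: "(z has_vector_derivative rotation_field UNIV \<xi> (z 0)) (at 0)"
        using der by metis
      have "((\<lambda>s. y (t + s) $ e \<bullet> y (t + s) $ f) has_real_derivative 0) (at 0)"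
        using has_real_derivative_gram[OF dz, of e f] SO3_orbit_eq_gram[OF z]
        by (simp add: gram_variation_rotation)
      then show "((\<lambda>t. y t $ e \<bullet> y t $ f) has_real_derivative 0) (at t)"
        using DERIV_shift[of "\<lambda>t. y t $ e \<bullet> y t $ f" 0 0 t] by (simp add: add.commute)
    qed
    show "y t $ e \<bullet> (y t $ f \<times> y t $ g) = y 0 $ e \<bullet> (y 0 $ f \<times> y 0 $ g)" for e f g
    proof (rule DERIV_isconst_all[of "\<lambda>t. y t $ e \<bullet> (y t $ f \<times> y t $ g)"], rule allI)
      fix t
      obtain z \<xi> where z: "\<And>s. SO3_orbit (z s) = SO3_orbit (y (t + s))"
        and dz: "(z has_vector_derivative rotation_field UNIV \<xi> (z 0)) (at 0)"
        using der by metis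
      have "((\<lambda>s. y (t + s) $ e \<bullet> (y (t + s) $ f \<times> y (t + s) $ g)) has_real_derivative 0) (at 0)"
        using has_real_derivative_volume[OF dz, of e f g] SO3_orbit_eq_volume[OF z]
        by (simp add: volume_variation_rotation)
      then show "((\<lambda>t. y t $ e \<bullet> (y t $ f \<times> y t $ g)) has_real_derivative 0) (at t)"
        using DERIV_shift[of "\<lambda>t. y t $ e \<bullet> (y t $ f \<times> y t $ g)" 0 0 t] by (simp add: add.commute)
    qed
  qed
  also have "SO3_orbit (y 0) = SO3_orbit \<rho>"
    using \<Phi> p r(2)[of 0] by (simp add: y_def is_hamiltonian_flow_def p_def)
  finally obtain A where A: "rotation_matrix A" "\<rho> = act A (y t)"
    by (rule SO3_orbit_eqD)
  then have "SO3_orbit (Rot I t \<rho>) = SO3_orbit (Rot I t (y t))"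
    by (simp add: Rot_act SO3_orbit_act)
  also have "Rot I t (y t) = r t"
    unfolding y_def using Rot_Rot[OF nz[OF r(1)]] by simp
  finally show ?thesis
    using r(2) by (simp add: p_def)
qed

section \<open>Maps of the polygon space induced by equivariant maps of polygons\<close>

definition pol_map :: "('e::finite \<Rightarrow> real) \<Rightarrow> (real^3^'e \<Rightarrow> real^3^'e) \<Rightarrow> (real^3^'e) set \<Rightarrow> (real^3^'e) set" where
  "pol_map len L = (\<lambda>p\<in>Pol len. L ` p)"

definition equivariant_on_polygons :: "('e::finite \<Rightarrow> real) \<Rightarrow> (real^3^'e \<Rightarrow> real^3^'e) \<Rightarrow> bool" where
  "equivariant_on_polygons len L \<longleftrightarrow> (\<forall>\<rho>\<in>closed_polygons len. L \<rho> \<in> closed_polygons len \<and>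
     (\<forall>A. rotation_matrix A \<longrightarrow> L (act A \<rho>) = act A (L \<rho>)))"

lemma pol_map_orbit:
  assumes "equivariant_on_polygons len L" "\<rho> \<in> closed_polygons len"
  shows "pol_map len L (SO3_orbit \<rho>) = SO3_orbit (L \<rho>)"
proof -
  have orb: "SO3_orbit \<sigma> = (\<lambda>A. act A \<sigma>) ` Collect rotation_matrix" for \<sigma> :: "real^3^'a"
    by (simp add: SO3_orbit_eq setcompr_eq_image)
  have "L ` SO3_orbit \<rho> = SO3_orbit (L \<rho>)"
    unfolding orb image_image using assms by (intro image_cong) (simp_all add: equivariant_on_polygons_def)
  then show ?thesis
    using assms(2) by (simp add: pol_map_def)
qed

lemma pol_map_in_Pol:
  assumes "equivariant_on_polygons len L" "p \<in> Pol len"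
  shows "pol_map len L p \<in> Pol len"
  using assms(2) by (rule PolE) (use assms(1) in \<open>simp add: pol_map_orbit[OF assms(1)] equivariant_on_polygons_def\<close>)

lemma pol_map_extensional: "pol_map len L \<in> extensional (Pol len)"
  by (simp add: pol_map_def)

lemma pol_map_pol_map:
  assumes "equivariant_on_polygons len L" "equivariant_on_polygons len M" "p \<in> Pol len"
  shows "pol_map len L (pol_map len M p) = pol_map len (\<lambda>\<rho>. L (M \<rho>)) p"
  using assms(3) pol_map_in_Pol[OF assms(2,3)] by (simp add: pol_map_def image_image)

lemma pol_map_cong:
  assumes "\<And>\<rho>. \<rho> \<in> closed_polygons len \<Longrightarrow> L \<rho> = M \<rho>"
  shows "pol_map len L = pol_map len M"
proof
  fix p
  show "pol_map len L p = pol_map len M p"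
  proof (cases "p \<in> Pol len")
    case True
    then have "p \<subseteq> closed_polygons len"
      using SO3_orbit_subset_closed_polygons by (auto elim: PolE)
    then show ?thesis
      using True assms by (auto simp: pol_map_def intro!: image_cong)
  qed (simp add: pol_map_def)
qed

lemma pol_map_id: "p \<in> Pol len \<Longrightarrow> pol_map len (\<lambda>\<rho>. \<rho>) p = p"
  by (simp add: pol_map_def)

lemma equivariant_on_polygons_comp:
  "equivariant_on_polygons len L \<Longrightarrow> equivariant_on_polygons len M \<Longrightarrow> equivariant_on_polygons len (\<lambda>\<rho>. L (M \<rho>))"
  by (simp add: equivariant_on_polygons_def)

lemma equivariant_Rot: "lopsided len I \<Longrightarrow> equivariant_on_polygons len (Rot I t)"
  by (simp add: equivariant_on_polygons_def Rot_act Rot_closed_polygons lopsided_closed_polygon)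

text \<open>The inverse of the induced map is induced by the inverse on polygons. \<open>Bij\<close>
  consists of extensional functions, which is why \<open>pol_map\<close> is restricted to
  \<open>Pol len\<close>.\<close>

lemma pol_map_Bij:
  assumes "equivariant_on_polygons len L" "equivariant_on_polygons len M"
    and "\<And>\<rho>. \<rho> \<in> closed_polygons len \<Longrightarrow> L (M \<rho>) = \<rho>" "\<And>\<rho>. \<rho> \<in> closed_polygons len \<Longrightarrow> M (L \<rho>) = \<rho>"
  shows "pol_map len L \<in> Bij (Pol len)"
proof -
  have inv: "pol_map len L (pol_map len M p) = p" "pol_map len M (pol_map len L p) = p" if "p \<in> Pol len" for p
    using pol_map_pol_map[OF assms(1,2) that] pol_map_pol_map[OF assms(2,1) that]
      pol_map_cong[of len "\<lambda>\<rho>. L (M \<rho>)" "\<lambda>\<rho>. \<rho>"] pol_map_cong[of len "\<lambda>\<rho>. M (L \<rho>)" "\<lambda>\<rho>. \<rho>"] assms(3,4)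
    by (simp_all add: pol_map_id that)
  have "bij_betw (pol_map len L) (Pol len) (Pol len)"
    by (rule bij_betw_byWitness[where f' = "pol_map len M"])
      (use inv pol_map_in_Pol[OF assms(1)] pol_map_in_Pol[OF assms(2)] in auto)
  then show ?thesis
    by (simp add: Bij_def pol_map_extensional)
qed

text \<open>By the group law a derivative at time 0 is enough: at time t the lift is the path of
  \<open>L s\<close> applied to the polygon \<open>L t \<rho>\<close>.\<close>

lemma is_hamiltonian_flow_pol_map:
  assumes eq: "\<And>t. equivariant_on_polygons len (L t)"
    and L0: "\<And>\<rho>. \<rho> \<in> closed_polygons len \<Longrightarrow> L 0 \<rho> = \<rho>"
    and Ladd: "\<And>s t \<rho>. \<rho> \<in> closed_polygons len \<Longrightarrow> L s (L t \<rho>) = L (s + t) \<rho>"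
    and der: "\<And>\<rho>. \<rho> \<in> closed_polygons len \<Longrightarrow> ((\<lambda>s. L s \<rho>) has_vector_derivative X \<rho>) (at 0)"
    and ham: "\<And>\<rho>. \<rho> \<in> closed_polygons len \<Longrightarrow> hamiltonian_vector len F \<rho> (X \<rho>)"
  shows "is_hamiltonian_flow len F (\<lambda>t. pol_map len (L t))"
  unfolding is_hamiltonian_flow_def
proof (intro conjI allI ballI)
  show "pol_map len (L t) \<in> Bij (Pol len)" for t
    by (rule pol_map_Bij[where M = "L (- t)"]) (simp_all add: eq Ladd L0)
  fix p assume p: "p \<in> Pol len"
  then obtain \<rho> where \<rho>: "\<rho> \<in> closed_polygons len" "p = SO3_orbit \<rho>"
    by (rule PolE)
  have LP: "L t \<sigma> \<in> closed_polygons len" if "\<sigma> \<in> closed_polygons len" for t \<sigma>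
    using eq[of t] that by (simp add: equivariant_on_polygons_def)
  show "pol_map len (L 0) p = p"
    using \<rho> by (simp add: pol_map_orbit[OF eq] L0)
  fix t
  have "curve_through len (\<lambda>s. L s (L t \<rho>)) (L t \<rho>) (X (L t \<rho>))"
    using der[OF LP[OF \<rho>(1)]] LP \<rho> by (simp add: curve_through_def L0)
  moreover have "\<forall>s. SO3_orbit (L s (L t \<rho>)) = pol_map len (L (t + s)) p"
    using \<rho> by (simp add: pol_map_orbit[OF eq] Ladd add.commute)
  ultimately show "\<exists>c \<rho> u. curve_through len c \<rho> u \<and> (\<forall>s. SO3_orbit (c s) = pol_map len (L (t + s)) p) \<and>
      hamiltonian_vector len F \<rho> u"
    using ham[OF LP[OF \<rho>(1)]] by blast
qed

lemma is_hamiltonian_flow_Rot: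
  assumes pos: "\<And>e. len e > 0" and I: "lopsided len I"
  shows "is_hamiltonian_flow len (bend_length I) (\<lambda>t. pol_map len (Rot I t))"
proof (rule is_hamiltonian_flow_pol_map)
  fix \<rho> assume \<rho>: "\<rho> \<in> closed_polygons len"
  note nz = lopsided_closed_polygon[OF I \<rho>]
  show "Rot I s (Rot I t \<rho>) = Rot I (s + t) \<rho>" for s t
    by (rule Rot_Rot[OF nz])
  show "((\<lambda>s. Rot I s \<rho>) has_vector_derivative rotation_field I (sgn (block_sum I \<rho>)) \<rho>) (at 0)"
    using curve_throughD(3)[OF curve_through_bend[OF \<rho> nz, of 1]] by simp
  show "hamiltonian_vector len (bend_length I) \<rho> (rotation_field I (sgn (block_sum I \<rho>)) \<rho>)"
    by (rule hamiltonian_vector_bend_length[OF pos \<rho> nz])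
qed (simp_all add: equivariant_Rot[OF I])

text \<open>Resolves the definite description in \<open>hamiltonian_flow\<close>. Uniqueness holds
  for functions on all sets of polygons, since outside \<open>Pol len\<close> both sides have the
  default value of extensional functions.\<close>

proposition bending_flow_eq_pol_map_Rot:
  assumes gen: "generic len" and pos: "\<And>e. len e > 0" and I: "lopsided len I"
  shows "bending_flow len I = (\<lambda>t. pol_map len (Rot I t))"
  unfolding bending_flow_def hamiltonian_flow_def
proof (rule the_equality)
  show "is_hamiltonian_flow len (bend_length I) (\<lambda>t. pol_map len (Rot I t))"
    by (rule is_hamiltonian_flow_Rot[OF pos I])
  fix \<Phi> assume \<Phi>: "is_hamiltonian_flow len (bend_length I) \<Phi>"
  show "\<Phi> = (\<lambda>t. pol_map len (Rot I t))"
  proof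
    fix t
    show "\<Phi> t = pol_map len (Rot I t)"
    proof (rule extensionalityI[of _ "Pol len"])
      show "\<Phi> t \<in> extensional (Pol len)"
        using \<Phi> by (simp add: is_hamiltonian_flow_def Bij_imp_extensional)
      fix p assume "p \<in> Pol len"
      then show "\<Phi> t p = pol_map len (Rot I t) p"
        by (elim PolE) (simp add: hamiltonian_flow_bend_length_unique[OF gen pos I \<Phi>] pol_map_orbit[OF equivariant_Rot[OF I]])
    qed (rule pol_map_extensional)
  qed
qed

lemma is_hamiltonian_flow_cong:
  assumes "\<And>\<rho>. \<rho> \<in> closed_polygons len \<Longrightarrow> F (SO3_orbit \<rho>) = G (SO3_orbit \<rho>)"
  shows "is_hamiltonian_flow len F = is_hamiltonian_flow len G"
proof -
  have "hamiltonian_vector len F = hamiltonian_vector len G"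
    unfolding hamiltonian_vector_def using assms by (auto simp: fun_eq_iff curve_through_def)
  then show ?thesis
    by (simp add: is_hamiltonian_flow_def fun_eq_iff)
qed

text \<open>On closed polygons the two block sums are opposite, so both sets have the same
  Hamiltonian. A flow cannot tell a set from its complement, hence the role of complements in the
  classification of compatible sets.\<close>

lemma bending_flow_Compl: "bending_flow len (- I) = bending_flow len I"
proof -
  have "bend_length (- I) (SO3_orbit \<rho>) = bend_length I (SO3_orbit \<rho>)" if "\<rho> \<in> closed_polygons len" for \<rho>
  proof -
    have "block_sum (- I) \<rho> = - block_sum I \<rho>"
      using block_sum_UNIV_split[of I \<rho>] that by (simp add: closed_polygons_iff minus_unique)
    then show ?thesis by (simp add: bend_length_block_sum)
  qed
  then show ?thesis
    unfolding bending_flow_def hamiltonian_flow_def by (subst is_hamiltonian_flow_cong) auto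
qed

section \<open>Calculus of smooth maps\<close>

lemma Ck_on_cong:
  assumes "Ck_on k f S" "open S" "\<And>x. x \<in> S \<Longrightarrow> f x = g x"
  shows "Ck_on k g S"
  using assms(1,3)
proof (induction k arbitrary: f g)
  case 0
  then show ?case by (auto cong: continuous_on_cong)
next
  case (Suc k)
  have g': "(g has_derivative frechet_derivative f (at x)) (at x)" if x: "x \<in> S" for x
  proof -
    have "(f has_derivative frechet_derivative f (at x)) (at x)"
      using Suc.prems(1) x frechet_derivative_works by auto
    then show ?thesis
      by (rule has_derivative_transform_within_open[OF _ assms(2) x]) (use Suc.prems in auto)
  qed
  have "g differentiable at x" if "x \<in> S" for x
    using g'[OF that] by (auto simp: differentiable_def)
  moreover have "Ck_on k (\<lambda>x. frechet_derivative g (at x) v) S" for v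
  proof (rule Suc.IH)
    show "Ck_on k (\<lambda>x. frechet_derivative f (at x) v) S"
      using Suc.prems(1) by simp
    show "frechet_derivative f (at x) v = frechet_derivative g (at x) v" if "x \<in> S" for x
      using frechet_derivative_at[OF g'[OF that]] by metis
  qed
  ultimately show ?case by simp
qed

lemma Ck_on_SucI:
  assumes "open S" "\<And>x. x \<in> S \<Longrightarrow> (f has_derivative f' x) (at x)" "\<And>v. Ck_on k (\<lambda>x. f' x v) S"
  shows "Ck_on (Suc k) f S"
proof -
  have "f differentiable at x" if "x \<in> S" for x
    using assms(2)[OF that] by (auto simp: differentiable_def)
  moreover have "Ck_on k (\<lambda>x. frechet_derivative f (at x) v) S" for v
    by (rule Ck_on_cong[OF assms(3)[of v] assms(1)]) (metis frechet_derivative_at assms(2))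
  ultimately show ?thesis by simp
qed

lemma Ck_on_SucD:
  assumes "Ck_on (Suc k) f S"
  shows "x \<in> S \<Longrightarrow> (f has_derivative frechet_derivative f (at x)) (at x)"
    and "Ck_on k (\<lambda>x. frechet_derivative f (at x) v) S"
  using assms frechet_derivative_works by auto

lemma Ck_on_Suc_imp: "Ck_on (Suc k) f S \<Longrightarrow> Ck_on k f S"
proof (induction k arbitrary: f)
  case 0
  then show ?case
    by (auto intro!: continuous_at_imp_continuous_on differentiable_imp_continuous_within)
next
  case (Suc k)
  show ?case
    using Suc.prems Suc.IH unfolding Ck_on.simps(2)[of "Suc k"] Ck_on.simps(2)[of k f] by blast
qed

lemma Ck_on_subset: "Ck_on k f S \<Longrightarrow> T \<subseteq> S \<Longrightarrow> Ck_on k f T"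
  by (induction k arbitrary: f) (auto intro: continuous_on_subset)

lemma Ck_on_const: "open S \<Longrightarrow> Ck_on k (\<lambda>x. c) S"
proof (induction k arbitrary: c)
  case (Suc k)
  then show ?case by (intro Ck_on_SucI[where f' = "\<lambda>x v. 0"]) auto
qed simp

lemma Ck_on_bounded_linear_comp:
  assumes "bounded_linear L" "open S" "Ck_on k f S"
  shows "Ck_on k (\<lambda>x. L (f x)) S"
  using assms(3)
proof (induction k arbitrary: f)
  case 0
  then show ?case
    using bounded_linear.continuous_on[OF assms(1)] by simp
next
  case (Suc k)
  show ?case
    by (rule Ck_on_SucI[OF assms(2) bounded_linear.has_derivative[OF assms(1) Ck_on_SucD(1)[OF Suc.prems]]])
      (use Suc.IH Ck_on_SucD(2)[OF Suc.prems] in auto)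
qed

lemma Ck_on_bounded_linear:
  assumes "bounded_linear L" "open S"
  shows "Ck_on k L S"
proof (cases k)
  case 0
  then show ?thesis
    using linear_continuous_on[OF assms(1)] by simp
next
  case (Suc n)
  show ?thesis
    unfolding Suc
    by (rule Ck_on_SucI[OF assms(2) bounded_linear_imp_has_derivative[OF assms(1)] Ck_on_const[OF assms(2)]])
qed

lemma Ck_on_add:
  assumes "open S" "Ck_on k f S" "Ck_on k g S"
  shows "Ck_on k (\<lambda>x. f x + g x) S"
  using assms(2,3)
proof (induction k arbitrary: f g)
  case 0
  then show ?case by (simp add: continuous_on_add)
next
  case (Suc k)
  show ?case
    by (rule Ck_on_SucI[OF assms(1) has_derivative_add[OF Ck_on_SucD(1)[OF Suc.prems(1)] Ck_on_SucD(1)[OF Suc.prems(2)]]])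
      (use Suc.IH Ck_on_SucD(2)[OF Suc.prems(1)] Ck_on_SucD(2)[OF Suc.prems(2)] in auto)
qed

lemma Ck_on_sum:
  assumes "open S" "\<And>i. i \<in> J \<Longrightarrow> Ck_on k (f i) S"
  shows "Ck_on k (\<lambda>x. \<Sum>i\<in>J. f i x) S"
  using assms(2)
  by (induction J rule: infinite_finite_induct) (simp_all add: Ck_on_const[OF assms(1)] Ck_on_add[OF assms(1)])

lemma Ck_on_bounded_bilinear:
  assumes "bounded_bilinear m" "open S" "Ck_on k f S" "Ck_on k g S"
  shows "Ck_on k (\<lambda>x. m (f x) (g x)) S"
  using assms(3,4)
proof (induction k arbitrary: f g)
  case 0
  then show ?case by (simp add: bounded_bilinear.continuous_on[OF assms(1)])
next
  case (Suc k)
  show ?case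
  proof (rule Ck_on_SucI[OF assms(2)])
    show "((\<lambda>x. m (f x) (g x)) has_derivative
        (\<lambda>v. m (f x) (frechet_derivative g (at x) v) + m (frechet_derivative f (at x) v) (g x))) (at x)" if "x \<in> S" for x
      by (rule bounded_bilinear.FDERIV[OF assms(1) Ck_on_SucD(1)[OF Suc.prems(1) that] Ck_on_SucD(1)[OF Suc.prems(2) that]])
    show "Ck_on k (\<lambda>x. m (f x) (frechet_derivative g (at x) v) + m (frechet_derivative f (at x) v) (g x)) S" for v
      by (rule Ck_on_add[OF assms(2) Suc.IH[OF Ck_on_Suc_imp[OF Suc.prems(1)] Ck_on_SucD(2)[OF Suc.prems(2)]]
            Suc.IH[OF Ck_on_SucD(2)[OF Suc.prems(1)] Ck_on_Suc_imp[OF Suc.prems(2)]]])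
  qed
qed

lemma Ck_on_compose:
  fixes f :: "'b::euclidean_space \<Rightarrow> 'c::real_normed_vector" and h :: "'a::real_normed_vector \<Rightarrow> 'b"
  assumes "open S" "Ck_on k h S" "Ck_on k f T" "h ` S \<subseteq> T"
  shows "Ck_on k (\<lambda>x. f (h x)) S"
  using assms(2,3)
proof (induction k arbitrary: f)
  case 0
  then show ?case
    using continuous_on_compose2[of T f S h] assms(4) by simp
next
  case (Suc k)
  let ?f' = "\<lambda>x. frechet_derivative f (at x)" and ?h' = "\<lambda>x. frechet_derivative h (at x)"
  have f': "(f has_derivative ?f' (h x)) (at (h x))" if "x \<in> S" for x
    using Ck_on_SucD(1)[OF Suc.prems(2)] that assms(4) by blast
  show ?case
  proof (rule Ck_on_SucI[OF assms(1)])
    fix x assume x: "x \<in> S"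
    have D: "((\<lambda>x. f (h x)) has_derivative (\<lambda>v. ?f' (h x) (?h' x v))) (at x)"
      by (rule has_derivative_compose[OF Ck_on_SucD(1)[OF Suc.prems(1) x] f'[OF x]])
    \<comment> \<open>The derivative of f at \<open>h x\<close> is applied to a vector that varies
      with x too. Expansion in the basis separates the two dependences, so that the induction
      hypothesis applies to derivatives of f in fixed directions.\<close>
    have rep: "?f' (h x) w = (\<Sum>b\<in>Basis. (w \<bullet> b) *\<^sub>R ?f' (h x) b)" for w
    proof -
      have "linear (?f' (h x))"
        using f'[OF x] has_derivative_linear by blast
      then have "?f' (h x) (\<Sum>b\<in>Basis. (w \<bullet> b) *\<^sub>R b) = (\<Sum>b\<in>Basis. (w \<bullet> b) *\<^sub>R ?f' (h x) b)"
        by (simp add: linear_sum linear_scale)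
      then show ?thesis by (simp add: euclidean_representation)
    qed
    show "((\<lambda>x. f (h x)) has_derivative (\<lambda>v. \<Sum>b\<in>Basis. (?h' x v \<bullet> b) *\<^sub>R ?f' (h x) b)) (at x)"
      by (rule has_derivative_eq_rhs[OF D]) (rule ext, rule rep)
  next
    fix v
    show "Ck_on k (\<lambda>x. \<Sum>b\<in>Basis. (?h' x v \<bullet> b) *\<^sub>R ?f' (h x) b) S"
    proof (rule Ck_on_sum[OF assms(1)])
      fix b :: 'b
      have "Ck_on k (\<lambda>x. ?h' x v \<bullet> b) S"
        by (rule Ck_on_bounded_linear_comp[OF bounded_linear_inner_left assms(1) Ck_on_SucD(2)[OF Suc.prems(1)]])
      moreover have "Ck_on k (\<lambda>x. ?f' (h x) b) S"
        by (rule Suc.IH[OF Ck_on_Suc_imp[OF Suc.prems(1)] Ck_on_SucD(2)[OF Suc.prems(2)]])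
      ultimately show "Ck_on k (\<lambda>x. (?h' x v \<bullet> b) *\<^sub>R ?f' (h x) b) S"
        by (rule Ck_on_bounded_bilinear[OF bounded_bilinear_scaleR assms(1)])
    qed
  qed
qed

text \<open>Real exponents keep the family closed under differentiation, so one induction over all
  of them suffices. Applied to the square of the norm, the exponents 1/2 and -1/2 give the norm and
  the factor in \<open>sgn\<close>.\<close>

lemma Ck_on_powr:
  fixes f :: "'a::real_normed_vector \<Rightarrow> real"
  assumes "open S" "Ck_on k f S" "\<And>x. x \<in> S \<Longrightarrow> f x > 0"
  shows "Ck_on k (\<lambda>x. f x powr a) S"
  using assms(2)
proof (induction k arbitrary: a)
  case 0
  then show ?case
    using assms(3) by (auto intro!: continuous_on_powr continuous_on_const simp: less_imp_neq[symmetric])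
next
  case (Suc k)
  show ?case
  proof (rule Ck_on_SucI[OF assms(1)])
    fix x assume x: "x \<in> S"
    have "((\<lambda>y. y powr a) has_real_derivative a * f x powr (a - 1)) (at (f x))"
      using assms(3)[OF x] by (rule has_real_derivative_powr)
    then show "((\<lambda>x. f x powr a) has_derivative (\<lambda>v. (a * f x powr (a - 1)) * frechet_derivative f (at x) v)) (at x)"
      using has_derivative_compose[OF Ck_on_SucD(1)[OF Suc.prems x]] by (simp add: has_field_derivative_def)
  next
    fix v
    have "Ck_on k (\<lambda>x. a * f x powr (a - 1)) S"
      by (rule Ck_on_bounded_linear_comp[OF bounded_linear_mult_right assms(1) Suc.IH[OF Ck_on_Suc_imp[OF Suc.prems]]])
    then show "Ck_on k (\<lambda>x. (a * f x powr (a - 1)) * frechet_derivative f (at x) v) S"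
      by (rule Ck_on_bounded_bilinear[OF bounded_bilinear_mult assms(1) _ Ck_on_SucD(2)[OF Suc.prems]])
  qed
qed

lemma Ck_on_vec_lambda:
  fixes f :: "'n::finite \<Rightarrow> 'a::real_normed_vector \<Rightarrow> 'b::euclidean_space"
  assumes "open S" "\<And>i. Ck_on k (f i) S"
  shows "Ck_on k (\<lambda>x. \<chi> i. f i x) S"
proof -
  have lin: "bounded_linear (axis i :: 'b \<Rightarrow> 'b^'n)" for i
    by (rule linear_conv_bounded_linear[THEN iffD1], rule linearI) (auto simp: vec_eq_iff axis_def)
  have "(\<Sum>i\<in>UNIV. axis i (f i x)) = (\<chi> i. f i x)" for x
    by (auto simp: vec_eq_iff axis_def sum.delta)
  moreover have "Ck_on k (\<lambda>x. \<Sum>i\<in>UNIV. axis i (f i x)) S"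
    by (intro Ck_on_sum[OF assms(1)] Ck_on_bounded_linear_comp[OF lin assms(1)] assms(2))
  ultimately show ?thesis by simp
qed

section \<open>Symplectomorphisms of the polygon space\<close>

lemma bounded_linear_block_sum: "bounded_linear (block_sum I)"
  unfolding block_sum_def[abs_def] by (intro bounded_linear_sum bounded_linear_vec_nth)

lemma open_block_sum_nonzero: "open {\<rho>. block_sum I \<rho> \<noteq> 0}"
  by (rule open_Collect_neq) (auto intro: continuous_on_block_sum)

lemma Ck_on_block_sum_power:
  "Ck_on k (\<lambda>\<rho>. (block_sum I \<rho> \<bullet> block_sum I \<rho>) powr a) {\<rho>. block_sum I \<rho> \<noteq> 0}"
  by (intro Ck_on_powr Ck_on_bounded_bilinear[OF bounded_bilinear_inner] open_block_sum_nonzero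
      Ck_on_bounded_linear[OF bounded_linear_block_sum]) simp

lemma Ck_on_norm_block_sum: "Ck_on k (\<lambda>\<rho>. norm (block_sum I \<rho>)) {\<rho>. block_sum I \<rho> \<noteq> 0}"
  by (rule Ck_on_cong[OF Ck_on_block_sum_power[where a = "1/2"] open_block_sum_nonzero])
    (simp add: norm_eq_sqrt_inner powr_half_sqrt)

lemma Ck_on_sgn_block_sum: "Ck_on k (\<lambda>\<rho>. sgn (block_sum I \<rho>)) {\<rho>. block_sum I \<rho> \<noteq> 0}"
proof (rule Ck_on_cong)
  show "Ck_on k (\<lambda>\<rho>. (block_sum I \<rho> \<bullet> block_sum I \<rho>) powr (- (1/2)) *\<^sub>R block_sum I \<rho>) {\<rho>. block_sum I \<rho> \<noteq> 0}"
    by (intro Ck_on_bounded_bilinear[OF bounded_bilinear_scaleR] Ck_on_block_sum_power open_block_sum_nonzero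
      Ck_on_bounded_linear[OF bounded_linear_block_sum])
qed (simp_all add: open_block_sum_nonzero sgn_div_norm norm_eq_sqrt_inner powr_minus powr_half_sqrt)

lemma Ck_on_Rot: "Ck_on k (Rot I t) {\<rho>. block_sum I \<rho> \<noteq> 0}"
proof -
  let ?U = "{\<rho>. block_sum I \<rho> \<noteq> 0}"
  note U = open_block_sum_nonzero[of I] and sgn = Ck_on_sgn_block_sum[of k I]
  have x: "Ck_on k (\<lambda>\<rho>. \<rho> $ e) ?U" for e
    by (rule Ck_on_bounded_linear[OF bounded_linear_vec_nth U])
  have "Ck_on k (\<lambda>\<rho>. rot (block_sum I \<rho>) t (\<rho> $ e)) ?U" for e
    unfolding rot_def
    by (intro Ck_on_add[OF U] Ck_on_bounded_bilinear[OF bounded_bilinear_scaleR U]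
        Ck_on_bounded_linear_comp[OF bounded_linear_scaleR_right U] Ck_on_bounded_linear_comp[OF bounded_linear_mult_right U]
        Ck_on_bounded_bilinear[OF bounded_bilinear_cross3 U] Ck_on_bounded_bilinear[OF bounded_bilinear_inner U] x sgn)
  then have "Ck_on k (\<lambda>\<rho>. if e \<in> I then rot (block_sum I \<rho>) t (\<rho> $ e) else \<rho> $ e) ?U" for e
    using x by (cases "e \<in> I") auto
  then show ?thesis
    unfolding Rot_def[abs_def] by (rule Ck_on_vec_lambda[OF U])
qed

text \<open>What a map of polygons has to satisfy, together with an inverse of the same kind, in
  order to induce a symplectomorphism. The derivative is tested on curves of polygons, so the
  conditions pass to composites by pushing curves forward.\<close>

definition symplectic_lift :: "('e::finite \<Rightarrow> real) \<Rightarrow> (real^3^'e \<Rightarrow> real^3^'e) \<Rightarrow> bool" where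
  "symplectic_lift len L \<longleftrightarrow> equivariant_on_polygons len L \<and>
     (\<forall>\<rho>\<in>closed_polygons len. \<exists>U. open U \<and> \<rho> \<in> U \<and> (\<forall>k. Ck_on k L U)) \<and>
     (\<forall>c \<rho> u. curve_through len c \<rho> u \<longrightarrow> (\<exists>w. ((\<lambda>s. L (c s)) has_vector_derivative w) (at 0))) \<and>
     (\<forall>c c' \<rho> u u' w w'. curve_through len c \<rho> u \<longrightarrow> curve_through len c' \<rho> u' \<longrightarrow>
        ((\<lambda>s. L (c s)) has_vector_derivative w) (at 0) \<longrightarrow> ((\<lambda>s. L (c' s)) has_vector_derivative w') (at 0) \<longrightarrow>
        KKS_form (L \<rho>) w w' = KKS_form \<rho> u u')"

lemma symplectic_liftD:
  assumes "symplectic_lift len L"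
  shows "equivariant_on_polygons len L"
    "\<rho> \<in> closed_polygons len \<Longrightarrow> \<exists>U. open U \<and> \<rho> \<in> U \<and> (\<forall>k. Ck_on k L U)"
    "curve_through len c \<rho> u \<Longrightarrow> \<exists>w. ((\<lambda>s. L (c s)) has_vector_derivative w) (at 0)"
    "curve_through len c \<rho> u \<Longrightarrow> curve_through len c' \<rho> u' \<Longrightarrow>
        ((\<lambda>s. L (c s)) has_vector_derivative w) (at 0) \<Longrightarrow> ((\<lambda>s. L (c' s)) has_vector_derivative w') (at 0) \<Longrightarrow>
        KKS_form (L \<rho>) w w' = KKS_form \<rho> u u'"
proof -
  note D = assms[unfolded symplectic_lift_def]
  show "equivariant_on_polygons len L"
    using D by (rule conjunct1)
  show "\<rho> \<in> closed_polygons len \<Longrightarrow> \<exists>U. open U \<and> \<rho> \<in> U \<and> (\<forall>k. Ck_on k L U)"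
    using D[THEN conjunct2, THEN conjunct1] by blast
  show "curve_through len c \<rho> u \<Longrightarrow> \<exists>w. ((\<lambda>s. L (c s)) has_vector_derivative w) (at 0)"
    using D[THEN conjunct2, THEN conjunct2, THEN conjunct1] by blast
  show "curve_through len c \<rho> u \<Longrightarrow> curve_through len c' \<rho> u' \<Longrightarrow>
        ((\<lambda>s. L (c s)) has_vector_derivative w) (at 0) \<Longrightarrow> ((\<lambda>s. L (c' s)) has_vector_derivative w') (at 0) \<Longrightarrow>
        KKS_form (L \<rho>) w w' = KKS_form \<rho> u u'"
    using D[THEN conjunct2, THEN conjunct2, THEN conjunct2] by blast
qed

lemma symplectic_lift_curve:
  assumes "symplectic_lift len L" "curve_through len c \<rho> u"
  obtains w where "curve_through len (\<lambda>s. L (c s)) (L \<rho>) w"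
  using symplectic_liftD(3)[OF assms] symplectic_liftD(1)[OF assms(1)] assms(2)
  by (auto simp: curve_through_def equivariant_on_polygons_def)

lemma symplectic_lift_id: "symplectic_lift len (\<lambda>\<rho>. \<rho>)"
proof -
  have "\<exists>U. open U \<and> \<rho> \<in> U \<and> (\<forall>k. Ck_on k (\<lambda>\<rho>. \<rho>) U)" for \<rho> :: "real^3^'a"
    using Ck_on_bounded_linear[OF bounded_linear_ident open_UNIV] by blast
  moreover have "KKS_form \<rho> w w' = KKS_form \<rho> u u'"
    if "curve_through len c \<rho> u" "curve_through len c' \<rho> u'" "(c has_vector_derivative w) (at 0)" "(c' has_vector_derivative w') (at 0)"
    for c c' \<rho> u u' w w'
    using that curve_throughD(3) vector_derivative_unique_at by metis
  ultimately show ?thesis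
    unfolding symplectic_lift_def equivariant_on_polygons_def using curve_throughD(3) by blast
qed

lemma symplectic_lift_comp:
  assumes L: "symplectic_lift len L" and M: "symplectic_lift len M"
  shows "symplectic_lift len (\<lambda>\<rho>. L (M \<rho>))"
proof -
  note LD = symplectic_liftD[OF L] and MD = symplectic_liftD[OF M]
  have "\<exists>W. open W \<and> \<rho> \<in> W \<and> (\<forall>k. Ck_on k (\<lambda>\<rho>. L (M \<rho>)) W)" if \<rho>: "\<rho> \<in> closed_polygons len" for \<rho>
  proof -
    obtain U where U: "open U" "\<rho> \<in> U" "\<And>k. Ck_on k M U"
      using MD(2)[OF \<rho>] by blast
    have "M \<rho> \<in> closed_polygons len"
      using MD(1) \<rho> by (simp add: equivariant_on_polygons_def)
    then obtain V where V: "open V" "M \<rho> \<in> V" "\<And>k. Ck_on k L V"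
      using LD(2) by blast
    have "continuous_on U M"
      using U(3)[of 0] by simp
    then have W: "open (M -` V \<inter> U)"
      using continuous_on_open_vimage[OF U(1)] V(1) by blast
    have "Ck_on k (\<lambda>\<rho>. L (M \<rho>)) (M -` V \<inter> U)" for k
      by (rule Ck_on_compose[OF W Ck_on_subset[OF U(3)] V(3)]) auto
    then show ?thesis
      using W U(2) V(2) by blast
  qed
  moreover have "\<exists>w. ((\<lambda>s. L (M (c s))) has_vector_derivative w) (at 0)" if c: "curve_through len c \<rho> u" for c \<rho> u
    by (rule symplectic_lift_curve[OF M c]) (rule LD(3))
  moreover have "KKS_form (L (M \<rho>)) w w' = KKS_form \<rho> u u'"
    if c: "curve_through len c \<rho> u" and c': "curve_through len c' \<rho> u'"
      and w: "((\<lambda>s. L (M (c s))) has_vector_derivative w) (at 0)" and w': "((\<lambda>s. L (M (c' s))) has_vector_derivative w') (at 0)"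
    for c c' \<rho> u u' w w'
  proof -
    obtain x where x: "curve_through len (\<lambda>s. M (c s)) (M \<rho>) x"
      by (rule symplectic_lift_curve[OF M c])
    obtain x' where x': "curve_through len (\<lambda>s. M (c' s)) (M \<rho>) x'"
      by (rule symplectic_lift_curve[OF M c'])
    have "KKS_form (L (M \<rho>)) w w' = KKS_form (M \<rho>) x x'"
      by (rule LD(4)[OF x x' w w'])
    also have "\<dots> = KKS_form \<rho> u u'"
      by (rule MD(4)[OF c c' curve_throughD(3)[OF x] curve_throughD(3)[OF x']])
    finally show ?thesis .
  qed
  ultimately show ?thesis
    unfolding symplectic_lift_def using equivariant_on_polygons_comp[OF LD(1) MD(1)] by blast
qed

lemma symplectic_lift_Rot:
  assumes pos: "\<And>e. len e > 0" and I: "lopsided len I"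
  shows "symplectic_lift len (Rot I t)"
proof -
  note nz = lopsided_closed_polygon[OF I]
  have d: "((\<lambda>s. Rot I t (c s)) has_vector_derivative Rot_velocity I t 0 \<rho> u) (at 0)" if c: "curve_through len c \<rho> u" for c \<rho> u
    using has_vector_derivative_Rot[OF DERIV_const curve_throughD(3)[OF c], of I t] curve_throughD(2)[OF c] nz[OF curve_throughD(4)[OF c]]
    by simp
  have "KKS_form (Rot I t \<rho>) w w' = KKS_form \<rho> u u'"
    if c: "curve_through len c \<rho> u" "curve_through len c' \<rho> u'"
      and w: "((\<lambda>s. Rot I t (c s)) has_vector_derivative w) (at 0)" "((\<lambda>s. Rot I t (c' s)) has_vector_derivative w') (at 0)"
    for c c' \<rho> u u' w w'
  proof -
    have "w = Rot_velocity I t 0 \<rho> u" "w' = Rot_velocity I t 0 \<rho> u'"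
      using d[OF c(1)] d[OF c(2)] w vector_derivative_unique_at by blast+
    then show ?thesis
      using KKS_form_Rot[OF closed_polygon_edge_nonzero[OF pos curve_throughD(4)[OF c(1)]] nz[OF curve_throughD(4)[OF c(1)]]
          curve_through_tangent[OF c(1)] curve_through_tangent[OF c(2)]] by simp
  qed
  moreover have "\<exists>U. open U \<and> \<rho> \<in> U \<and> (\<forall>k. Ck_on k (Rot I t) U)" if "\<rho> \<in> closed_polygons len" for \<rho>
    using open_block_sum_nonzero Ck_on_Rot nz[OF that] by blast
  ultimately show ?thesis
    unfolding symplectic_lift_def using equivariant_Rot[OF I] d by blast
qed

lemma Pol_smooth_cong:
  assumes "Pol_smooth len F" "\<And>p. p \<in> Pol len \<Longrightarrow> F p = G p"
  shows "Pol_smooth len G"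
  unfolding Pol_smooth_def
proof
  fix \<rho> assume "\<rho> \<in> closed_polygons len"
  then obtain U g where "open U" "\<rho> \<in> U" "\<forall>k. Ck_on k g U" "\<forall>\<sigma>\<in>U \<inter> closed_polygons len. F (SO3_orbit \<sigma>) = g \<sigma>"
    using assms(1) unfolding Pol_smooth_def by blast
  then show "\<exists>U g. open U \<and> \<rho> \<in> U \<and> (\<forall>k. Ck_on k g U) \<and> (\<forall>\<sigma>\<in>U \<inter> closed_polygons len. G (SO3_orbit \<sigma>) = g \<sigma>)"
    using assms(2) by (metis IntD2 SO3_orbit_in_Pol)
qed

lemma Pol_smooth_pol_map:
  assumes L: "symplectic_lift len L" and F: "Pol_smooth len F"
  shows "Pol_smooth len (\<lambda>p. F (pol_map len L p))"
  unfolding Pol_smooth_def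
proof
  fix \<rho> assume \<rho>: "\<rho> \<in> closed_polygons len"
  obtain U where U: "open U" "\<rho> \<in> U" "\<And>k. Ck_on k L U"
    using symplectic_liftD(2)[OF L \<rho>] by blast
  have LP: "L \<sigma> \<in> closed_polygons len" if "\<sigma> \<in> closed_polygons len" for \<sigma>
    using symplectic_liftD(1)[OF L] that by (simp add: equivariant_on_polygons_def)
  obtain V g where V: "open V" "L \<rho> \<in> V" "\<And>k. Ck_on k g V"
    and g: "\<And>\<sigma>. \<sigma>\<in>V \<inter> closed_polygons len \<Longrightarrow> F (SO3_orbit \<sigma>) = g \<sigma>"
    using F LP[OF \<rho>] unfolding Pol_smooth_def by metis
  have "continuous_on U L"
    using U(3)[of 0] by simp
  then have W: "open (L -` V \<inter> U)"
    using continuous_on_open_vimage[OF U(1)] V(1) by blast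
  have "Ck_on k (\<lambda>\<rho>. g (L \<rho>)) (L -` V \<inter> U)" for k
    by (rule Ck_on_compose[OF W Ck_on_subset[OF U(3)] V(3)]) auto
  moreover have "F (pol_map len L (SO3_orbit \<sigma>)) = g (L \<sigma>)" if "\<sigma> \<in> (L -` V \<inter> U) \<inter> closed_polygons len" for \<sigma>
    using that g LP by (simp add: pol_map_orbit[OF symplectic_liftD(1)[OF L]])
  ultimately show "\<exists>U g. open U \<and> \<rho> \<in> U \<and> (\<forall>k. Ck_on k g U) \<and>
      (\<forall>\<sigma>\<in>U \<inter> closed_polygons len. F (pol_map len L (SO3_orbit \<sigma>)) = g \<sigma>)"
    using W U(2) V(2) by (intro exI[of _ "L -` V \<inter> U"] exI[of _ "\<lambda>\<rho>. g (L \<rho>)"]) auto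
qed

lemma KKS_form_add_rotation:
  assumes nz: "\<And>e. \<rho> $ e \<noteq> 0" and "tangent \<rho> w" "tangent \<rho> w'"
    "x - w = rotation_field UNIV \<xi> \<rho>" "x' - w' = rotation_field UNIV \<xi>' \<rho>" "tangent \<rho> x'"
  shows "KKS_form \<rho> x x' = KKS_form \<rho> w w'"
proof -
  have K0: "KKS_form \<rho> (rotation_field UNIV \<xi> \<rho>) y = 0" if "tangent \<rho> y" for y \<xi>
    using KKS_form_rotation_field[OF nz that] that by (simp add: tangent_def)
  have "x = w + rotation_field UNIV \<xi> \<rho>" "x' = w' + rotation_field UNIV \<xi>' \<rho>"
    using assms(4,5) by (simp_all add: algebra_simps)
  then have "KKS_form \<rho> x x' = KKS_form \<rho> w x'"
    using K0[OF assms(6)] by (simp add: KKS_form_add_left)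
  also have "\<dots> = - KKS_form \<rho> x' w"
    by (rule KKS_form_skew)
  also have "\<dots> = - KKS_form \<rho> w' w"
    using K0[OF assms(2)] \<open>x' = _\<close> by (simp add: KKS_form_add_left)
  also have "\<dots> = KKS_form \<rho> w w'"
    using KKS_form_skew[of \<rho> w w'] by simp
  finally show ?thesis .
qed

text \<open>In \<open>tangent_mapsto\<close> the lift c of the image curve is arbitrary. After one
  fixed rotation A it has the same starting point and the same orbits as the image of b under L, so
  the velocities differ by an orbit direction, which the form does not see.\<close>

proposition pol_map_symplectomorphism:
  assumes gen: "generic len" and pos: "\<And>e. len e > 0"
    and L: "symplectic_lift len L" and M: "symplectic_lift len M"
    and inv: "\<And>\<rho>. \<rho> \<in> closed_polygons len \<Longrightarrow> L (M \<rho>) = \<rho>" "\<And>\<rho>. \<rho> \<in> closed_polygons len \<Longrightarrow> M (L \<rho>) = \<rho>"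
  shows "pol_map len L \<in> symplectomorphisms len"
proof -
  note LE = symplectic_liftD(1)[OF L] and ME = symplectic_liftD(1)[OF M]
  have bij: "pol_map len L \<in> Bij (Pol len)"
    by (rule pol_map_Bij[OF LE ME inv])
  have "inv_into (Pol len) (pol_map len L) p = pol_map len M p" if p: "p \<in> Pol len" for p
  proof (rule inv_into_f_eq)
    show "inj_on (pol_map len L) (Pol len)"
      using bij by (simp add: Bij_def bij_betw_def)
    show "pol_map len M p \<in> Pol len"
      by (rule pol_map_in_Pol[OF ME p])
    show "pol_map len L (pol_map len M p) = p"
      using pol_map_pol_map[OF LE ME p] pol_map_cong[of len "\<lambda>\<rho>. L (M \<rho>)" "\<lambda>\<rho>. \<rho>"] inv(1) pol_map_id[OF p]
      by simp
  qed
  then have smooth_inv: "Pol_smooth len (\<lambda>p. F (inv_into (Pol len) (pol_map len L) p))" if "Pol_smooth len F" for F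
    using Pol_smooth_cong[OF Pol_smooth_pol_map[OF M that]] by simp
  have form: "KKS_form \<sigma> w w' = KKS_form \<rho> u u'"
    if t: "tangent_mapsto len (pol_map len L) \<rho> u \<sigma> w" and t': "tangent_mapsto len (pol_map len L) \<rho> u' \<sigma> w'"
    for \<rho> \<sigma> u u' w w'
  proof -
    obtain b c where b: "curve_through len b \<rho> u" and c: "curve_through len c \<sigma> w"
      and bc: "\<And>t. SO3_orbit (c t) = pol_map len L (SO3_orbit (b t))"
      using t by (auto simp: tangent_mapsto_def)
    obtain b' c' where b': "curve_through len b' \<rho> u'" and c': "curve_through len c' \<sigma> w'"
      and bc': "\<And>t. SO3_orbit (c' t) = pol_map len L (SO3_orbit (b' t))"
      using t' by (auto simp: tangent_mapsto_def)
    have orb: "SO3_orbit (c t) = SO3_orbit (L (b t))" "SO3_orbit (c' t) = SO3_orbit (L (b' t))" for t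
      using bc bc' curve_throughD(1)[OF b] curve_throughD(1)[OF b'] by (simp_all add: pol_map_orbit[OF LE])
    have "SO3_orbit (L \<rho>) = SO3_orbit \<sigma>"
      using orb(1)[of 0] curve_throughD(2)[OF b] curve_throughD(2)[OF c] by simp
    then obtain A where A: "rotation_matrix A" "\<sigma> = act A (L \<rho>)"
      by (rule SO3_orbit_eqD)
    obtain x where x: "curve_through len (\<lambda>s. L (b s)) (L \<rho>) x"
      by (rule symplectic_lift_curve[OF L b])
    obtain x' where x': "curve_through len (\<lambda>s. L (b' s)) (L \<rho>) x'"
      by (rule symplectic_lift_curve[OF L b'])
    note Ax = curve_through_act[OF A(1) x, folded A(2)] and Ax' = curve_through_act[OF A(1) x', folded A(2)]
    obtain \<xi> where \<xi>: "w - act A x = rotation_field UNIV \<xi> \<sigma>"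
      by (rule velocities_of_same_orbit_curve[OF gen pos c Ax]) (simp add: orb SO3_orbit_act[OF A(1)])
    obtain \<xi>' where \<xi>': "w' - act A x' = rotation_field UNIV \<xi>' \<sigma>"
      by (rule velocities_of_same_orbit_curve[OF gen pos c' Ax']) (simp add: orb SO3_orbit_act[OF A(1)])
    have "KKS_form \<sigma> w w' = KKS_form \<sigma> (act A x) (act A x')"
      by (rule KKS_form_add_rotation[OF closed_polygon_edge_nonzero[OF pos curve_throughD(4)[OF c]]
            curve_through_tangent[OF Ax] curve_through_tangent[OF Ax'] \<xi> \<xi>' curve_through_tangent[OF c']])
    also have "\<dots> = KKS_form (L \<rho>) x x'"
      unfolding A(2) by (rule KKS_form_act[OF A(1)])
    also have "\<dots> = KKS_form \<rho> u u'"
      by (rule symplectic_liftD(4)[OF L b b' curve_throughD(3)[OF x] curve_throughD(3)[OF x']])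
    finally show ?thesis .
  qed
  show ?thesis
    unfolding symplectomorphisms_def using bij Pol_smooth_pol_map[OF L] smooth_inv form by blast
qed

lemma Pol_smooth_bend_length:
  assumes "lopsided len I"
  shows "Pol_smooth len (\<lambda>p. r * bend_length I p)"
  unfolding Pol_smooth_def
proof
  fix \<rho> assume "\<rho> \<in> closed_polygons len"
  then have "block_sum I \<rho> \<noteq> 0"
    by (rule lopsided_closed_polygon[OF assms])
  moreover have "Ck_on k (\<lambda>\<rho>. r * norm (block_sum I \<rho>)) {\<rho>. block_sum I \<rho> \<noteq> 0}" for k
    by (rule Ck_on_bounded_linear_comp[OF bounded_linear_mult_right open_block_sum_nonzero Ck_on_norm_block_sum])
  ultimately show "\<exists>U g. open U \<and> \<rho> \<in> U \<and> (\<forall>k. Ck_on k g U) \<and>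
      (\<forall>\<sigma>\<in>U \<inter> closed_polygons len. r * bend_length I (SO3_orbit \<sigma>) = g \<sigma>)"
    by (intro exI[of _ "{\<rho>. block_sum I \<rho> \<noteq> 0}"] exI[of _ "\<lambda>\<rho>. r * norm (block_sum I \<rho>)"])
      (auto simp: open_block_sum_nonzero bend_length_block_sum)
qed

section \<open>Tori generated by laminar families\<close>

text \<open>Angles count full turns, so that integral angles act trivially, as the lattice in
  \<open>hamiltonian_torus_of_dim\<close> demands. Accordingly the moment map consists of the bend
  lengths multiplied by \<open>2 * pi\<close>.\<close>

primrec multi_rot :: "(nat \<Rightarrow> 'e::finite set) \<Rightarrow> nat \<Rightarrow> (nat \<Rightarrow> real) \<Rightarrow> real^3^'e \<Rightarrow> real^3^'e" where
  "multi_rot I 0 a \<rho> = \<rho>"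
| "multi_rot I (Suc k) a \<rho> = Rot (I k) (2 * pi * a k) (multi_rot I k a \<rho>)"

definition nested_or_disjoint :: "'a set \<Rightarrow> 'a set \<Rightarrow> bool" where
  "nested_or_disjoint A B \<longleftrightarrow> A \<inter> B = {} \<or> A \<subseteq> B \<or> B \<subseteq> A"

lemma Rot_commute:
  assumes "nested_or_disjoint I J" "block_sum I \<rho> \<noteq> 0" "block_sum J \<rho> \<noteq> 0"
  shows "Rot I s (Rot J t \<rho>) = Rot J t (Rot I s \<rho>)"
  using assms Rot_commute_disjoint[of I J] Rot_commute_subset[of I J \<rho>] Rot_commute_subset[of J I \<rho>]
  unfolding nested_or_disjoint_def by metis

lemma symplectic_lift_multi_rot:
  assumes pos: "\<And>e. len e > 0" and "\<And>i. i < k \<Longrightarrow> lopsided len (I i)"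
  shows "symplectic_lift len (multi_rot I k a)"
  using assms(2)
proof (induction k)
  case 0
  have "multi_rot I 0 a = (\<lambda>\<rho>. \<rho>)" by auto
  then show ?case by (metis symplectic_lift_id)
next
  case (Suc k)
  have "multi_rot I (Suc k) a = (\<lambda>\<rho>. Rot (I k) (2 * pi * a k) (multi_rot I k a \<rho>))" by auto
  then show ?case
    using symplectic_lift_comp[OF symplectic_lift_Rot[OF pos Suc.prems] Suc.IH] Suc.prems by simp
qed

locale laminar_family =
  fixes len :: "'e::finite \<Rightarrow> real" and I :: "nat \<Rightarrow> 'e set" and k :: nat
  assumes gen: "generic len" and pos: "\<And>e. len e > 0"
    and lop: "\<And>i. i < k \<Longrightarrow> lopsided len (I i)"
    and lam: "\<And>i j. i < k \<Longrightarrow> j < k \<Longrightarrow> nested_or_disjoint (I i) (I j)"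
begin

lemma lift: "n \<le> k \<Longrightarrow> symplectic_lift len (multi_rot I n a)"
  by (rule symplectic_lift_multi_rot[OF pos lop]) simp

lemma equivariant: "n \<le> k \<Longrightarrow> equivariant_on_polygons len (multi_rot I n a)"
  by (rule symplectic_liftD(1)[OF lift])

lemma multi_rot_closed_polygons:
  "n \<le> k \<Longrightarrow> \<rho> \<in> closed_polygons len \<Longrightarrow> multi_rot I n a \<rho> \<in> closed_polygons len"
  using equivariant by (simp add: equivariant_on_polygons_def)

lemma Rot_multi_rot_commute:
  assumes "n \<le> k" "j < k" "\<rho> \<in> closed_polygons len"
  shows "Rot (I j) t (multi_rot I n a \<rho>) = multi_rot I n a (Rot (I j) t \<rho>)"
  using assms(1)
proof (induction n)
  case (Suc n)
  then have n: "n < k" "n \<le> k" by simp_all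
  have "multi_rot I n a \<rho> \<in> closed_polygons len"
    using multi_rot_closed_polygons[OF n(2) assms(3)] .
  then have "Rot (I j) t (Rot (I n) (2 * pi * a n) (multi_rot I n a \<rho>)) = Rot (I n) (2 * pi * a n) (Rot (I j) t (multi_rot I n a \<rho>))"
    by (intro Rot_commute lam lopsided_closed_polygon[OF lop] n assms(2))
  then show ?case
    using Suc by simp
qed simp

lemma multi_rot_add:
  assumes "n \<le> k" "\<rho> \<in> closed_polygons len"
  shows "multi_rot I n a (multi_rot I n b \<rho>) = multi_rot I n (\<lambda>i. a i + b i) \<rho>"
  using assms(1)
proof (induction n)
  case (Suc n)
  then have n: "n < k" "n \<le> k" by simp_all
  let ?\<sigma> = "multi_rot I n b \<rho>"
  have \<sigma>: "?\<sigma> \<in> closed_polygons len"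
    using multi_rot_closed_polygons[OF n(2) assms(2)] .
  have "multi_rot I (Suc n) a (multi_rot I (Suc n) b \<rho>)
      = Rot (I n) (2 * pi * a n) (Rot (I n) (2 * pi * b n) (multi_rot I n a ?\<sigma>))"
    by (simp add: Rot_multi_rot_commute[OF n(2,1) \<sigma>])
  also have "\<dots> = Rot (I n) (2 * pi * a n + 2 * pi * b n) (multi_rot I n a ?\<sigma>)"
    by (rule Rot_Rot) (rule lopsided_closed_polygon[OF lop[OF n(1)] multi_rot_closed_polygons[OF n(2) \<sigma>]])
  also have "\<dots> = multi_rot I (Suc n) (\<lambda>i. a i + b i) \<rho>"
    using Suc.IH n by (simp add: distrib_left)
  finally show ?case .
qed simp

lemma multi_rot_Ints_cong:
  "(\<And>i. i < n \<Longrightarrow> a i - b i \<in> \<int>) \<Longrightarrow> multi_rot I n a \<rho> = multi_rot I n b \<rho>"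
proof (induction n)
  case (Suc n)
  then show ?case by (simp add: Rot_2pi_Ints[of "a n" "b n"])
qed simp

lemma multi_rot_0 [simp]: "multi_rot I n (\<lambda>i. 0) \<rho> = \<rho>"
  by (induction n) simp_all

definition velocity :: "nat \<Rightarrow> (nat \<Rightarrow> real) \<Rightarrow> real^3^'e \<Rightarrow> real^3^'e" where
  "velocity n a \<rho> = (\<Sum>i<n. rotation_field (I i) ((2 * pi * a i) *\<^sub>R sgn (block_sum (I i) \<rho>)) \<rho>)"

lemma has_vector_derivative_multi_rot:
  assumes "n \<le> k" "\<rho> \<in> closed_polygons len"
  shows "((\<lambda>s. multi_rot I n (\<lambda>i. s * a i) \<rho>) has_vector_derivative velocity n a \<rho>) (at 0)"
  using assms(1)
proof (induction n)
  case (Suc n)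
  then have n: "n < k" "n \<le> k" by simp_all
  have "((\<lambda>s. 2 * pi * (s * a n)) has_real_derivative 2 * pi * a n) (at 0)"
    by (auto intro!: derivative_eq_intros)
  from has_vector_derivative_Rot[OF this Suc.IH[OF n(2)], of "I n"] lopsided_closed_polygon[OF lop[OF n(1)] assms(2)]
  show ?case
    by (simp add: velocity_def Rot_velocity_at_0)
qed (simp add: velocity_def)

lemma hamiltonian_vector_velocity:
  assumes "n \<le> k" "\<rho> \<in> closed_polygons len"
  shows "hamiltonian_vector len (\<lambda>p. \<Sum>i<n. a i * (2 * pi * bend_length (I i) p)) \<rho> (velocity n a \<rho>)"
  unfolding hamiltonian_vector_def
proof (intro allI impI)
  fix b w assume b: "curve_through len b \<rho> w"
  have K: "KKS_form \<rho> (\<Sum>i<n. f i) w = (\<Sum>i<n. KKS_form \<rho> (f i) w)" for f :: "nat \<Rightarrow> real^3^'e" and n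
  proof (induction n)
    case 0
    then show ?case by (simp add: KKS_form_def)
  qed (simp add: KKS_form_add_left)
  have "KKS_form \<rho> (velocity n a \<rho>) w
    = (\<Sum>i<n. a i * (2 * pi * KKS_form \<rho> (rotation_field (I i) (sgn (block_sum (I i) \<rho>)) \<rho>) w))"
    unfolding velocity_def K
  proof (rule sum.cong)
    fix i
    have "rotation_field (I i) ((2 * pi * a i) *\<^sub>R sgn (block_sum (I i) \<rho>)) \<rho>
      = (2 * pi * a i) *\<^sub>R rotation_field (I i) (sgn (block_sum (I i) \<rho>)) \<rho>"
      by (subst vec_eq_iff) (simp add: rotation_field_def cross_mult_left)
    then show "KKS_form \<rho> (rotation_field (I i) ((2 * pi * a i) *\<^sub>R sgn (block_sum (I i) \<rho>)) \<rho>) w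
        = a i * (2 * pi * KKS_form \<rho> (rotation_field (I i) (sgn (block_sum (I i) \<rho>)) \<rho>) w)"
      by (simp only: KKS_form_scaleR_left) simp
  qed simp
  moreover have "((\<lambda>s. \<Sum>i<n. a i * (2 * pi * bend_length (I i) (SO3_orbit (b s)))) has_real_derivative
      (\<Sum>i<n. a i * (2 * pi * KKS_form \<rho> (rotation_field (I i) (sgn (block_sum (I i) \<rho>)) \<rho>) w))) (at 0)"
  proof (intro DERIV_sum DERIV_cmult)
    fix i assume "i \<in> {..<n}"
    then have "lopsided len (I i)" using assms(1) lop by auto
    then show "((\<lambda>s. bend_length (I i) (SO3_orbit (b s))) has_real_derivative
        KKS_form \<rho> (rotation_field (I i) (sgn (block_sum (I i) \<rho>)) \<rho>) w) (at 0)"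
      using hamiltonian_vector_bend_length[OF pos assms(2) lopsided_closed_polygon] assms(2) b
      unfolding hamiltonian_vector_def by blast
  qed
  ultimately show "((\<lambda>s. \<Sum>i<n. a i * (2 * pi * bend_length (I i) (SO3_orbit (b s)))) has_real_derivative
      KKS_form \<rho> (velocity n a \<rho>) w) (at 0)"
    by simp
qed

definition \<theta> :: "(nat \<Rightarrow> real) \<Rightarrow> (real^3^'e) set \<Rightarrow> (real^3^'e) set" where
  "\<theta> a = pol_map len (multi_rot I k a)"

lemma multi_rot_inverse:
  assumes "\<rho> \<in> closed_polygons len"
  shows "multi_rot I k a (multi_rot I k (\<lambda>i. - a i) \<rho>) = \<rho>" "multi_rot I k (\<lambda>i. - a i) (multi_rot I k a \<rho>) = \<rho>"
  using assms by (simp_all add: multi_rot_add)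

lemma \<theta>_symplectomorphism: "\<theta> a \<in> symplectomorphisms len"
  unfolding \<theta>_def
  by (rule pol_map_symplectomorphism[OF gen pos lift lift[of k "\<lambda>i. - a i"]]) (simp_all add: multi_rot_inverse)

lemma \<theta>_Bij: "\<theta> a \<in> Bij (Pol len)"
  using \<theta>_symplectomorphism by (auto simp: symplectomorphisms_def)

lemma \<theta>_orbit: "\<rho> \<in> closed_polygons len \<Longrightarrow> \<theta> a (SO3_orbit \<rho>) = SO3_orbit (multi_rot I k a \<rho>)"
  unfolding \<theta>_def by (rule pol_map_orbit[OF equivariant]) simp_all

lemma \<theta>_add: "\<theta> (\<lambda>i. a i + b i) = \<theta> a \<otimes>\<^bsub>BijGroup (Pol len)\<^esub> \<theta> b"
proof -
  have "compose (Pol len) (\<theta> a) (\<theta> b) = \<theta> (\<lambda>i. a i + b i)"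
  proof (rule extensionalityI[OF compose_extensional])
    show "\<theta> (\<lambda>i. a i + b i) \<in> extensional (Pol len)"
      by (simp add: \<theta>_def pol_map_extensional)
    fix p assume "p \<in> Pol len"
    then show "compose (Pol len) (\<theta> a) (\<theta> b) p = \<theta> (\<lambda>i. a i + b i) p"
      by (elim PolE) (simp add: compose_def \<theta>_orbit multi_rot_closed_polygons multi_rot_add)
  qed
  then show ?thesis
    by (simp add: BijGroup_def \<theta>_Bij)
qed

lemma is_hamiltonian_flow_\<theta>:
  "is_hamiltonian_flow len (\<lambda>p. \<Sum>i<k. a i * (2 * pi * bend_length (I i) p)) (\<lambda>t. \<theta> (\<lambda>i. t * a i))"
  unfolding \<theta>_def
proof (rule is_hamiltonian_flow_pol_map)
  show "multi_rot I k (\<lambda>i. s * a i) (multi_rot I k (\<lambda>i. t * a i) \<rho>) = multi_rot I k (\<lambda>i. (s + t) * a i) \<rho>"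
    if "\<rho> \<in> closed_polygons len" for s t \<rho>
    using multi_rot_add[OF _ that] by (simp add: distrib_right)
  show "((\<lambda>s. multi_rot I k (\<lambda>i. s * a i) \<rho>) has_vector_derivative velocity k a \<rho>) (at 0)"
    if "\<rho> \<in> closed_polygons len" for \<rho>
    using has_vector_derivative_multi_rot[OF _ that] by simp
  show "hamiltonian_vector len (\<lambda>p. \<Sum>i<k. a i * (2 * pi * bend_length (I i) p)) \<rho> (velocity k a \<rho>)"
    if "\<rho> \<in> closed_polygons len" for \<rho>
    using hamiltonian_vector_velocity[OF _ that] by simp
qed (simp_all add: equivariant)

lemma \<theta>_0: "\<theta> (\<lambda>i. 0) = \<one>\<^bsub>BijGroup (Pol len)\<^esub>"
  by (simp add: \<theta>_def BijGroup_def pol_map_def)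

lemma multi_rot_single:
  "multi_rot I n (\<lambda>i. if i = j then r else 0) \<rho> = (if j < n then Rot (I j) (2 * pi * r) \<rho> else \<rho>)"
  by (induction n) (auto simp: less_Suc_eq)

lemma bending_flow_in_range_\<theta>:
  assumes "j < k"
  shows "bending_flow len (I j) t = \<theta> (\<lambda>i. if i = j then t / (2 * pi) else 0)"
proof -
  have "multi_rot I k (\<lambda>i. if i = j then t / (2 * pi) else 0) = Rot (I j) t"
    using assms by (auto simp: multi_rot_single)
  then show ?thesis
    by (simp add: \<theta>_def bending_flow_eq_pol_map_Rot[OF gen pos lop[OF assms]])
qed

text \<open>By additivity the range is a subgroup, and it contains the generating flows; conversely
  each \<open>\<theta> a\<close> is a product of k flows, which the induction on n builds
  up.\<close>

lemma range_\<theta>_eq_bending_group: "range \<theta> = bending_group len (I ` {..<k})"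
proof
  interpret B: group "BijGroup (Pol len)" by (rule group_BijGroup)
  have sub: "subgroup (range \<theta>) (BijGroup (Pol len))"
  proof (rule B.subgroupI)
    show "range \<theta> \<subseteq> carrier (BijGroup (Pol len))"
      using \<theta>_Bij by (auto simp: BijGroup_def)
    show "x \<otimes>\<^bsub>BijGroup (Pol len)\<^esub> y \<in> range \<theta>" if xy: "x \<in> range \<theta>" "y \<in> range \<theta>" for x y
    proof -
      obtain a b where "x = \<theta> a" "y = \<theta> b" using xy by blast
      then show ?thesis by (simp add: \<theta>_add[symmetric])
    qed
    fix x assume x: "x \<in> range \<theta>"
    obtain a where a: "x = \<theta> a" using x by blast
    have "x \<otimes>\<^bsub>BijGroup (Pol len)\<^esub> \<theta> (\<lambda>i. - a i) = \<one>\<^bsub>BijGroup (Pol len)\<^esub>"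
      using \<theta>_add[of a "\<lambda>i. - a i"] by (simp add: a \<theta>_0)
    then have "inv\<^bsub>BijGroup (Pol len)\<^esub> x = \<theta> (\<lambda>i. - a i)"
      using B.inv_equality[of "\<theta> (\<lambda>i. - a i)" x] \<theta>_Bij \<theta>_add[of "\<lambda>i. - a i" a]
      by (simp add: a \<theta>_0 BijGroup_def)
    then show "inv\<^bsub>BijGroup (Pol len)\<^esub> x \<in> range \<theta>" by blast
  qed blast
  have "(\<Union>J\<in>I ` {..<k}. range (bending_flow len J)) \<subseteq> range \<theta>"
    using bending_flow_in_range_\<theta> by auto
  then show "bending_group len (I ` {..<k}) \<subseteq> range \<theta>"
    unfolding bending_group_def by (rule B.generate_subgroup_incl[OF _ sub])
  have "pol_map len (multi_rot I n a) \<in> bending_group len (I ` {..<k})" if "n \<le> k" for a n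
    using that
  proof (induction n)
    case 0
    have one: "pol_map len (multi_rot I 0 a) = \<one>\<^bsub>BijGroup (Pol len)\<^esub>"
      by (simp add: pol_map_def BijGroup_def)
    show ?case
      unfolding one bending_group_def by (rule generate.one)
  next
    case (Suc n)
    then have n: "n < k" "n \<le> k" by simp_all
    let ?R = "pol_map len (Rot (I n) (2 * pi * a n))"
    have "?R \<in> (\<Union>J\<in>I ` {..<k}. range (bending_flow len J))"
      using n by (auto simp: bending_flow_eq_pol_map_Rot[OF gen pos lop])
    then have R: "?R \<in> bending_group len (I ` {..<k})"
      unfolding bending_group_def by (rule generate.incl)
    have RB: "?R \<in> Bij (Pol len)"
      using \<theta>_Bij bending_flow_in_range_\<theta>[OF n(1)] bending_flow_eq_pol_map_Rot[OF gen pos lop[OF n(1)]] by metis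
    have MB: "pol_map len (multi_rot I n a) \<in> Bij (Pol len)"
      using pol_map_symplectomorphism[OF gen pos lift[OF n(2)] lift[OF n(2)], of a "\<lambda>i. - a i"] n
      by (auto simp: symplectomorphisms_def multi_rot_add)
    have "?R \<otimes>\<^bsub>BijGroup (Pol len)\<^esub> pol_map len (multi_rot I n a) \<in> bending_group len (I ` {..<k})"
      using R Suc.IH[OF n(2)] unfolding bending_group_def by (rule generate.eng)
    moreover have "?R \<otimes>\<^bsub>BijGroup (Pol len)\<^esub> pol_map len (multi_rot I n a) = compose (Pol len) ?R (pol_map len (multi_rot I n a))"
      using RB MB by (simp add: BijGroup_def)
    moreover have "compose (Pol len) ?R (pol_map len (multi_rot I n a)) = pol_map len (multi_rot I (Suc n) a)"
    proof (rule extensionalityI[OF compose_extensional pol_map_extensional])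
      fix p assume "p \<in> Pol len"
      then show "compose (Pol len) ?R (pol_map len (multi_rot I n a)) p = pol_map len (multi_rot I (Suc n) a) p"
        using pol_map_pol_map[OF equivariant_Rot[OF lop[OF n(1)]] equivariant[OF n(2)]]
        by (simp add: compose_def del: multi_rot.simps) (rule arg_cong[of _ _ "\<lambda>L. pol_map len L p"], auto)
    qed
    ultimately show ?case
      by (simp del: multi_rot.simps)
  qed
  then show "range \<theta> \<subseteq> bending_group len (I ` {..<k})"
    by (auto simp: \<theta>_def)
qed

end

section \<open>Effectiveness of the torus action\<close>

lemma rot_fixes_imp_2pi_multiple:
  assumes "v \<times> x \<noteq> 0" "rot v (2 * pi * r) x = x"
  shows "r \<in> \<int>"
proof -
  have v0: "v \<noteq> 0" using assms(1) by auto
  define n where "n = sgn v"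
  define c where "c = cos (2 * pi * r)"
  have n: "n \<bullet> n = 1" using v0 by (simp add: n_def sgn_inner_self)
  have nx: "n \<times> x \<noteq> 0"
    using assms(1) v0 by (simp add: n_def sgn_div_norm cross_mult_left)
  have "(rot v (2 * pi * r) x) \<bullet> x = c * (x \<bullet> x) + (1 - c) * (n \<bullet> x) * (n \<bullet> x)"
    by (simp add: rot_def inner_add_left dot_cross_self flip: n_def c_def)
  then have "(1 - c) * (x \<bullet> x - (n \<bullet> x) * (n \<bullet> x)) = 0"
    unfolding assms(2) by (simp add: algebra_simps)
  moreover have "(n \<times> x) \<bullet> (n \<times> x) = x \<bullet> x - (n \<bullet> x) * (n \<bullet> x)"
    by (simp add: dot_cross n inner_commute)
  ultimately have "c = 1"
    using nx by (metis eq_iff_diff_eq_0 inner_eq_zero_iff mult_eq_0_iff)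
  then obtain m :: int where "2 * pi * r = of_int m * 2 * pi"
    using cos_one_2pi_int by (auto simp: c_def)
  then have "r = of_int m" by simp
  then show ?thesis by simp
qed

lemma rotation_matrix_fixing_frame:
  fixes A :: "real^3^3"
  assumes "rotation_matrix A" "A *v v = v" "A *v c = c" "v \<times> c \<noteq> 0"
  shows "A *v x = x"
proof -
  have "A *v (v \<times> c) = v \<times> c"
    using cross_rotation_matrix[OF assms(1), of v c] assms by simp
  then have "A *v x - x = 0"
    using rotation_matrix_inner[OF assms(1), of x] assms(2,3)
    by (intro orthogonal_to_cross_frame[OF assms(4)]) (simp_all add: inner_diff_left, metis+)
  then show ?thesis by simp
qed

definition four_blocks :: "'a set \<Rightarrow> 'a set \<Rightarrow> 'a set \<Rightarrow> 'a set \<Rightarrow> bool" where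
  "four_blocks A B C D \<longleftrightarrow> A \<noteq> {} \<and> B \<noteq> {} \<and> C \<noteq> {} \<and> D \<noteq> {} \<and> A \<union> B \<union> C \<union> D = UNIV \<and>
     A \<inter> B = {} \<and> A \<inter> C = {} \<and> A \<inter> D = {} \<and> B \<inter> C = {} \<and> B \<inter> D = {} \<and> C \<inter> D = {}"

text \<open>Each block has to reveal its own angle. X turns with \<open>I i\<close> while C stays,
  so the half-planes of X and C at the axis of \<open>I i\<close> measure it. Every other member
  either contains \<open>I i\<close> or, being inside or disjoint from each of X, \<open>I i\<close>
  and C, leaves their three sums alone. D only completes the partition.\<close>

locale effective_laminar_family = laminar_family +
  assumes Pol_ne: "Pol len \<noteq> {}" and inj: "inj_on I {..<k}"
    and split: "\<And>i. i < k \<Longrightarrow> \<exists>X Y C D. four_blocks X Y C D \<and> I i = X \<union> Y \<and>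
      (\<forall>j<k. j \<noteq> i \<longrightarrow> I i \<subseteq> I j \<or> (\<forall>Z\<in>{X, I i, C}. I j \<subseteq> Z \<or> I j \<inter> Z = {}))"
begin

text \<open>A family of angles acting trivially is tested on the maximal block with a non-trivial angle:
  only the rotation of that block changes the position of its part X relative to the rest.\<close>

lemma trivial_angles:
  assumes triv: "\<And>\<rho>. \<rho> \<in> closed_polygons len \<Longrightarrow> SO3_orbit (multi_rot I k c \<rho>) = SO3_orbit \<rho>"
  shows "\<forall>i<k. c i \<in> \<int>"
proof (rule ccontr)
  assume nontrivial: "\<not> ?thesis"
  define S where "S = {i. i < k \<and> c i \<notin> \<int>}"
  define g where "g j = card (I j)" for j
  have S: "S \<noteq> {}" "finite S"
    using nontrivial by (auto simp: S_def)
  then have "Max (g ` S) \<in> g ` S" by (intro Max_in) auto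
  then obtain i where "i \<in> S" "Max (g ` S) = g i" by (elim imageE) simp
  then have i: "i < k" "c i \<notin> \<int>" and max: "\<And>j. j < k \<Longrightarrow> c j \<notin> \<int> \<Longrightarrow> card (I j) \<le> card (I i)"
    using Max_ge[of "g ` S"] S by (auto simp: S_def g_def)
  \<comment> \<open>By injectivity such a set is strictly larger than \<open>I i\<close>, whose
    cardinality is maximal among the sets with non-integral angle.\<close>
  have above: "c j \<in> \<int>" if "j < k" "j \<noteq> i" "I i \<subseteq> I j" for j
  proof -
    have "I i \<noteq> I j"
      using inj that i by (auto simp: inj_on_def)
    then have "card (I i) < card (I j)"
      using that by (intro psubset_card_mono) auto
    then show ?thesis using max that by fastforce
  qed
  obtain X Y C D where blocks: "four_blocks X Y C D" and Ii: "I i = X \<union> Y"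
    and others: "\<And>j. j < k \<Longrightarrow> j \<noteq> i \<Longrightarrow> I i \<subseteq> I j \<or> (\<forall>Z\<in>{X, I i, C}. I j \<subseteq> Z \<or> I j \<inter> Z = {})"
    using split[OF i(1)] by blast
  have ne: "X \<noteq> {}" "Y \<noteq> {}" "C \<noteq> {}" "D \<noteq> {}"
    and part: "X \<union> Y \<union> C \<union> D = UNIV" "X \<inter> Y = {}" "X \<inter> C = {}" "X \<inter> D = {}" "Y \<inter> C = {}" "Y \<inter> D = {}" "C \<inter> D = {}"
    using blocks by (simp_all add: four_blocks_def)
  obtain \<rho> where \<rho>: "\<rho> \<in> closed_polygons len" and det: "block_sum X \<rho> \<bullet> (block_sum Y \<rho> \<times> block_sum C \<rho>) \<noteq> 0"
    by (rule four_blocks_noncoplanar[OF gen pos Pol_ne ne part])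
  define v where "v = block_sum (I i) \<rho>"
  have v: "v = block_sum X \<rho> + block_sum Y \<rho>"
    unfolding v_def Ii by (rule block_sum_Un[OF part(2)])
  have eff: "block_sum (I i) (multi_rot I n c \<rho>) = v \<and> block_sum C (multi_rot I n c \<rho>) = block_sum C \<rho> \<and>
      block_sum X (multi_rot I n c \<rho>) = (if i < n then rot v (2 * pi * c i) (block_sum X \<rho>) else block_sum X \<rho>)"
    if "n \<le> k" for n
    using that
  proof (induction n)
    case (Suc n)
    let ?\<sigma> = "multi_rot I n c \<rho>"
    have IH: "block_sum (I i) ?\<sigma> = v" "block_sum C ?\<sigma> = block_sum C \<rho>"
      "block_sum X ?\<sigma> = (if i < n then rot v (2 * pi * c i) (block_sum X \<rho>) else block_sum X \<rho>)"
      using Suc by simp_all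
    have n: "n < k" using Suc by simp
    show ?case
    proof (cases "n = i")
      case True
      have "I i \<inter> C = {}" using part by (auto simp: Ii)
      moreover have "X \<subseteq> I i" by (simp add: Ii)
      ultimately show ?thesis
        using True IH by (simp add: block_sum_Rot_supset block_sum_Rot_disjoint block_sum_Rot_subset)
    next
      case False
      consider "I i \<subseteq> I n" | "\<forall>Z\<in>{X, I i, C}. I n \<subseteq> Z \<or> I n \<inter> Z = {}"
        using others[OF n False] by blast
      then have "\<forall>Z\<in>{X, I i, C}. block_sum Z (Rot (I n) (2 * pi * c n) ?\<sigma>) = block_sum Z ?\<sigma>"
      proof cases
        case 1
        then have "c n \<in> \<int>" using above n False by blast
        then show ?thesis
          using Rot_2pi_Ints[of "c n" 0 "I n" ?\<sigma>] by simp
      next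
        case 2
        then show ?thesis
          by (meson block_sum_Rot_disjoint block_sum_Rot_supset)
      qed
      then show ?thesis
        using False IH by (simp add: less_Suc_eq)
    qed
  qed (simp add: v_def)
  obtain A where A: "rotation_matrix A" "multi_rot I k c \<rho> = act A \<rho>"
    using triv[OF \<rho>] SO3_orbit_eqD by metis
  have "A *v v = v" "A *v block_sum C \<rho> = block_sum C \<rho>" "A *v block_sum X \<rho> = rot v (2 * pi * c i) (block_sum X \<rho>)"
    using eff[of k] i(1) by (simp_all add: A(2) v_def[symmetric])
  moreover have "v \<times> block_sum C \<rho> \<noteq> 0"
  proof
    assume "v \<times> block_sum C \<rho> = 0"
    then have "block_sum X \<rho> \<bullet> (v \<times> block_sum C \<rho>) = 0" by simp
    then show False
      using det by (simp add: v cross_add_left inner_add_right dot_cross_self)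
  qed
  ultimately have fixed: "rot v (2 * pi * c i) (block_sum X \<rho>) = block_sum X \<rho>"
    using rotation_matrix_fixing_frame[OF A(1)] by metis
  have "v \<times> block_sum X \<rho> \<noteq> 0"
  proof
    assume "v \<times> block_sum X \<rho> = 0"
    then have "block_sum Y \<rho> \<times> block_sum X \<rho> = 0"
      by (simp add: v cross_add_left)
    moreover have "block_sum X \<rho> \<bullet> (block_sum Y \<rho> \<times> block_sum C \<rho>) = - (block_sum C \<rho> \<bullet> (block_sum Y \<rho> \<times> block_sum X \<rho>))"
      by (metis cross_skew inner_minus_right inner_triple_commute)
    ultimately show False using det by simp
  qed
  then have "c i \<in> \<int>"
    using rot_fixes_imp_2pi_multiple fixed by blast
  with i show False by blast
qed

lemma \<theta>_eq_iff: "\<theta> a = \<theta> b \<longleftrightarrow> (\<forall>i<k. a i - b i \<in> \<int>)"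
proof
  assume eq: "\<theta> a = \<theta> b"
  have "SO3_orbit (multi_rot I k (\<lambda>i. a i - b i) \<rho>) = SO3_orbit \<rho>" if \<rho>: "\<rho> \<in> closed_polygons len" for \<rho>
  proof -
    let ?\<sigma> = "multi_rot I k (\<lambda>i. - b i) \<rho>"
    have \<sigma>: "?\<sigma> \<in> closed_polygons len"
      using multi_rot_closed_polygons \<rho> by simp
    have "SO3_orbit (multi_rot I k a ?\<sigma>) = SO3_orbit (multi_rot I k b ?\<sigma>)"
      using eq \<theta>_orbit[OF \<sigma>] by metis
    then show ?thesis
      using \<rho> by (simp add: multi_rot_add)
  qed
  then show "\<forall>i<k. a i - b i \<in> \<int>"
    by (rule trivial_angles)
next
  assume "\<forall>i<k. a i - b i \<in> \<int>"
  then show "\<theta> a = \<theta> b"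
    unfolding \<theta>_def by (intro pol_map_cong multi_rot_Ints_cong) simp
qed

theorem hamiltonian_torus: "hamiltonian_torus_of_dim len k (bending_group len (I ` {..<k}))"
  unfolding hamiltonian_torus_of_dim_def
proof (intro conjI exI[of _ \<theta>] exI[of _ "\<lambda>i p. 2 * pi * bend_length (I i) p"] allI impI)
  show "bending_group len (I ` {..<k}) \<subseteq> symplectomorphisms len"
    unfolding range_\<theta>_eq_bending_group[symmetric] using \<theta>_symplectomorphism by blast
qed (simp_all add: range_\<theta>_eq_bending_group \<theta>_add \<theta>_eq_iff Pol_smooth_bend_length lop is_hamiltonian_flow_\<theta>)

end

section \<open>The dimension of a torus\<close>

(* That x has order at most two is expressed by idempotency of its square, so that the unit of T need not be identified. *)
lemma hamiltonian_torus_half_periods: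
  assumes "hamiltonian_torus_of_dim len k T"
  defines "m \<equiv> \<lambda>x y. x \<otimes>\<^bsub>BijGroup (Pol len)\<^esub> y"
  shows "card {x \<in> T. m (m x x) (m x x) = m x x} = 2 ^ k"
proof -
  from assms(1) obtain \<theta> H where *: "range \<theta> = T \<and>
        (\<forall>a b. \<theta> (\<lambda>i. a i + b i) = \<theta> a \<otimes>\<^bsub>BijGroup (Pol len)\<^esub> \<theta> b) \<and>
        (\<forall>a b. \<theta> a = \<theta> b \<longleftrightarrow> (\<forall>i<k. a i - b i \<in> \<int>)) \<and>
        (\<forall>i<k. Pol_smooth len (H i)) \<and>
        (\<forall>a. is_hamiltonian_flow len (\<lambda>p. \<Sum>i<k. a i * H i p) (\<lambda>t. \<theta> (\<lambda>i. t * a i)))"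
    unfolding hamiltonian_torus_of_dim_def by (elim conjE[of "T \<subseteq> _"] exE)
  note T = *[THEN conjunct1] and mult = *[THEN conjunct2, THEN conjunct1]
    and kernel = *[THEN conjunct2, THEN conjunct2, THEN conjunct1]
  have add: "\<theta> (\<lambda>i. a i + b i) = m (\<theta> a) (\<theta> b)" for a b
    using mult by (simp add: m_def)
  have ker: "\<theta> a = \<theta> b \<longleftrightarrow> (\<forall>i<k. a i - b i \<in> \<int>)" for a b
    using kernel by blast
  \<comment> \<open>The half turns in the coordinates of s: these 2^k elements are the ones whose
    square is the unit.\<close>
  define h where "h s = \<theta> (\<lambda>i. if i \<in> s then 1/2 else 0)" for s :: "nat set"
  have half: "(1/2 :: real) \<notin> \<int>"
  proof
    assume "(1/2 :: real) \<in> \<int>"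
    then obtain z where "1/2 = real_of_int z" by (rule Ints_cases)
    then have "2 * z = 1" by linarith
    then show False by presburger
  qed
  have "inj_on h (Pow {..<k})"
  proof (rule inj_onI)
    fix s t assume st: "s \<in> Pow {..<k}" "t \<in> Pow {..<k}" "h s = h t"
    then have "(if i \<in> s then 1/2 else 0) - (if i \<in> t then 1/2 else 0) \<in> (\<int> :: real set)" if "i < k" for i
      using ker that by (simp add: h_def)
    then have "i \<in> s \<longleftrightarrow> i \<in> t" if "i < k" for i
      using half minus_in_Ints_iff[of "1/2 :: real"] that by (fastforce split: if_splits)
    then show "s = t"
      using st by auto
  qed
  moreover have "h ` Pow {..<k} = {x \<in> T. m (m x x) (m x x) = m x x}"
  proof -
    have in_iff: "m (m (\<theta> a) (\<theta> a)) (m (\<theta> a) (\<theta> a)) = m (\<theta> a) (\<theta> a) \<longleftrightarrow> (\<forall>i<k. 2 * a i \<in> \<int>)" for a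
      by (simp add: add[symmetric] ker)
    have "\<exists>s\<in>Pow {..<k}. \<theta> a = h s" if a: "\<forall>i<k. 2 * a i \<in> \<int>" for a
    proof (rule bexI[of _ "{i. i < k \<and> a i \<notin> \<int>}"])
      have "a i - 1/2 \<in> \<int>" if "i < k" "a i \<notin> \<int>" for i
      proof -
        obtain z where z: "2 * a i = of_int z"
          using a \<open>i < k\<close> by (auto elim: Ints_cases)
        have "odd z"
        proof
          assume "even z"
          then obtain y where "z = 2 * y" by (elim evenE)
          then have "a i = of_int y" using z by simp
          then show False using that by simp
        qed
        then obtain y where "z = 2 * y + 1" by (elim oddE)
        then have "a i - 1/2 = of_int y" using z by simp
        then show ?thesis by simp
      qed
      then show "\<theta> a = h {i. i < k \<and> a i \<notin> \<int>}"
        by (simp add: h_def ker)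
    qed auto
    moreover have "h s \<in> {x \<in> T. m (m x x) (m x x) = m x x}" for s
      using T by (auto simp: h_def in_iff)
    ultimately show ?thesis
      using T in_iff by (intro equalityI subsetI) (blast, auto simp: image_iff)
  qed
  ultimately have "card {x \<in> T. m (m x x) (m x x) = m x x} = card (Pow {..<k})"
    by (metis card_image)
  then show ?thesis by (simp add: card_Pow)
qed

lemma hamiltonian_torus_dim_unique:
  assumes "hamiltonian_torus_of_dim len k T" "hamiltonian_torus_of_dim len l T"
  shows "k = l"
  using hamiltonian_torus_half_periods[OF assms(1)] hamiltonian_torus_half_periods[OF assms(2)] by simp

lemma torus_dim_eq: "hamiltonian_torus_of_dim len k T \<Longrightarrow> torus_dim len T = k"
  unfolding torus_dim_def using hamiltonian_torus_dim_unique by blast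

section \<open>Bending groups\<close>

lemma bending_flow_Bij:
  assumes gen: "generic len" and pos: "\<And>e. len e > 0" and I: "lopsided len I"
  shows "bending_flow len I t \<in> Bij (Pol len)"
  using is_hamiltonian_flow_Rot[OF pos I] bending_flow_eq_pol_map_Rot[OF gen pos I]
  by (simp add: is_hamiltonian_flow_def)

lemma subgroup_bending_group:
  assumes gen: "generic len" and pos: "\<And>e. len e > 0" and "\<forall>I\<in>\<I>. lopsided len I"
  shows "subgroup (bending_group len \<I>) (BijGroup (Pol len))"
proof -
  have "(\<Union>I\<in>\<I>. range (bending_flow len I)) \<subseteq> carrier (BijGroup (Pol len))"
    using assms bending_flow_Bij[OF gen pos] by (auto simp: BijGroup_def)
  then show ?thesis
    unfolding bending_group_def by (rule group.generate_is_subgroup[OF group_BijGroup])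
qed

lemma bending_flow_in_bending_group: "I \<in> \<I> \<Longrightarrow> bending_flow len I t \<in> bending_group len \<I>"
  unfolding bending_group_def by (intro generate.incl) blast

lemma bending_group_subsetI:
  assumes "generic len" "\<And>e. len e > 0" "\<forall>I\<in>\<I>. lopsided len I"
    and "\<And>K t. K \<in> \<K> \<Longrightarrow> bending_flow len K t \<in> bending_group len \<I>"
  shows "bending_group len \<K> \<subseteq> bending_group len \<I>"
  unfolding bending_group_def[of len \<K>]
  by (rule group.generate_subgroup_incl[OF group_BijGroup _ subgroup_bending_group[OF assms(1-3)]]) (use assms(4) in auto)

lemma bending_group_mono:
  assumes "generic len" "\<And>e. len e > 0" "\<forall>I\<in>\<I>. lopsided len I" "\<K> \<subseteq> \<I>"
  shows "bending_group len \<K> \<subseteq> bending_group len \<I>"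
  by (rule bending_group_subsetI[OF assms(1-3)]) (use assms(4) bending_flow_in_bending_group in blast)

lemma lopsided_singleton: "len e > 0 \<Longrightarrow> lopsided len {e}"
  by (simp add: lopsided_def)

lemma lopsided_nonempty: "lopsided len I \<Longrightarrow> I \<noteq> {}"
  by (auto simp: lopsided_def)

lemma bending_flow_singleton:
  assumes "generic len" "\<And>e. len e > 0"
  shows "bending_flow len {e} t = \<one>\<^bsub>BijGroup (Pol len)\<^esub>"
  using bending_flow_eq_pol_map_Rot[OF assms lopsided_singleton[OF assms(2)], of e]
  by (simp add: Rot_singleton pol_map_def BijGroup_def)

lemma block_sum_rotation_field: "block_sum K (rotation_field I \<xi> \<rho>) = \<xi> \<times> block_sum (K \<inter> I) \<rho>"
proof -
  have "block_sum K (rotation_field I \<xi> \<rho>) = (\<Sum>e\<in>K. if e \<in> I then \<xi> \<times> \<rho> $ e else 0)"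
    unfolding block_sum_def by (rule sum.cong) (auto simp: rotation_field_def)
  also have "\<dots> = (\<Sum>e\<in>K \<inter> I. \<xi> \<times> \<rho> $ e)"
    by (simp add: sum.inter_restrict)
  also have "\<dots> = \<xi> \<times> block_sum (K \<inter> I) \<rho>"
    by (simp add: block_sum_def linear_sum[OF bounded_linear.linear[OF bounded_bilinear.bounded_linear_right[OF bounded_bilinear_cross3]]])
  finally show ?thesis .
qed

text \<open>If the flows commute and preserve the form, the derivative of the length of K along the flow of I
  is the constant value of the form on the two Hamiltonian vectors; as this flow is periodic, it vanishes.\<close>

proposition commuting_bending_flows:
  fixes len :: "'e::finite \<Rightarrow> real"
  assumes gen: "generic len" and pos: "\<And>e. len e > 0" and ne: "Pol len \<noteq> {}"
    and K: "lopsided len K" and I: "lopsided len I"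
    and commute: "\<And>s t p. p \<in> Pol len \<Longrightarrow>
        bending_flow len K t (bending_flow len I s p) = bending_flow len I s (bending_flow len K t p)"
    and symp: "\<And>s. bending_flow len I s \<in> symplectomorphisms len"
  shows "K \<inter> I = {} \<or> K \<subseteq> I \<or> I \<subseteq> K \<or> K \<union> I = UNIV"
proof (rule ccontr)
  assume "\<not> ?thesis"
  then have blocks: "K - I \<noteq> {}" "K \<inter> I \<noteq> {}" "I - K \<noteq> {}" "- (K \<union> I) \<noteq> {}"
    by blast+
  obtain \<rho> where \<rho>: "\<rho> \<in> closed_polygons len"
    and det: "block_sum (K - I) \<rho> \<bullet> (block_sum (K \<inter> I) \<rho> \<times> block_sum (I - K) \<rho>) \<noteq> 0"
    by (rule four_blocks_noncoplanar[OF gen pos ne blocks]) blast+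
  note nzK = lopsided_closed_polygon[OF K] and nzI = lopsided_closed_polygon[OF I]
  note fK = bending_flow_eq_pol_map_Rot[OF gen pos K] and fI = bending_flow_eq_pol_map_Rot[OF gen pos I]
  define X where "X J \<sigma> = rotation_field J (sgn (block_sum J \<sigma>)) \<sigma>" for J and \<sigma> :: "real^3^'e"
  define \<sigma> where "\<sigma> s = Rot I s \<rho>" for s
  have \<sigma>: "\<sigma> s \<in> closed_polygons len" for s
    unfolding \<sigma>_def by (intro Rot_closed_polygons \<rho> nzI)
  define \<kappa> where "\<kappa> = KKS_form \<rho> (X K \<rho>) (X I \<rho>)"
  have bend: "curve_through len (\<lambda>t. Rot J t \<tau>) \<tau> (X J \<tau>)"
    if "\<tau> \<in> closed_polygons len" "block_sum J \<tau> \<noteq> 0" for J \<tau>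
    using curve_through_bend[OF that, of 1] by (simp add: X_def)
  have const: "KKS_form (\<sigma> s) (X K (\<sigma> s)) (X I (\<sigma> s)) = \<kappa>" for s
  proof -
    \<comment> \<open>Commutation is what carries the flow line of K through \<open>\<rho>\<close>
      to the one through \<open>\<sigma> s\<close>; for I itself, below, this is the group
      law.\<close>
    have "SO3_orbit (Rot K t (\<sigma> s)) = bending_flow len I s (SO3_orbit (Rot K t \<rho>))" for t
      using commute[of "SO3_orbit \<rho>" t s] \<rho> \<sigma>[of s]
      by (simp add: fK fI pol_map_orbit[OF equivariant_Rot[OF K]] pol_map_orbit[OF equivariant_Rot[OF I]]
          Rot_closed_polygons nzK nzI flip: \<sigma>_def)
    then have TK: "tangent_mapsto len (bending_flow len I s) \<rho> (X K \<rho>) (\<sigma> s) (X K (\<sigma> s))"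
      unfolding tangent_mapsto_def using bend[OF \<rho> nzK[OF \<rho>]] bend[OF \<sigma> nzK[OF \<sigma>]] by blast
    have "SO3_orbit (Rot I t (\<sigma> s)) = bending_flow len I s (SO3_orbit (Rot I t \<rho>))" for t
      using \<rho> by (simp add: fI pol_map_orbit[OF equivariant_Rot[OF I]] Rot_closed_polygons nzI \<sigma>_def Rot_Rot add.commute)
    then have TI: "tangent_mapsto len (bending_flow len I s) \<rho> (X I \<rho>) (\<sigma> s) (X I (\<sigma> s))"
      unfolding tangent_mapsto_def using bend[OF \<rho> nzI[OF \<rho>]] bend[OF \<sigma> nzI[OF \<sigma>]] by blast
    have "\<forall>\<rho> \<sigma> u u' w w'. tangent_mapsto len (bending_flow len I s) \<rho> u \<sigma> w \<longrightarrow>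
        tangent_mapsto len (bending_flow len I s) \<rho> u' \<sigma> w' \<longrightarrow> KKS_form \<sigma> w w' = KKS_form \<rho> u u'"
      using symp[of s] unfolding symplectomorphisms_def by simp
    then show ?thesis
      using TK TI unfolding \<kappa>_def by metis
  qed
  define g where "g s = norm (block_sum K (\<sigma> s))" for s
  have dg: "(g has_real_derivative \<kappa>) (at s)" for s
  proof -
    have "hamiltonian_vector len (bend_length K) (\<sigma> s) (X K (\<sigma> s))"
      unfolding X_def by (rule hamiltonian_vector_bend_length[OF pos \<sigma> nzK[OF \<sigma>]])
    then have "((\<lambda>t. bend_length K (SO3_orbit (Rot I t (\<sigma> s)))) has_real_derivative \<kappa>) (at 0)"
      using bend[OF \<sigma>[of s] nzI[OF \<sigma>[of s]]] const[of s] unfolding hamiltonian_vector_def by metis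
    moreover have "bend_length K (SO3_orbit (Rot I t (\<sigma> s))) = g (t + s)" for t
      by (simp add: bend_length_block_sum g_def \<sigma>_def Rot_Rot[OF nzI[OF \<rho>]])
    ultimately show ?thesis
      using DERIV_shift[of g \<kappa> 0 s] by simp
  qed
  have "((\<lambda>s. g s - \<kappa> * s) has_real_derivative 0) (at s)" for s
    using dg by (auto intro!: derivative_eq_intros)
  then have "g (2 * pi) - \<kappa> * (2 * pi) = g 0 - \<kappa> * 0"
    using DERIV_isconst_all[of "\<lambda>s. g s - \<kappa> * s"] by blast
  moreover have "g (2 * pi) = g 0"
    using Rot_2pi_Ints[of 1 0 I \<rho>] by (simp add: g_def \<sigma>_def)
  ultimately have "\<kappa> = 0" by simp
  define x y c where "x = block_sum (K - I) \<rho>" and "y = block_sum (K \<inter> I) \<rho>" and "c = block_sum (I - K) \<rho>"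
  have KI: "block_sum K \<rho> = x + y" "block_sum I \<rho> = y + c"
    using block_sum_Un[of "K - I" "K \<inter> I" \<rho>] block_sum_Un[of "K \<inter> I" "I - K" \<rho>]
    by (simp_all add: x_def y_def c_def Diff_Int_distrib2 Int_Diff Un_Diff_Int Int_commute[of K I])
      (metis Int_Diff_disjoint Int_commute Un_commute Un_Diff_Int Int_Diff)+
  \<comment> \<open>The flow of I moves only the part y of K. Terms with a repeated vector cancel,
    and the bracket of the two lengths is, up to a positive factor, the triple product of x, c and
    y, which is nonzero for the chosen polygon.\<close>
  have "\<kappa> = sgn (x + y) \<bullet> (sgn (y + c) \<times> y)"
    unfolding \<kappa>_def X_def
    using KKS_form_rotation_field[OF closed_polygon_edge_nonzero[OF pos \<rho>] curve_through_tangent[OF bend[OF \<rho> nzI[OF \<rho>]]], of K]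
    by (simp add: X_def block_sum_rotation_field KI y_def)
  then have "(x + y) \<bullet> ((y + c) \<times> y) = 0"
    using \<open>\<kappa> = 0\<close> nzK[OF \<rho>] nzI[OF \<rho>] by (simp add: sgn_div_norm cross_mult_left KI)
  then have "x \<bullet> (c \<times> y) = 0"
    by (simp add: cross_add_left inner_add_left dot_cross_self)
  then show False
    using det cross_skew[of y c] by (simp add: x_def y_def c_def)
qed

section \<open>Combinatorics of full bending sets\<close>

text \<open>A full bending set is a forest of binary trees with the singletons as leaves; these are
  the inner nodes. They are the members whose bending flow is not trivial for the mere reason of
  turning an edge about itself.\<close>

definition branches :: "'e set set \<Rightarrow> 'e set set" where
  "branches \<I> = {I \<in> \<I>. \<nexists>e. I = {e}}"

locale full_set =
  fixes len :: "'e::finite \<Rightarrow> real" and \<I> :: "'e set set"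
  assumes gen: "generic len" and pos: "\<And>e. len e > 0" and Pol_ne: "Pol len \<noteq> {}"
    and full: "full_bending_set len \<I>"
begin

lemma lop: "I \<in> \<I> \<Longrightarrow> lopsided len I"
  using full by (simp add: full_bending_set_def bending_set_def)

lemma ne: "I \<in> \<I> \<Longrightarrow> I \<noteq> {}"
  using lop lopsided_nonempty by blast

lemma singletons: "{e} \<in> \<I>"
  using full by (simp add: full_bending_set_def bending_set_def)

lemma laminar: "A \<in> \<I> \<Longrightarrow> B \<in> \<I> \<Longrightarrow> A \<inter> B = {} \<or> A \<subseteq> B \<or> B \<subseteq> A"
  using full by (simp add: full_bending_set_def bending_set_def)

lemma split_branch:
  assumes "I \<in> branches \<I>"
  obtains I' I'' where "I' \<in> \<I>" "I'' \<in> \<I>" "I' \<inter> I'' = {}" "I = I' \<union> I''"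
  using assms full unfolding full_bending_set_def branches_def by blast

lemma proper_subset_of_split:
  assumes "I' \<in> \<I>" "I'' \<in> \<I>" "I' \<inter> I'' = {}" "K \<in> \<I>" "K \<subset> I' \<union> I''"
  shows "K \<subseteq> I' \<or> K \<subseteq> I''"
  using laminar[OF assms(1,4)] laminar[OF assms(2,4)] ne[OF assms(1)] ne[OF assms(2)] ne[OF assms(4)] assms(3,5) by blast

lemma maximal_above:
  assumes "I \<in> \<I>"
  obtains J where "J \<in> maximal_members \<I>" "I \<subseteq> J"
proof -
  obtain J where "J \<in> \<I>" "I \<subseteq> J" "\<forall>K\<in>\<I>. J \<subseteq> K \<longrightarrow> J = K"
    using finite_has_maximal2[of \<I> I] assms by (auto intro: finite_subset[OF subset_UNIV])
  then show thesis
    using that[of J] unfolding maximal_members_def by blast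
qed

lemma maximal_member: "J \<in> maximal_members \<I> \<Longrightarrow> J \<in> \<I>"
  by (simp add: maximal_members_def)

lemma member_vs_maximal:
  assumes "J \<in> maximal_members \<I>" "K \<in> \<I>"
  shows "K \<inter> J = {} \<or> K \<subseteq> J"
proof -
  have "J \<subseteq> K \<Longrightarrow> K = J"
    using assms by (simp add: maximal_members_def)
  then show ?thesis
    using laminar[OF assms(2) maximal_member[OF assms(1)]] by blast
qed

lemma maximal_disjoint:
  assumes "J \<in> maximal_members \<I>" "J' \<in> maximal_members \<I>" "J \<noteq> J'"
  shows "J \<inter> J' = {}"
proof -
  have "J' \<inter> J = {} \<or> J' \<subseteq> J" "J \<inter> J' = {} \<or> J \<subseteq> J'"
    by (rule member_vs_maximal[OF assms(1) maximal_member[OF assms(2)]],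
        rule member_vs_maximal[OF assms(2) maximal_member[OF assms(1)]])
  then show ?thesis
    using assms(3) by auto
qed

lemma maximal_cover: "\<exists>J\<in>maximal_members \<I>. e \<in> J"
  by (rule maximal_above[OF singletons[of e]]) auto

text \<open>A binary tree has one leaf more than inner nodes: the counts of the two halves are
  added, and the root J is one more branch.\<close>

lemma card_le_branches_below:
  assumes "J \<in> \<I>"
  shows "card J \<le> card {K \<in> branches \<I>. K \<subseteq> J} + 1"
  using assms
proof (induction "card J" arbitrary: J rule: less_induct)
  case less
  show ?case
  proof (cases "\<exists>e. J = {e}")
    case False
    then have J: "J \<in> branches \<I>" using less.prems by (simp add: branches_def)
    obtain I' I'' where s: "I' \<in> \<I>" "I'' \<in> \<I>" "I' \<inter> I'' = {}" "J = I' \<union> I''"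
      using split_branch[OF J] by blast
    have sub: "I' \<subset> J" "I'' \<subset> J"
      using s ne[OF s(1)] ne[OF s(2)] by blast+
    then have card: "card I' < card J" "card I'' < card J"
      by (auto intro: psubset_card_mono)
    let ?B = "\<lambda>J. {K \<in> branches \<I>. K \<subseteq> J}"
    have fin: "finite (?B J)" for J
      by (rule finite_subset[OF subset_UNIV]) simp
    have "?B I' \<inter> ?B I'' = {}"
      using s(3) ne unfolding branches_def by blast
    moreover have "J \<notin> ?B I' \<union> ?B I''"
      using sub by blast
    moreover have "insert J (?B I' \<union> ?B I'') \<subseteq> ?B J"
      using J s(4) by blast
    ultimately have "card (?B I') + card (?B I'') + 1 \<le> card (?B J)"
      using card_mono[OF fin, of "insert J (?B I' \<union> ?B I'')" J] fin by (simp add: card_Un_disjoint)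
    moreover have "card J = card I' + card I''"
      using s by (simp add: card_Un_disjoint)
    ultimately show ?thesis
      using less.hyps[OF card(1) s(1)] less.hyps[OF card(2) s(2)] by simp
  qed auto
qed

text \<open>The count for a single tree, summed over the trees of the forest, whose roots are the
  maximal members.\<close>

lemma card_UNIV_le: "CARD('e) \<le> card (branches \<I>) + card (maximal_members \<I>)"
proof -
  let ?M = "maximal_members \<I>" and ?B = "\<lambda>J. {K \<in> branches \<I>. K \<subseteq> J}"
  have finM: "finite ?M" and finB: "finite (?B J)" for J
    by (auto intro: finite_subset[OF subset_UNIV])
  have "(UNIV :: 'e set) = \<Union>?M"
    using maximal_cover by blast
  then have "CARD('e) \<le> (\<Sum>J\<in>?M. card J)"
    using card_Union_le_sum_card[of ?M] by simp
  also have "\<dots> \<le> (\<Sum>J\<in>?M. card (?B J) + 1)"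
    by (intro sum_mono card_le_branches_below maximal_member)
  also have "\<dots> = (\<Sum>J\<in>?M. card (?B J)) + card ?M"
    by (simp only: sum.distrib) simp
  also have "(\<Sum>J\<in>?M. card (?B J)) = card (\<Union>J\<in>?M. ?B J)"
  proof (rule card_UN_disjoint[symmetric])
    have "?B J \<inter> ?B J' = {}" if "J \<in> ?M" "J' \<in> ?M" "J \<noteq> J'" for J J'
      using maximal_disjoint[OF that] ne unfolding branches_def by blast
    then show "\<forall>J\<in>?M. \<forall>J'\<in>?M. J \<noteq> J' \<longrightarrow> ?B J \<inter> ?B J' = {}" by blast
  qed (use finM finB in auto)
  finally have "CARD('e) \<le> card (\<Union>J\<in>?M. ?B J) + card ?M" .
  moreover have "card (\<Union>J\<in>?M. ?B J) \<le> card (branches \<I>)"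
    by (rule card_mono) (rule finite_subset[OF subset_UNIV], simp, blast)
  ultimately show ?thesis by simp
qed

lemma UNIV_not_lopsided: "\<not> lopsided len UNIV"
proof
  assume U: "lopsided len UNIV"
  obtain \<rho> where "\<rho> \<in> closed_polygons len"
    using Pol_ne by (auto simp: Pol_def)
  with lopsided_closed_polygon[OF U this] show False
    by (simp add: closed_polygons_iff)
qed

lemma bending_group_branches: "bending_group len \<I> = bending_group len (branches \<I>)"
proof
  show "bending_group len (branches \<I>) \<subseteq> bending_group len \<I>"
    by (rule bending_group_mono[OF gen pos]) (use lop in \<open>auto simp: branches_def\<close>)
  show "bending_group len \<I> \<subseteq> bending_group len (branches \<I>)"
  proof (rule bending_group_subsetI[OF gen pos])
    show "\<forall>I\<in>branches \<I>. lopsided len I"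
      using lop by (simp add: branches_def)
    show "bending_flow len K t \<in> bending_group len (branches \<I>)" if "K \<in> \<I>" for K t
    proof (cases "K \<in> branches \<I>")
      case False
      then obtain e where "K = {e}" using \<open>K \<in> \<I>\<close> by (auto simp: branches_def)
      then have "bending_flow len K t = \<one>\<^bsub>BijGroup (Pol len)\<^esub>"
        by (simp add: bending_flow_singleton[OF gen pos])
      then show ?thesis
        unfolding bending_group_def by (simp add: generate.one)
    qed (rule bending_flow_in_bending_group)
  qed
qed

text \<open>For a branch below the maximal member J, X and Y are its two halves, a second maximal
  member serves as C, and a third one makes D nonempty. With only two, complementary maximal members
  have the same flow, and the angles would not be independent.\<close>

lemma hamiltonian_torus:
  assumes three: "3 \<le> card (maximal_members \<I>)"
  shows "hamiltonian_torus_of_dim len (card (branches \<I>)) (bending_group len \<I>)"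
proof -
  define k where "k = card (branches \<I>)"
  have "finite (branches \<I>)" by (rule finite_subset[OF subset_UNIV]) simp
  then obtain f where "bij_betw f {0..<k} (branches \<I>)"
    unfolding k_def using ex_bij_betw_nat_finite by blast
  then have f: "inj_on f {..<k}" "f ` {..<k} = branches \<I>"
    by (simp_all add: bij_betw_def atLeast0LessThan)
  then have fI: "f i \<in> branches \<I>" "f i \<in> \<I>" if "i < k" for i
    using that by (auto simp: branches_def)
  interpret effective_laminar_family len f k
  proof
    show "generic len" "\<And>e. len e > 0" "Pol len \<noteq> {}" "inj_on f {..<k}"
      by (fact gen, fact pos, fact Pol_ne, fact f)
    show "\<And>i. i < k \<Longrightarrow> lopsided len (f i)"
      using fI lop by blast
    show "nested_or_disjoint (f i) (f j)" if "i < k" "j < k" for i j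
      unfolding nested_or_disjoint_def using laminar fI that by blast
    fix i assume i: "i < k"
    obtain X Y where XY: "X \<in> \<I>" "Y \<in> \<I>" "X \<inter> Y = {}" "f i = X \<union> Y"
      using split_branch[OF fI(1)[OF i]] by blast
    obtain J where J: "J \<in> maximal_members \<I>" "f i \<subseteq> J"
      using maximal_above[OF fI(2)[OF i]] by blast
    have "2 \<le> card (maximal_members \<I> - {J})"
      using three J by simp
    then obtain T where T: "T \<subseteq> maximal_members \<I> - {J}" "card T = 2"
      by (rule obtain_subset_with_card_n)
    then obtain C J3 where "T = {C, J3}" "C \<noteq> J3"
      by (auto simp: card_2_iff)
    with T(1) have CJ: "C \<in> maximal_members \<I>" "J3 \<in> maximal_members \<I>" "C \<noteq> J" "J3 \<noteq> J" "C \<noteq> J3"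
      by auto
    have dis: "C \<inter> J = {}" "J3 \<inter> J = {}" "C \<inter> J3 = {}"
      using maximal_disjoint CJ J by blast+
    define D where "D = - (f i \<union> C)"
    have "J3 \<subseteq> D" using dis J(2) by (auto simp: D_def)
    then have "D \<noteq> {}" using ne[OF maximal_member[OF CJ(2)]] by blast
    have C: "C \<in> \<I>" "C \<noteq> {}" using maximal_member ne CJ by blast+
    have others: "f i \<subseteq> f j \<or> (\<forall>Z\<in>{X, f i, C}. f j \<subseteq> Z \<or> f j \<inter> Z = {})" if j: "j < k" "j \<noteq> i" for j
    proof (cases "f i \<subseteq> f j")
      case False
      have CK: "f j \<subseteq> C \<or> f j \<inter> C = {}"
        using member_vs_maximal[OF CJ(1) fI(2)[OF j(1)]] by blast
      consider "f j \<inter> f i = {}" | "f j \<subset> f i"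
        using laminar[OF fI(2)[OF i] fI(2)[OF j(1)]] False by blast
      then show ?thesis
      proof cases
        case 1
        then have "f j \<inter> X = {}" using XY by blast
        then show ?thesis using 1 CK by blast
      next
        case 2
        then have "f j \<subseteq> X \<or> f j \<subseteq> Y"
          using proper_subset_of_split[OF XY(1-3) fI(2)[OF j(1)]] XY(4) by simp
        then have "f j \<subseteq> X \<or> f j \<inter> X = {}" using XY(3) by blast
        then show ?thesis using 2 CK by blast
      qed
    qed simp
    have "four_blocks X Y C D"
      unfolding four_blocks_def
    proof (intro conjI)
      show "X \<noteq> {}" "Y \<noteq> {}" "C \<noteq> {}" "D \<noteq> {}" "X \<inter> Y = {}"
        using XY ne C \<open>D \<noteq> {}\<close> by blast+
      show "X \<union> Y \<union> C \<union> D = UNIV" "X \<inter> D = {}" "Y \<inter> D = {}" "C \<inter> D = {}"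
        unfolding D_def XY(4) by blast+
      show "X \<inter> C = {}" "Y \<inter> C = {}"
        using J(2) dis(1) XY(4) by blast+
    qed
    then show "\<exists>X Y C D. four_blocks X Y C D \<and> f i = X \<union> Y \<and>
      (\<forall>j<k. j \<noteq> i \<longrightarrow> f i \<subseteq> f j \<or> (\<forall>Z\<in>{X, f i, C}. f j \<subseteq> Z \<or> f j \<inter> Z = {}))"
      using XY(4) others by blast
  qed
  show ?thesis
    using hamiltonian_torus unfolding bending_group_branches k_def[symmetric] f(2) .
qed

end

section \<open>Polygons with blocks of equal length\<close>

lemma norm_block_sum_le:
  assumes "\<rho> \<in> closed_polygons len"
  shows "norm (block_sum I \<rho>) \<le> sum len I"
  unfolding block_sum_def using assms by (intro sum_norm_le) (simp add: closed_polygons_iff)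

lemma norm_block_sum_ge:
  assumes "\<rho> \<in> closed_polygons len" "e \<in> I"
  shows "len e - sum len (I - {e}) \<le> norm (block_sum I \<rho>)"
proof -
  have "block_sum I \<rho> = \<rho> $ e + block_sum (I - {e}) \<rho>"
    using block_sum_insert[of e "I - {e}" \<rho>] assms(2) by (simp add: insert_absorb)
  moreover have "norm (\<rho> $ e) - norm (block_sum (I - {e}) \<rho>) \<le> norm (\<rho> $ e + block_sum (I - {e}) \<rho>)"
    by (rule norm_diff_ineq)
  ultimately show ?thesis
    using norm_block_sum_le[OF assms(1), of "I - {e}"] assms(1) by (simp add: closed_polygons_iff)
qed

lemma bend_length_image: "bend_length I ` Pol len = (\<lambda>\<rho>. norm (block_sum I \<rho>)) ` closed_polygons len"
  by (simp add: Pol_def image_image bend_length_block_sum)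

text \<open>The block with the dominating edge e is at least as long as e minus its other edges,
  hence longer than the stretched other block. Neither bound depends on the polygon, so the
  comparison also holds for lengths taken from different polygons, as the images require.\<close>

lemma lopsided_union_disjoint_images:
  fixes len :: "'e::finite \<Rightarrow> real"
  assumes "lopsided len (J \<union> J')" "J \<inter> J' = {}"
  shows "bend_length J ` Pol len \<inter> bend_length J' ` Pol len = {}"
proof -
  have *: False if "e \<in> B" "len e > sum len (A \<union> B - {e})" "A \<inter> B = {}" "\<rho> \<in> closed_polygons len" "\<sigma> \<in> closed_polygons len"
      "norm (block_sum A \<rho>) = norm (block_sum B \<sigma>)" for e A B \<rho> \<sigma>
  proof -
    have "A \<union> B - {e} = A \<union> (B - {e})" "A \<inter> (B - {e}) = {}" using that by blast+
    then have "sum len (A \<union> B - {e}) = sum len A + sum len (B - {e})"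
      by (simp add: sum.union_disjoint)
    then show False
      using that norm_block_sum_le[OF that(4), of A] norm_block_sum_ge[OF that(5,1)] by simp
  qed
  obtain e where e: "e \<in> J \<union> J'" "len e > sum len (J \<union> J' - {e})"
    using assms(1) by (auto simp: lopsided_def)
  show ?thesis
  proof (rule ccontr)
    assume "\<not> ?thesis"
    then obtain \<rho> \<sigma> where \<rho>: "\<rho> \<in> closed_polygons len" "\<sigma> \<in> closed_polygons len"
        "norm (block_sum J \<rho>) = norm (block_sum J' \<sigma>)"
      by (auto simp: bend_length_image)
    show False
    proof (cases "e \<in> J'")
      case True
      then show False
        using *[OF True e(2) assms(2) \<rho>] by simp
    next
      case False
      then have eJ: "e \<in> J" using e by blast
      have J'J: "len e > sum len (J' \<union> J - {e})" "J' \<inter> J = {}"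
        using e(2) assms(2) by (simp_all add: Un_commute Int_commute)
      show False
        using *[OF eJ J'J \<rho>(2,1)] \<rho>(3) by simp
    qed
  qed
qed

section \<open>Reach of chains of arms\<close>

lemma two_arms:
  fixes v :: "real^3"
  assumes "\<bar>p - q\<bar> \<le> norm v" "norm v \<le> p + q"
  obtains x y where "norm x = p" "norm y = q" "x + y = v"
proof (cases "v = 0")
  case True
  then have "p = q" "p \<ge> 0" using assms by auto
  moreover have "norm (p *\<^sub>R axis 1 1 :: real^3) = \<bar>p\<bar>"
    by (simp add: norm_axis_1)
  ultimately show ?thesis
    using that[of "p *\<^sub>R axis 1 1" "- (p *\<^sub>R axis 1 1)"] True by simp
next
  case False
  obtain w where w: "w \<noteq> 0" "w \<bullet> v = 0"
    using perpendicular_direction[OF False] by metis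
  define N where "N = norm v"
  have N: "N > 0" using False by (simp add: N_def)
  have pq: "p \<ge> 0" "q \<ge> 0" using assms by auto
  \<comment> \<open>The position of the foot of the apex on the line of v, by the cosine rule. The
    inequalities assumed for the norm of v yield |\<alpha>| \<le> p, so that the height is
    real.\<close>
  define \<alpha> where "\<alpha> = (N\<^sup>2 + p\<^sup>2 - q\<^sup>2) / (2 * N)"
  have "(N - p)\<^sup>2 \<le> q\<^sup>2"
    using assms pq by (intro abs_le_square_iff[THEN iffD1]) (auto simp: N_def)
  moreover have "q\<^sup>2 \<le> (N + p)\<^sup>2"
    using assms pq by (intro power_mono) (auto simp: N_def)
  ultimately have "\<bar>N\<^sup>2 + p\<^sup>2 - q\<^sup>2\<bar> \<le> p * (2 * N)"
    by (simp add: power2_eq_square algebra_simps abs_le_iff)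
  then have "\<bar>\<alpha>\<bar> \<le> p"
    using N by (simp add: \<alpha>_def abs_divide pos_divide_le_eq)
  then have \<alpha>p: "\<alpha>\<^sup>2 \<le> p\<^sup>2"
    by (simp add: abs_le_square_iff[symmetric] pq)
  define u where "u = sgn w"
  define n where "n = sgn v"
  have un: "u \<bullet> u = 1" "n \<bullet> n = 1" "u \<bullet> n = 0" "n \<bullet> u = 0" "v = N *\<^sub>R n"
    using w False by (simp_all add: u_def n_def N_def sgn_inner_self) (simp_all add: sgn_div_norm inner_commute)
  define x where "x = \<alpha> *\<^sub>R n + sqrt (p\<^sup>2 - \<alpha>\<^sup>2) *\<^sub>R u"
  have xx: "x \<bullet> x = p\<^sup>2"
    using \<alpha>p by (simp add: x_def inner_add_left inner_add_right un flip: power2_eq_square)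
  have xn: "x \<bullet> n = \<alpha>"
    by (simp add: x_def inner_add_left un)
  have "(v - x) \<bullet> (v - x) = N\<^sup>2 - 2 * N * \<alpha> + p\<^sup>2"
    by (simp add: un(5) inner_diff_left inner_diff_right xx xn inner_commute[of n x] un power2_eq_square algebra_simps)
  also have "\<dots> = q\<^sup>2"
    using N by (simp add: \<alpha>_def)
  finally have "norm (v - x) = q" "norm x = p"
    using xx pq by (simp_all add: norm_eq_sqrt_inner)
  then show ?thesis
    using that[of x "v - x"] by simp
qed

text \<open>All edges but the dominating one are lined up into one arm of length L, so that the
  block becomes a triangle over v. For a singleton L is 0, but then no edge is left for the quotient
  \<open>len h / L\<close>.\<close>

lemma lopsided_block_reach:
  fixes len :: "'e::finite \<Rightarrow> real" and v :: "real^3"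
  assumes pos: "\<And>e. len e > 0" and e: "e \<in> I" "len e > sum len (I - {e})"
    and v: "len e - sum len (I - {e}) \<le> norm v" "norm v \<le> sum len I"
  obtains x where "\<And>h. h \<in> I \<Longrightarrow> norm (x h) = len h" "sum x I = v"
proof -
  define L where "L = sum len (I - {e})"
  have sI: "sum f I = f e + sum f (I - {e})" for f :: "'e \<Rightarrow> 'b::comm_monoid_add"
    using e by (simp add: sum.remove)
  obtain x0 y where xy: "norm x0 = len e" "norm y = L" "x0 + y = v"
    using two_arms[of "len e" L v] v e sI[of len] by (auto simp: L_def)
  define x where "x h = (if h = e then x0 else (len h / L) *\<^sub>R y)" for h
  have Lpos: "L > 0" if "h \<in> I" "h \<noteq> e" for h
    unfolding L_def using pos that by (intro sum_pos) auto
  have "sum x (I - {e}) = y"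
  proof (cases "I - {e} = {}")
    case True
    have "L = 0" unfolding L_def True by simp
    then show ?thesis unfolding True using xy by simp
  next
    case False
    then have "L > 0" using Lpos by auto
    have "sum x (I - {e}) = (\<Sum>h\<in>I - {e}. (len h / L) *\<^sub>R y)"
      by (rule sum.cong) (auto simp: x_def)
    also have "\<dots> = (sum len (I - {e}) / L) *\<^sub>R y"
      by (simp add: scaleR_sum_left sum_divide_distrib)
    finally show ?thesis using \<open>L > 0\<close> by (simp add: L_def)
  qed
  then have "sum x I = v"
    using sI[of x] xy by (simp add: x_def)
  moreover have "norm (x h) = len h" if "h \<in> I" for h
    using Lpos[OF that] xy pos[of h] by (cases "h = e") (simp_all add: x_def)
  ultimately show thesis by (rule that[rotated])
qed

text \<open>One arm is laid along w, which brings the distance still to be covered within reach of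
  the remaining arms. The induction starts with two arms, since a single arm reaches only vectors of
  norm s.\<close>

lemma equal_arms:
  fixes w :: "real^3"
  assumes "finite F" "card F = n + 2" "s \<ge> 0" "norm w \<le> real (n + 2) * s"
  shows "\<exists>y. (\<forall>J\<in>F. norm (y J) = s) \<and> sum y F = w"
  using assms
proof (induction n arbitrary: F w)
  case 0
  then obtain A B where F: "F = {A, B}" "A \<noteq> B"
    using card_2_iff[of F] by auto
  obtain x z where "norm x = s" "norm z = s" "x + z = w"
    using two_arms[of s s w] 0 by auto
  then show ?case
    using F by (intro exI[of _ "\<lambda>J. if J = A then x else z"]) auto
next
  case (Suc n)
  then obtain A where A: "A \<in> F" by fastforce
  have card: "card (F - {A}) = n + 2"
    using Suc A by simp
  define x where "x = (if w = 0 then s *\<^sub>R axis 1 1 else s *\<^sub>R sgn w)"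
  have nx: "norm x = s"
    using Suc.prems(3) by (simp add: x_def norm_axis_1 norm_sgn)
  have "norm (w - x) \<le> real (n + 2) * s"
  proof (cases "w = 0")
    case True
    have "s * 1 \<le> s * real (n + 2)"
      using Suc.prems(3) by (intro mult_left_mono) auto
    then show ?thesis using True nx by (simp add: mult.commute)
  next
    case False
    then have "w - x = (norm w - s) *\<^sub>R sgn w"
      by (simp add: x_def sgn_div_norm left_diff_distrib scaleR_diff_left)
    then have nwx: "norm (w - x) = \<bar>norm w - s\<bar>"
      using False by (simp add: norm_sgn)
    have 1: "norm w - s \<le> real (n + 2) * s"
      using Suc.prems(4) by (simp add: algebra_simps)
    have "s * 1 \<le> s * real (n + 2)"
      using Suc.prems(3) by (intro mult_left_mono) auto
    then have 2: "s \<le> real (n + 2) * s" by (simp add: mult.commute)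
    show ?thesis
      unfolding nwx abs_le_iff using 1 2 norm_ge_zero[of w] by linarith
  qed
  from Suc.IH[OF _ card Suc.prems(3) this] Suc.prems(1)
  obtain y where y: "\<forall>J\<in>F - {A}. norm (y J) = s" "sum y (F - {A}) = w - x"
    by auto
  have "sum (\<lambda>J. if J = A then x else y J) F = x + sum y (F - {A})"
    using A Suc.prems(1) by (simp add: sum.remove[of F A])
  then show ?case
    using y nx by (intro exI[of _ "\<lambda>J. if J = A then x else y J"]) auto
qed

context full_set
begin

lemma sum_over_maximal: "sum f UNIV = (\<Sum>J\<in>maximal_members \<I>. sum f J)" for f :: "'e \<Rightarrow> 'b::comm_monoid_add"
proof -
  have "(UNIV :: 'e set) = \<Union>(maximal_members \<I>)"
    using maximal_cover by blast
  then have "sum f UNIV = sum f (\<Union>(maximal_members \<I>))" by simp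
  also have "\<dots> = (\<Sum>J\<in>maximal_members \<I>. sum f J)"
    using maximal_disjoint by (subst sum.Union_disjoint) auto
  finally show ?thesis .
qed

text \<open>A maximal block can take every length between \<open>m J\<close>, its dominating edge
  minus the others, and the sum of its edges. The largest lower end s serves all blocks: for
  distinct J and J' the inequality \<open>m J \<le> sum len J'\<close> says that the dominating edge
  of J does not dominate the union.\<close>

lemma equilateral_polygon:
  assumes two: "2 \<le> card (maximal_members \<I>)"
    and no_pair: "\<And>J J'. J \<in> maximal_members \<I> \<Longrightarrow> J' \<in> maximal_members \<I> \<Longrightarrow> J \<noteq> J' \<Longrightarrow> \<not> lopsided len (J \<union> J')"
  obtains \<rho> s where "\<rho> \<in> closed_polygons len" "\<And>J. J \<in> maximal_members \<I> \<Longrightarrow> norm (block_sum J \<rho>) = s"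
proof -
  let ?M = "maximal_members \<I>"
  have fin: "finite ?M" by (rule finite_subset[OF subset_UNIV]) simp
  have M0: "?M \<noteq> {}" using two by auto
  have "\<forall>J\<in>?M. \<exists>e. e \<in> J \<and> len e > sum len (J - {e})"
    using lop maximal_member unfolding lopsided_def by blast
  then obtain d where d: "\<And>J. J \<in> ?M \<Longrightarrow> d J \<in> J" "\<And>J. J \<in> ?M \<Longrightarrow> len (d J) > sum len (J - {d J})"
    by metis
  define m where "m J = len (d J) - sum len (J - {d J})" for J
  define s where "s = Max (m ` ?M)"
  have ms: "m J \<le> s" if "J \<in> ?M" for J
    unfolding s_def using fin that by (intro Max_ge) auto
  have s0: "s > 0"
  proof -
    obtain J where "J \<in> ?M" using M0 by blast
    then show ?thesis using ms[of J] d(2)[of J] by (simp add: m_def)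
  qed
  have sl: "s \<le> sum len J'" if J': "J' \<in> ?M" for J'
  proof -
    have "s \<in> m ` ?M"
      unfolding s_def using fin M0 by (intro Max_in) auto
    then obtain J where J: "J \<in> ?M" "s = m J" by blast
    have nonneg: "sum len A \<ge> 0" for A
      using pos by (intro sum_nonneg) (simp add: less_imp_le)
    show ?thesis
    proof (cases "J = J'")
      case True
      have "sum len J = len (d J) + sum len (J - {d J})"
        using d(1)[OF J(1)] by (simp add: sum.remove)
      then show ?thesis
        using True J nonneg[of "J - {d J}"] by (simp add: m_def)
    next
      case False
      have dis: "J \<inter> J' = {}" by (rule maximal_disjoint[OF J(1) J' False])
      then have "J \<union> J' - {d J} = (J - {d J}) \<union> J'"
        using d(1)[OF J(1)] by blast
      then have "sum len (J \<union> J' - {d J}) = sum len (J - {d J}) + sum len J'"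
        using dis by (simp add: sum.union_disjoint Diff_Int_distrib2)
      moreover have "\<not> len (d J) > sum len (J \<union> J' - {d J})"
        using no_pair[OF J(1) J' False] d(1)[OF J(1)] unfolding lopsided_def by blast
      ultimately show ?thesis
        using J by (simp add: m_def)
    qed
  qed
  obtain n where n: "card ?M = n + 2"
    using two by (metis add.commute le_Suc_ex)
  have "norm (0 :: real^3) \<le> real (n + 2) * s"
    using s0 by simp
  from equal_arms[OF fin n _ this] s0
  obtain y where y: "\<And>J. J \<in> ?M \<Longrightarrow> norm (y J) = s" "sum y ?M = (0 :: real^3)" by auto
  have "\<forall>J\<in>?M. \<exists>x. (\<forall>h\<in>J. norm (x h) = len h) \<and> sum x J = y J"
  proof
    fix J assume J: "J \<in> ?M"
    have "len (d J) - sum len (J - {d J}) \<le> norm (y J)" "norm (y J) \<le> sum len J"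
      using ms[OF J] sl[OF J] y(1)[OF J] by (simp_all add: m_def)
    from lopsided_block_reach[OF pos d(1)[OF J] d(2)[OF J] this]
    show "\<exists>x. (\<forall>h\<in>J. norm (x h) = len h) \<and> sum x J = y J" by metis
  qed
  then obtain x where x: "\<And>J h. J \<in> ?M \<Longrightarrow> h \<in> J \<Longrightarrow> norm (x J h) = len h" "\<And>J. J \<in> ?M \<Longrightarrow> sum (x J) J = y J"
    by metis
  obtain c where c: "\<And>e. c e \<in> ?M" "\<And>e. e \<in> c e"
    using maximal_cover by metis
  define \<rho> where "\<rho> = (\<chi> e. x (c e) e)"
  have block: "block_sum J \<rho> = y J" if J: "J \<in> ?M" for J
  proof -
    have "c e = J" if "e \<in> J" for e
      using maximal_disjoint[OF c(1) J, of e] c(2)[of e] that by blast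
    then have "block_sum J \<rho> = sum (x J) J"
      unfolding block_sum_def by (intro sum.cong) (simp_all add: \<rho>_def)
    then show ?thesis using x(2)[OF J] by simp
  qed
  have "block_sum UNIV \<rho> = (\<Sum>J\<in>?M. block_sum J \<rho>)"
    unfolding block_sum_def by (rule sum_over_maximal)
  also have "\<dots> = 0"
    using block y(2) by simp
  finally have "\<rho> \<in> closed_polygons len"
    using x(1) c by (simp add: closed_polygons_iff \<rho>_def)
  then show thesis
    using that block y(1) by metis
qed

section \<open>Extending and reducing full bending sets\<close>

text \<open>Fullness leaves no room for a new compatible set below a member: in the smallest member
  around L, neither half contains L, so L meets both halves and by compatibility contains
  both.\<close>

lemma member_if_compatible:
  assumes L: "L \<noteq> {}" "L \<subseteq> J" "J \<in> \<I>" and comp: "\<And>I. I \<in> \<I> \<Longrightarrow> L \<inter> I = {} \<or> L \<subseteq> I \<or> I \<subseteq> L"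
  shows "L \<in> \<I>"
proof -
  have "finite {I \<in> \<I>. L \<subseteq> I}" by (rule finite_subset[OF subset_UNIV]) simp
  moreover have "{I \<in> \<I>. L \<subseteq> I} \<noteq> {}" using L by blast
  ultimately have "\<exists>I\<in>{I \<in> \<I>. L \<subseteq> I}. \<forall>K\<in>{I \<in> \<I>. L \<subseteq> I}. K \<subseteq> I \<longrightarrow> I = K"
    by (rule finite_has_minimal)
  then obtain I where I: "I \<in> \<I>" "L \<subseteq> I" and min: "\<And>K. K \<in> \<I> \<Longrightarrow> L \<subseteq> K \<Longrightarrow> K \<subseteq> I \<Longrightarrow> I = K"
    by auto
  show ?thesis
  proof (cases "I \<in> branches \<I>")
    case False
    then obtain e where "I = {e}" using I by (auto simp: branches_def)
    then have "L = I" using I(2) L(1) by blast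
    then show ?thesis using I(1) by simp
  next
    case True
    obtain I' I'' where s: "I' \<in> \<I>" "I'' \<in> \<I>" "I' \<inter> I'' = {}" "I = I' \<union> I''"
      by (rule split_branch[OF True])
    have "I \<noteq> I'" "I \<noteq> I''"
      using s ne[OF s(1)] ne[OF s(2)] by blast+
    then have "\<not> L \<subseteq> I'" "\<not> L \<subseteq> I''"
      using min[of I'] min[of I''] s by blast+
    then have "I' \<subseteq> L" "I'' \<subseteq> L"
      using comp[OF s(1)] comp[OF s(2)] I(2) s(4) by blast+
    then have "L = I" using I(2) s(4) by blast
    then show ?thesis using I(1) by simp
  qed
qed

text \<open>Two members lie below at most two maximal ones; a third would be nonempty and disjoint
  from both. This disposes of the case that a set and its partner cover all edges.\<close>

lemma no_two_members_cover:
  assumes "3 \<le> card (maximal_members \<I>)" "J \<in> maximal_members \<I>" "I \<in> \<I>"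
  shows "J \<union> I \<noteq> UNIV"
proof
  assume U: "J \<union> I = UNIV"
  obtain J' where J': "J' \<in> maximal_members \<I>" "I \<subseteq> J'"
    using maximal_above[OF assms(3)] by blast
  have "maximal_members \<I> \<subseteq> {J, J'}"
  proof
    fix A assume A: "A \<in> maximal_members \<I>"
    show "A \<in> {J, J'}"
    proof (rule ccontr)
      assume "A \<notin> {J, J'}"
      then have "A \<inter> J = {}" "A \<inter> J' = {}"
        using maximal_disjoint[OF A assms(2)] maximal_disjoint[OF A J'(1)] by simp_all
      then show False
        using U J'(2) ne[OF maximal_member[OF A]] by blast
    qed
  qed
  then have "card (maximal_members \<I>) \<le> card {J, J'}"
    by (intro card_mono) auto
  also have "\<dots> \<le> 2"
    by (simp add: card_insert_if)
  finally show False using assms(1) by simp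
qed

text \<open>Compatibility with the maximal members leaves three positions: K below one of them, its
  complement below one of them, or K a union of them. In the first two
  \<open>member_if_compatible\<close> applies.\<close>

lemma lopsided_compatible_set:
  assumes three: "3 \<le> card (maximal_members \<I>)" and K: "lopsided len K"
    and no_pair: "\<And>J J'. J \<in> maximal_members \<I> \<Longrightarrow> J' \<in> maximal_members \<I> \<Longrightarrow> J \<noteq> J' \<Longrightarrow> \<not> lopsided len (J \<union> J')"
    and comp: "\<And>I. I \<in> \<I> \<Longrightarrow> K \<inter> I = {} \<or> K \<subseteq> I \<or> I \<subseteq> K \<or> K \<union> I = UNIV"
  shows "K \<in> \<I> \<or> - K \<in> \<I>"
proof -
  have K0: "K \<noteq> {}" by (rule lopsided_nonempty[OF K])
  have "K \<noteq> UNIV" using K UNIV_not_lopsided by blast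
  then have KU: "- K \<noteq> {}" by blast
  consider (inside) J where "J \<in> maximal_members \<I>" "K \<subseteq> J" | (outside) J where "J \<in> maximal_members \<I>" "- K \<subseteq> J"
    | (union) "\<And>J. J \<in> maximal_members \<I> \<Longrightarrow> K \<inter> J = {} \<or> J \<subseteq> K"
    using comp maximal_member by blast
  then show ?thesis
  proof cases
    case inside
    have "K \<inter> I = {} \<or> K \<subseteq> I \<or> I \<subseteq> K" if "I \<in> \<I>" for I
      using comp[OF that] no_two_members_cover[OF three inside(1) that] inside(2) by blast
    then show ?thesis
      using member_if_compatible[OF K0 inside(2) maximal_member[OF inside(1)]] by blast
  next
    case outside
    have "- K \<inter> I = {} \<or> - K \<subseteq> I \<or> I \<subseteq> - K" if "I \<in> \<I>" for I
      using comp[OF that] no_two_members_cover[OF three outside(1) that] outside(2) by blast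
    then show ?thesis
      using member_if_compatible[OF KU outside(2) maximal_member[OF outside(1)]] by blast
  next
    case union
    obtain e where e: "e \<in> K" "len e > sum len (K - {e})"
      using K by (auto simp: lopsided_def)
    obtain J where J: "J \<in> maximal_members \<I>" "e \<in> J"
      using maximal_cover by blast
    have JK: "J \<subseteq> K" using union[OF J(1)] e(1) J(2) by blast
    show ?thesis
    proof (cases "J = K")
      case True
      then show ?thesis using maximal_member[OF J(1)] by blast
    next
      case False
      then obtain f where f: "f \<in> K" "f \<notin> J" using JK by blast
      obtain J' where J': "J' \<in> maximal_members \<I>" "f \<in> J'"
        using maximal_cover by blast
      have J'K: "J' \<subseteq> K" using union[OF J'(1)] f(1) J'(2) by blast
      \<comment> \<open>An edge that dominates K dominates every subset of K containing it, in
        particular the union of its own maximal block with a second one inside K.\<close>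
      have "sum len (J \<union> J' - {e}) \<le> sum len (K - {e})"
        using JK J'K pos by (intro sum_mono2) (auto simp: less_imp_le)
      then have "lopsided len (J \<union> J')"
        unfolding lopsided_def using e(2) J(2) by force
      moreover have "J \<noteq> J'" using f J' by blast
      ultimately show ?thesis using no_pair[OF J(1) J'(1)] by blast
    qed
  qed
qed

text \<open>The union becomes the parent of J and J', so two trees are joined to one: one inner node
  is gained and at most one maximal member is lost.\<close>

lemma full_set_insert_union:
  assumes J: "J \<in> maximal_members \<I>" "J' \<in> maximal_members \<I>" "J \<noteq> J'" and lopJ: "lopsided len (J \<union> J')"
  shows "full_set len (insert (J \<union> J') \<I>)"
    and "card (branches (insert (J \<union> J') \<I>)) = card (branches \<I>) + 1"
    and "card (maximal_members \<I>) \<le> card (maximal_members (insert (J \<union> J') \<I>)) + 1"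
proof -
  let ?U = "J \<union> J'"
  note JI = maximal_member[OF J(1)] maximal_member[OF J(2)]
  have dis: "J \<inter> J' = {}" by (rule maximal_disjoint[OF J])
  have new: "?U \<notin> \<I>"
  proof
    assume "?U \<in> \<I>"
    then have "?U = J" using J(1) by (auto simp: maximal_members_def)
    then show False using dis ne[OF JI(2)] by blast
  qed
  have lamU: "A \<inter> ?U = {} \<or> A \<subseteq> ?U" if "A \<in> \<I>" for A
    using member_vs_maximal[OF J(1) that] member_vs_maximal[OF J(2) that] by blast
  have "bending_set len (insert ?U \<I>)"
    unfolding bending_set_def
  proof (intro conjI ballI allI)
    show "lopsided len I" if "I \<in> insert ?U \<I>" for I
      using that lop lopJ by auto
    show "{e} \<in> insert ?U \<I>" for e
      using singletons by simp
    fix A B assume "A \<in> insert ?U \<I>" "B \<in> insert ?U \<I>"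
    then show "A \<inter> B = {} \<or> A \<subseteq> B \<or> B \<subseteq> A"
      using lamU laminar by (elim insertE) (simp, blast, blast, blast)
  qed
  moreover have "\<exists>I'\<in>insert ?U \<I>. \<exists>I''\<in>insert ?U \<I>. I' \<inter> I'' = {} \<and> I = I' \<union> I''"
    if I: "I \<in> insert ?U \<I>" "\<nexists>e. I = {e}" for I
  proof (cases "I = ?U")
    case True
    then show ?thesis using JI dis by blast
  next
    case False
    then have "I \<in> branches \<I>" using I by (simp add: branches_def)
    then obtain I' I'' where "I' \<in> \<I>" "I'' \<in> \<I>" "I' \<inter> I'' = {}" "I = I' \<union> I''"
      by (rule split_branch)
    then show ?thesis by blast
  qed
  ultimately show "full_set len (insert ?U \<I>)"
    using gen pos Pol_ne by unfold_locales (auto simp: full_bending_set_def)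
  have "\<nexists>e. ?U = {e}"
    using dis ne[OF JI(1)] ne[OF JI(2)] by (auto simp: Un_singleton_iff)
  then have "branches (insert ?U \<I>) = insert ?U (branches \<I>)"
    by (auto simp: branches_def)
  moreover have "?U \<notin> branches \<I>" using new by (simp add: branches_def)
  moreover have "finite (branches \<I>)" by (rule finite_subset[OF subset_UNIV]) simp
  ultimately show "card (branches (insert ?U \<I>)) = card (branches \<I>) + 1"
    by simp
  have sub: "insert ?U (maximal_members \<I> - {J, J'}) \<subseteq> maximal_members (insert ?U \<I>)"
  proof
    fix A assume "A \<in> insert ?U (maximal_members \<I> - {J, J'})"
    then consider "A = ?U" | "A \<in> maximal_members \<I>" "A \<noteq> J" "A \<noteq> J'" by blast
    then show "A \<in> maximal_members (insert ?U \<I>)"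
    proof cases
      case 1
      have "K = ?U" if "K \<in> \<I>" "?U \<subseteq> K" for K
        using lamU[OF that(1)] that ne[OF JI(1)] by blast
      then show ?thesis using 1 by (auto simp: maximal_members_def)
    next
      case 2
      have "A \<inter> ?U = {}"
        using maximal_disjoint[OF 2(1) J(1) 2(2)] maximal_disjoint[OF 2(1) J(2) 2(3)] by blast
      then have "\<not> A \<subseteq> ?U" using ne[OF maximal_member[OF 2(1)]] by blast
      then show ?thesis using 2(1) by (auto simp: maximal_members_def)
    qed
  qed
  have fin: "finite (maximal_members K)" for K :: "'e set set"
    by (rule finite_subset[OF subset_UNIV]) simp
  have "?U \<notin> maximal_members \<I>" using new maximal_member by blast
  then have "card (insert ?U (maximal_members \<I> - {J, J'})) = card (maximal_members \<I>) - 2 + 1"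
    using J fin by (simp add: card_Diff_subset)
  moreover have "2 \<le> card (maximal_members \<I>)"
    using card_mono[OF fin, of "{J, J'}" \<I>] J by simp
  ultimately show "card (maximal_members \<I>) \<le> card (maximal_members (insert ?U \<I>)) + 1"
    using card_mono[OF fin sub] by simp
qed

lemma torus_dim_if_two_maximal_members:
  assumes M: "maximal_members \<I> = {J, J'}" "J \<noteq> J'" and J: "J \<in> branches \<I>"
  shows "torus_dim len (bending_group len \<I>) + 1 = card (branches \<I>)"
proof -
  let ?I = "\<I> - {J}"
  have max: "J \<in> maximal_members \<I>" "J' \<in> maximal_members \<I>" using M by auto
  note JI = maximal_member[OF max(1)] maximal_member[OF max(2)]
  have dis: "J \<inter> J' = {}" by (rule maximal_disjoint[OF max M(2)])
  have compl: "J' = - J"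
    using maximal_cover M(1) dis by blast
  obtain A B where AB: "A \<in> \<I>" "B \<in> \<I>" "A \<inter> B = {}" "J = A \<union> B"
    by (rule split_branch[OF J])
  have proper: "A \<noteq> J" "B \<noteq> J"
    using AB ne[OF AB(1)] ne[OF AB(2)] by blast+
  have top: "K = J" if "K \<in> \<I>" "J \<subseteq> K" for K
    using max(1) that by (simp add: maximal_members_def)
  have "bending_set len ?I"
    unfolding bending_set_def
  proof (intro conjI ballI allI)
    show "lopsided len I" if "I \<in> ?I" for I using that lop by auto
    show "{e} \<in> ?I" for e using J singletons by (auto simp: branches_def)
    show "A \<inter> B = {} \<or> A \<subseteq> B \<or> B \<subseteq> A" if "A \<in> ?I" "B \<in> ?I" for A B
      using that laminar[of A B] by simp
  qed
  moreover have "\<exists>I'\<in>?I. \<exists>I''\<in>?I. I' \<inter> I'' = {} \<and> I = I' \<union> I''" if I: "I \<in> ?I" "\<nexists>e. I = {e}" for I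
  proof -
    have "I \<in> branches \<I>" using I by (simp add: branches_def)
    then obtain I' I'' where s: "I' \<in> \<I>" "I'' \<in> \<I>" "I' \<inter> I'' = {}" "I = I' \<union> I''"
      by (rule split_branch)
    then have "I' \<noteq> J" "I'' \<noteq> J"
      using top[of I] I by auto
    then show ?thesis using s by blast
  qed
  ultimately interpret R: full_set len ?I
    using gen pos Pol_ne by unfold_locales (auto simp: full_bending_set_def)
  have sub: "{A, B, J'} \<subseteq> maximal_members ?I"
  proof -
    have "K = A" if "K \<in> ?I" "A \<subseteq> K" for K
    proof -
      have "K \<subseteq> J"
        using member_vs_maximal[OF max(1)] that AB(4) ne[OF AB(1)] by blast
      then have "K \<subset> A \<union> B" using that AB(4) by blast
      then have "K \<subseteq> A \<or> K \<subseteq> B"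
        using proper_subset_of_split[OF AB(1-3)] that by blast
      then show ?thesis using that AB(3) ne[OF AB(1)] by blast
    qed
    moreover have "K = B" if "K \<in> ?I" "B \<subseteq> K" for K
    proof -
      have "K \<subseteq> J"
        using member_vs_maximal[OF max(1)] that AB(4) ne[OF AB(2)] by blast
      then have "K \<subset> A \<union> B" using that AB(4) by blast
      then have "K \<subseteq> A \<or> K \<subseteq> B"
        using proper_subset_of_split[OF AB(1-3)] that by blast
      then show ?thesis using that AB(3) ne[OF AB(2)] by blast
    qed
    moreover have "K = J'" if "K \<in> ?I" "J' \<subseteq> K" for K
      using max(2) that by (simp add: maximal_members_def)
    ultimately show ?thesis
      using AB proper JI M(2) by (auto simp: maximal_members_def)
  qed
  have "card {A, B, J'} = 3"
    using AB dis ne[OF AB(1)] ne[OF AB(2)] by (auto simp: card_insert_if)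
  then have three: "3 \<le> card (maximal_members ?I)"
    using card_mono[OF _ sub] by (metis finite finite_subset subset_UNIV)
  have "bending_group len \<I> = bending_group len ?I"
  proof
    show "bending_group len ?I \<subseteq> bending_group len \<I>"
      by (rule bending_group_mono[OF gen pos]) (use lop in auto)
    show "bending_group len \<I> \<subseteq> bending_group len ?I"
    proof (rule bending_group_subsetI[OF gen pos])
      show "bending_flow len K t \<in> bending_group len ?I" if "K \<in> \<I>" for K t
      proof (cases "K = J")
        case True
        then have "bending_flow len K t = bending_flow len J' t"
          by (simp add: compl bending_flow_Compl)
        then show ?thesis
          using bending_flow_in_bending_group[of J' ?I len t] JI(2) M(2) by simp
      qed (use that in \<open>auto intro: bending_flow_in_bending_group\<close>)
    qed (use lop in auto)
  qed
  then have "torus_dim len (bending_group len \<I>) = card (branches ?I)"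
    using torus_dim_eq[OF R.hamiltonian_torus[OF three]] by simp
  moreover have "branches \<I> = insert J (branches ?I)" "J \<notin> branches ?I"
    using J by (auto simp: branches_def)
  moreover have "finite (branches ?I)" by (rule finite_subset[OF subset_UNIV]) simp
  ultimately show ?thesis by simp
qed

text \<open>With three maximal members the branches are counted by the dimension, with two they
  exceed it by one; in both cases \<open>card_UNIV_le\<close> bounds |E| by the dimension plus 3. A
  single maximal member would be the set of all edges, which is not lopsided.\<close>

lemma four_maximal_members:
  assumes dim: "torus_dim len (bending_group len \<I>) + 3 < CARD('e)"
  shows "4 \<le> card (maximal_members \<I>)"
proof (rule ccontr)
  let ?M = "maximal_members \<I>"
  assume "\<not> ?thesis"
  then consider "card ?M = 0" | "card ?M = 1" | "card ?M = 2" | "card ?M = 3" by linarith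
  then show False
  proof cases
    case 1
    then have "?M = {}" using finite_subset[OF subset_UNIV, of ?M] by simp
    then show False using maximal_cover by blast
  next
    case 2
    then obtain J where "?M = {J}" by (auto simp: card_1_singleton_iff)
    then have "J \<in> ?M" "J = UNIV" using maximal_cover by auto
    then show False using lop[OF maximal_member] UNIV_not_lopsided by blast
  next
    case 3
    then obtain J J' where M: "?M = {J, J'}" "J \<noteq> J'" by (auto simp: card_2_iff)
    have "J \<in> branches \<I> \<or> J' \<in> branches \<I>"
    proof (rule ccontr)
      assume "\<not> ?thesis"
      then obtain e f where "J = {e}" "J' = {f}"
        using M maximal_member[of J] maximal_member[of J'] by (auto simp: branches_def)
      then have "UNIV = {e, f}" using maximal_cover M(1) by blast
      then have "CARD('e) = card {e, f}" by (rule arg_cong)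
      also have "\<dots> \<le> 2" by (simp add: card_insert_if)
      finally show False using dim by simp
    qed
    then have "torus_dim len (bending_group len \<I>) + 1 = card (branches \<I>)"
      using torus_dim_if_two_maximal_members[of J J'] torus_dim_if_two_maximal_members[of J' J] M
      by (auto simp: insert_commute)
    then show False using card_UNIV_le dim 3 by simp
  next
    case 4
    then have "torus_dim len (bending_group len \<I>) = card (branches \<I>)"
      using torus_dim_eq[OF hamiltonian_torus] by simp
    then show False using card_UNIV_le dim 4 by simp
  qed
qed

section \<open>Comparison with larger bending tori\<close>

lemma bending_torus_full:
  assumes "3 \<le> card (maximal_members \<I>)"
  shows "bending_torus len (bending_group len \<I>)"
  unfolding bending_torus_def hamiltonian_torus_def using hamiltonian_torus[OF assms] lop by blast

lemma bending_group_subset_if_no_lopsided_pair: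
  assumes three: "3 \<le> card (maximal_members \<I>)"
    and no_pair: "\<And>J J'. J \<in> maximal_members \<I> \<Longrightarrow> J' \<in> maximal_members \<I> \<Longrightarrow> J \<noteq> J' \<Longrightarrow> \<not> lopsided len (J \<union> J')"
    and T: "bending_torus len T" and sub: "bending_group len \<I> \<subseteq> T"
  shows "T \<subseteq> bending_group len \<I>"
proof -
  obtain \<K> where \<K>: "\<forall>K\<in>\<K>. lopsided len K" "T = bending_group len \<K>"
    using T by (auto simp: bending_torus_def)
  obtain k where tor: "hamiltonian_torus_of_dim len k T"
    using T by (auto simp: bending_torus_def hamiltonian_torus_def)
  then have symp: "T \<subseteq> symplectomorphisms len"
    by (simp add: hamiltonian_torus_of_dim_def)
  \<comment> \<open>A torus is commutative because angles add; this is what the classification of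
    the further generators K rests on.\<close>
  have comm: "x \<otimes>\<^bsub>BijGroup (Pol len)\<^esub> y = y \<otimes>\<^bsub>BijGroup (Pol len)\<^esub> x" if "x \<in> T" "y \<in> T" for x y
  proof -
    from tor obtain \<theta> :: "(nat \<Rightarrow> real) \<Rightarrow> (real^3^'e) set \<Rightarrow> (real^3^'e) set"
      where \<theta>: "range \<theta> = T" "\<forall>a b. \<theta> (\<lambda>i. a i + b i) = \<theta> a \<otimes>\<^bsub>BijGroup (Pol len)\<^esub> \<theta> b"
      unfolding hamiltonian_torus_of_dim_def by (elim conjE exE)
    obtain a b where "x = \<theta> a" "y = \<theta> b"
      using \<open>x \<in> T\<close> \<open>y \<in> T\<close> \<theta>(1) by blast
    then show ?thesis
      using \<theta>(2)[rule_format, of a b] \<theta>(2)[rule_format, of b a] by (simp add: add.commute)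
  qed
  have "bending_flow len K t \<in> bending_group len \<I>" if K: "K \<in> \<K>" for K t
  proof -
    have lK: "lopsided len K" using K \<K>(1) by blast
    have KT: "bending_flow len K t \<in> T" for t
      unfolding \<K>(2) by (rule bending_flow_in_bending_group[OF K])
    have "K \<inter> I = {} \<or> K \<subseteq> I \<or> I \<subseteq> K \<or> K \<union> I = UNIV" if I: "I \<in> \<I>" for I
    proof (rule commuting_bending_flows[OF gen pos Pol_ne lK lop[OF I]])
      have IT: "bending_flow len I s \<in> T" for s
        using bending_flow_in_bending_group[OF I] sub by blast
      then show "bending_flow len I s \<in> symplectomorphisms len" for s
        using symp by blast
      fix s t p assume p: "p \<in> Pol len"
      have "bending_flow len K t \<otimes>\<^bsub>BijGroup (Pol len)\<^esub> bending_flow len I s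
          = bending_flow len I s \<otimes>\<^bsub>BijGroup (Pol len)\<^esub> bending_flow len K t"
        by (rule comm[OF KT IT])
      then have "compose (Pol len) (bending_flow len K t) (bending_flow len I s)
          = compose (Pol len) (bending_flow len I s) (bending_flow len K t)"
        using bending_flow_Bij[OF gen pos lK] bending_flow_Bij[OF gen pos lop[OF I]] by (simp add: BijGroup_def)
      from fun_cong[OF this, of p] p
      show "bending_flow len K t (bending_flow len I s p) = bending_flow len I s (bending_flow len K t p)"
        by (simp add: compose_def)
    qed
    then consider "K \<in> \<I>" | "- K \<in> \<I>"
      using lopsided_compatible_set[OF three lK no_pair] by blast
    then show ?thesis
    proof cases
      case 2
      then show ?thesis
        using bending_flow_in_bending_group[OF 2, of len t] by (simp add: bending_flow_Compl)
    qed (rule bending_flow_in_bending_group)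
  qed
  then show ?thesis
    unfolding \<K>(2) using lop by (intro bending_group_subsetI[OF gen pos]) auto
qed

text \<open>By maximality the group of the extended set would be the same torus, but the extra
  branch gives it a different dimension. Four maximal members are assumed so that three are left
  after the merge.\<close>

lemma not_maximal_if_lopsided_pair:
  assumes four: "4 \<le> card (maximal_members \<I>)" and J: "J \<in> maximal_members \<I>" "J' \<in> maximal_members \<I>" "J \<noteq> J'"
    and lopJ: "lopsided len (J \<union> J')"
  shows "\<not> maximal_bending_torus len (bending_group len \<I>)"
proof
  assume max: "maximal_bending_torus len (bending_group len \<I>)"
  interpret X: full_set len "insert (J \<union> J') \<I>"
    by (rule full_set_insert_union(1)[OF J lopJ])
  have three: "3 \<le> card (maximal_members (insert (J \<union> J') \<I>))"
    using full_set_insert_union(3)[OF J lopJ] four by simp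
  have "bending_group len \<I> \<subseteq> bending_group len (insert (J \<union> J') \<I>)"
    by (rule bending_group_mono[OF gen pos]) (use X.lop in auto)
  then have "bending_group len (insert (J \<union> J') \<I>) = bending_group len \<I>"
    using max X.bending_torus_full[OF three] unfolding maximal_bending_torus_def by blast
  then have "card (branches (insert (J \<union> J') \<I>)) = card (branches \<I>)"
    using hamiltonian_torus_dim_unique[OF X.hamiltonian_torus[OF three]] hamiltonian_torus four by simp
  then show False
    using full_set_insert_union(2)[OF J lopJ] by simp
qed

end

theorem proposition3p3:
  fixes len :: "'e::finite \<Rightarrow> real" and \<I> :: "'e set set"
  assumes "\<forall>e. len e > 0"
    and "generic len"
    and "Pol len \<noteq> {}"
    and "full_bending_set len \<I>"
    and "torus_dim len (bending_group len \<I>) + 3 < CARD('e)"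
  shows "maximal_bending_torus len (bending_group len \<I>) \<longleftrightarrow>
    (\<Inter>J\<in>maximal_members \<I>. bend_length J ` Pol len) \<noteq> {}"
proof -
  interpret full_set len \<I>
    using assms by unfold_locales auto
  have four: "4 \<le> card (maximal_members \<I>)"
    by (rule four_maximal_members[OF assms(5)])
  show ?thesis
  proof (cases "\<exists>J\<in>maximal_members \<I>. \<exists>J'\<in>maximal_members \<I>. J \<noteq> J' \<and> lopsided len (J \<union> J')")
    case True
    then obtain J J' where J: "J \<in> maximal_members \<I>" "J' \<in> maximal_members \<I>" "J \<noteq> J'" "lopsided len (J \<union> J')"
      by blast
    have "bend_length J ` Pol len \<inter> bend_length J' ` Pol len = {}"
      by (rule lopsided_union_disjoint_images[OF J(4) maximal_disjoint[OF J(1-3)]])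
    then have "(\<Inter>J\<in>maximal_members \<I>. bend_length J ` Pol len) = {}"
      using J(1,2) by blast
    then show ?thesis
      using not_maximal_if_lopsided_pair[OF four J] by blast
  next
    case False
    then have no_pair: "\<not> lopsided len (J \<union> J')"
      if "J \<in> maximal_members \<I>" "J' \<in> maximal_members \<I>" "J \<noteq> J'" for J J'
      using that by blast
    have two: "2 \<le> card (maximal_members \<I>)" and three: "3 \<le> card (maximal_members \<I>)"
      using four by simp_all
    obtain \<rho> s where \<rho>: "\<rho> \<in> closed_polygons len" "\<And>J. J \<in> maximal_members \<I> \<Longrightarrow> norm (block_sum J \<rho>) = s"
      using equilateral_polygon[OF two no_pair] by blast
    then have "s \<in> (\<Inter>J\<in>maximal_members \<I>. bend_length J ` Pol len)"
      unfolding bend_length_image by blast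
    moreover have "maximal_bending_torus len (bending_group len \<I>)"
      unfolding maximal_bending_torus_def
    proof (intro conjI allI impI)
      show "bending_torus len (bending_group len \<I>)"
        by (rule bending_torus_full[OF three])
      fix T assume T: "bending_torus len T \<and> bending_group len \<I> \<subseteq> T"
      then have "T \<subseteq> bending_group len \<I>"
        using bending_group_subset_if_no_lopsided_pair[OF three no_pair] by blast
      with T show "T = bending_group len \<I>" by blast
    qed
    ultimately show ?thesis by blast
  qed
qed

end
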